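(* Let $n, N \ge 1$ be integers and let $\Omega$ be a domain in $\mathbb C^n$. Suppose $u: \Omega\rightarrow \mathbb C^N$ with $u\in W_{loc}^{1,1}(\Omega)$ satisfies $|\bar\partial u| \le V|u|$ a.e. on $\Omega$ for some nonnegative function $V \in L_{loc}^{p}(\Omega)$ with $p>2n$. If $u$ vanishes to infinite order in the $L^1$ sense at some $z_0\in \Omega$, then $u$ vanishes identically on $\Omega$.
   Context: A domain is a nonempty connected open set. For $u=(u_1,\dots,u_N)\in W^{1,1}_{loc}(\Omega)$ (componentwise Sobolev, with weak derivatives), $|u| := \left(\sum_{k=1}^N |u_k|^2\right)^{1/2}$ and $|\bar\partial u| := \left(\sum_{j=1}^n\sum_{k=1}^N |\bar\partial_j u_k|^2\right)^{1/2}$, where $\bar\partial_j = \partial/\partial \bar z_j$ is taken in the weak sense. For $q\ge 1$, $u\in L^q_{loc}(\Omega)$ is said to vanish to infinite order in the $L^q$ sense at $z_0\in\Omega$ if for all $m\ge 1$, $\lim_{r\to 0} r^{-m}\int_{|z-z_0|<r}|u(z)|^q\,dv_z = 0$, where $dv$ is Lebesgue measure. "Vanishes identically" means $u=0$ as an element of $L^1_{loc}(\Omega)$, i.e. a.e. on $\Omega$. *)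

theory Defs
  imports "HOL-Analysis.Analysis"
begin

definition L_loc :: "real \<Rightarrow> 'a::euclidean_space set \<Rightarrow> ('a \<Rightarrow> 'b::euclidean_space) \<Rightarrow> bool" where
  "L_loc p \<Omega> f \<longleftrightarrow>
     set_borel_measurable lebesgue \<Omega> f \<and>
     (\<forall>K. compact K \<and> K \<subseteq> \<Omega> \<longrightarrow> set_integrable lebesgue K (\<lambda>x. norm (f x) powr p))"

primrec C_k :: "nat \<Rightarrow> ('a::euclidean_space \<Rightarrow> real) \<Rightarrow> bool" where
  "C_k 0 \<phi> \<longleftrightarrow> continuous_on UNIV \<phi>"
| "C_k (Suc k) \<phi> \<longleftrightarrow>
     (\<forall>x. \<phi> differentiable (at x)) \<and> (\<forall>v. C_k k (\<lambda>x. frechet_derivative \<phi> (at x) v))"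

text \<open>Real-valued test functions: members of $C_c^\infty(\Omega)$, extended by zero outside $\Omega$.\<close>

definition test_function :: "'a::euclidean_space set \<Rightarrow> ('a \<Rightarrow> real) \<Rightarrow> bool" where
  "test_function \<Omega> \<phi> \<longleftrightarrow>
     (\<forall>k. C_k k \<phi>) \<and> compact (closure {x. \<phi> x \<noteq> 0}) \<and> closure {x. \<phi> x \<noteq> 0} \<subseteq> \<Omega>"

definition has_weak_partial ::
    "'a::euclidean_space set \<Rightarrow> 'a \<Rightarrow> ('a \<Rightarrow> 'b::euclidean_space) \<Rightarrow> ('a \<Rightarrow> 'b) \<Rightarrow> bool" where
  "has_weak_partial \<Omega> v f g \<longleftrightarrow>
     L_loc 1 \<Omega> f \<and> L_loc 1 \<Omega> g \<and>
     (\<forall>\<phi>. test_function \<Omega> \<phi> \<longrightarrow>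
        (LINT x:\<Omega>|lebesgue. frechet_derivative \<phi> (at x) v *\<^sub>R f x) =
        - (LINT x:\<Omega>|lebesgue. \<phi> x *\<^sub>R g x))"

text \<open>A representative of the weak derivative in the direction \<open>v\<close>. It is determined only up to
  a null subset of \<open>\<Omega>\<close>, and is meaningful only if the weak derivative exists, as is the case
  for functions in \<open>W11_loc\<close> below.\<close>

definition weak_partial ::
    "'a::euclidean_space set \<Rightarrow> 'a \<Rightarrow> ('a \<Rightarrow> 'b::euclidean_space) \<Rightarrow> ('a \<Rightarrow> 'b)" where
  "weak_partial \<Omega> v f = (SOME g. has_weak_partial \<Omega> v f g)"

definition W11_loc :: "'a::euclidean_space set \<Rightarrow> ('a \<Rightarrow> 'b::euclidean_space) \<Rightarrow> bool" where
  "W11_loc \<Omega> f \<longleftrightarrow> L_loc 1 \<Omega> f \<and> (\<forall>b\<in>Basis. \<exists>g. has_weak_partial \<Omega> b f g)"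

text \<open>$\bar\partial_j = \frac12(\partial_{x_j} + i\,\partial_{y_j})$ in the weak sense, where the
  unit vectors of the real coordinates $x_j$, $y_j$ of $z_j = x_j + i y_j$ are
  \<open>axis j 1\<close> and \<open>axis j \<i>\<close>.\<close>

definition weak_dbar ::
    "(complex ^ 'n) set \<Rightarrow> 'n \<Rightarrow> (complex ^ 'n \<Rightarrow> complex) \<Rightarrow> (complex ^ 'n \<Rightarrow> complex)" where
  "weak_dbar \<Omega> j f z =
     (weak_partial \<Omega> (axis j 1) f z + \<i> * weak_partial \<Omega> (axis j \<i>) f z) / 2"

definition norm_dbar ::
    "(complex ^ 'n) set \<Rightarrow> (complex ^ 'n \<Rightarrow> complex ^ 'm) \<Rightarrow> (complex ^ 'n \<Rightarrow> real)" where
  "norm_dbar \<Omega> u z =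
     sqrt (\<Sum>j\<in>UNIV. \<Sum>k\<in>UNIV. (cmod (weak_dbar \<Omega> j (\<lambda>w. u w $ k) z))\<^sup>2)"

text \<open>For \<open>z0\<close> in an open set on which \<open>u\<close> is locally in $L^q$; the integral over
  \<open>ball z0 r\<close> is then meaningful for all sufficiently small \<open>r\<close>.\<close>

definition vanishes_to_infinite_order ::
    "real \<Rightarrow> ('a::euclidean_space \<Rightarrow> 'b::euclidean_space) \<Rightarrow> 'a \<Rightarrow> bool" where
  "vanishes_to_infinite_order q u z0 \<longleftrightarrow>
     (\<forall>m::nat\<ge>1.
        ((\<lambda>r::real. (LINT z:ball z0 r|lebesgue. norm (u z) powr q) / r ^ m) \<longlongrightarrow> 0) (at_right 0))"

end

theory Submission
  imports Defs
begin

text \<open>The theorem is reduced to one complex variable by restricting \<open>u\<close> to the complex lines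
\<open>\<mu> \<mapsto> z0 + \<mu> \<omega>\<close> through \<open>z0\<close>, and on almost every such line it is proved by a Carleman estimate
with the weights \<open>\<mu>\<^sup>-\<^sup>m\<close>, \<open>m \<longrightarrow> \<infinity>\<close>.

The condition \<open>p > 2n\<close> is what survives the restriction.  Lebesgue measure on \<open>C\<^sup>n\<close> becomes
\<open>|\<mu>|\<^sup>2\<^sup>n\<^sup>-\<^sup>2\<close> times plane measure on the lines, so a function \<open>V \<in> L\<^sup>p\<close> restricts to almost every
line with a bound on the integral of \<open>|\<mu>|\<^sup>a V\<^sup>p\<close>, for any \<open>a > 2n - 2\<close>
(\<open>AE_slice_integral_finite\<close>).  Since \<open>p > 2n\<close>, the exponent can be chosen with \<open>a < p - 2\<close>, and then
Young's inequality bounds \<open>V(\<mu>) / |\<mu> - \<zeta>|\<close> by \<open>V\<^sup>p |\<mu>|\<^sup>a\<close> plus the singularities \<open>|\<mu>|\<close> and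
\<open>|\<mu> - \<zeta>|\<close> to a power larger than \<open>-2\<close> (\<open>young_kernel_bound\<close>).  Hence the Cauchy potential of
\<open>V\<close> restricted to a thin annulus is small, uniformly in \<open>\<zeta>\<close> (\<open>thin_annulus_kato\<close>).

In one variable, a compactly supported \<open>v\<close> is bounded at \<open>z\<close> by the integral of
\<open>|dbar v(\<zeta>)| / |\<zeta> - z|\<close> (\<open>pompeiu_inequality\<close>).  Multiplying by a weight \<open>w\<close> whose Cauchy potential
is at most \<open>\<kappa>\<close> and integrating gives \<open>\<integral> w |v| \<le> C \<kappa> \<integral> |dbar v|\<close> by Tonelli
(\<open>carleman_inequality\<close>).  Because \<open>z\<^sup>-\<^sup>m\<close> is holomorphic away from \<open>0\<close>, the same inequality holds for
\<open>z\<^sup>-\<^sup>m v\<close> with \<open>z\<^sup>-\<^sup>m dbar v\<close> on the right and a constant that does not depend on \<open>m\<close>.  If \<open>u\<close> vanishes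
for \<open>|z| \<le> S\<close>, this is applied with \<open>w = V + 1\<close> on a thin annulus \<open>S < |z| < S + \<delta>\<close> to \<open>u\<close>
times a cutoff.  The hypothesis \<open>|dbar u| \<le> V |u|\<close> lets the left side absorb the main term on
the right.  What remains comes from the derivative of the cutoff: the part near \<open>0\<close> disappears since
\<open>u\<close> vanishes there to infinite order, and the part at \<open>|z| \<ge> b\<^sub>1 > S\<close> carries at most \<open>b\<^sub>1\<^sup>-\<^sup>m\<close>,
which for \<open>m \<longrightarrow> \<infinity>\<close> is too small to compensate a nonzero \<open>u\<close> at any \<open>|z| < b < b\<^sub>1\<close>.  So the disc of
vanishing always grows, and it is the whole disc (\<open>disc_unique_continuation\<close>).  The width \<open>\<delta>\<close> depends
on the line, but this is harmless as the argument never leaves the line.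

A Sobolev function has no restriction to a single line.  The inequalities above involve \<open>L\<^sup>1\<close> norms
only, so they pass to limits: mollification gives \<open>C\<^sup>1\<close> functions that converge with their
derivatives in \<open>L\<^sup>1\<close> (\<open>friedrichs_approximation\<close>), and if the errors are summable then they
are summable on almost every line.

Altogether \<open>u\<close> vanishes on each ball about \<open>z0\<close> whose closure lies in \<open>\<Omega>\<close>
(\<open>infinite_order_imp_vanish_on_ball\<close>).  The radius depends on the distance to the complement of \<open>\<Omega>\<close>
only, so the points near which \<open>u\<close> vanishes form a set that is open and closed in the connected set \<open>\<Omega>\<close>.\<close>

section \<open>Smooth test functions\<close>

text \<open>The index \<open>k\<close> makes the family closed under differentiation up to linear combinations, which is
what an induction over the order of smoothness needs.\<close>

definition exp_flat :: "nat \<Rightarrow> real \<Rightarrow> real" where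
  "exp_flat k t = (if t > 0 then exp (- (1 / t)) / t ^ k else 0)"

lemma power_le_fact_exp:
  fixes x :: real
  assumes "x \<ge> 0"
  shows "x ^ n \<le> fact n * exp x"
proof -
  have "(\<Sum>i\<in>{n}. x ^ i /\<^sub>R fact i) \<le> exp x"
    unfolding exp_def
    by (rule sum_le_suminf[OF summable_exp_generic]) (use assms in auto)
  then have "inverse (fact n) * x ^ n \<le> exp x"
    by simp
  then show ?thesis by (simp add: field_simps)
qed

text \<open>This gives differentiability at \<open>0\<close>: the difference quotient of \<open>exp_flat k\<close> there is
\<open>exp_flat (k + 1)\<close>.\<close>

lemma exp_flat_bound: "\<bar>exp_flat k t\<bar> \<le> fact (Suc k) * \<bar>t\<bar>"
proof (cases "t > 0")
  case True
  define c :: real where "c = fact (Suc k)"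
  have "(1 / t) ^ Suc k \<le> c * exp (1 / t)"
    unfolding c_def using True by (intro power_le_fact_exp) simp
  then have "exp (- (1 / t)) \<le> c * t ^ Suc k"
    using True by (simp add: exp_minus field_simps)
  then show ?thesis
    unfolding c_def[symmetric] using True by (simp add: exp_flat_def field_simps)
next
  case False
  have "0 \<le> fact (Suc k) * \<bar>t\<bar>" by (intro mult_nonneg_nonneg) auto
  then show ?thesis using False by (simp add: exp_flat_def del: fact_Suc)
qed

lemma exp_flat_has_derivative:
  "(exp_flat k has_real_derivative exp_flat (k + 2) t - real k * exp_flat (k + 1) t) (at t)"
proof -
  consider "t > 0" | "t < 0" | "t = 0" by linarith
  then show ?thesis
  proof cases
    case 1
    have "((\<lambda>t. exp (- (1 / t)) / t ^ k) has_real_derivative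
        exp_flat (k + 2) t - real k * exp_flat (k + 1) t) (at t)"
      using 1 by (auto intro!: derivative_eq_intros simp: exp_flat_def field_simps power2_eq_square)
         (cases k; simp add: field_simps)
    then show ?thesis
      by (rule has_field_derivative_transform_within_open[where S="{0<..}"])
         (use 1 in \<open>auto simp: exp_flat_def\<close>)
  next
    case 2
    have "((\<lambda>t. 0) has_real_derivative exp_flat (k + 2) t - real k * exp_flat (k + 1) t) (at t)"
      using 2 by (simp add: exp_flat_def)
    then show ?thesis
      by (rule has_field_derivative_transform_within_open[where S="{..<0}"])
         (use 2 in \<open>auto simp: exp_flat_def\<close>)
  next
    case 3
    have "((\<lambda>h. exp_flat (Suc k) h) \<longlongrightarrow> 0) (at 0)"
    proof (rule Lim_null_comparison)
      show "((\<lambda>h. fact (Suc (Suc k)) * \<bar>h\<bar>) \<longlongrightarrow> (0::real)) (at 0)"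
        by (auto intro!: tendsto_eq_intros)
      show "\<forall>\<^sub>F h in at 0. norm (exp_flat (Suc k) h) \<le> fact (Suc (Suc k)) * \<bar>h\<bar>"
        unfolding real_norm_def by (intro always_eventually allI exp_flat_bound)
    qed
    then have "((\<lambda>h. (exp_flat k (0 + h) - exp_flat k 0) / h) \<longlongrightarrow> 0) (at 0)"
      by (rule Lim_transform_eventually)
         (auto simp: eventually_at exp_flat_def intro!: exI[of _ 1])
    then show ?thesis
      using 3 by (simp add: DERIV_def exp_flat_def)
  qed
qed

lemma continuous_exp_flat: "continuous_on UNIV (exp_flat k)"
  using exp_flat_has_derivative by (meson DERIV_isCont continuous_at_imp_continuous_on)

lemma C_k_Suc_imp: "C_k (Suc k) f \<Longrightarrow> C_k k f"
proof (induction k arbitrary: f)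
  case 0
  then show ?case
    by (auto intro!: continuous_at_imp_continuous_on differentiable_imp_continuous_within)
next
  case (Suc k)
  then show ?case by (metis C_k.simps(2))
qed

text \<open>The two defining clauses of \<open>C_k (Suc k)\<close> mention \<open>frechet_derivative\<close>; this form accepts
whatever expression a derivative rule produces.\<close>

lemma C_k_SucI:
  assumes "\<And>x. (f has_derivative f' x) (at x)" "\<And>v. C_k k (\<lambda>x. f' x v)"
  shows "C_k (Suc k) f"
proof -
  have "frechet_derivative f (at x) = f' x" for x
    using assms(1) by (metis frechet_derivative_at)
  then show ?thesis
    using assms by (auto simp: differentiable_def)
qed

lemma C_k_deriv:
  assumes "C_k (Suc k) f"
  shows "(f has_derivative frechet_derivative f (at x)) (at x)" 
    "C_k k (\<lambda>x. frechet_derivative f (at x) v)"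
  using assms by (auto simp: frechet_derivative_works)

lemma C_k_add: "C_k k f \<Longrightarrow> C_k k g \<Longrightarrow> C_k k (\<lambda>x. f x + g x)"
proof (induction k arbitrary: f g)
  case 0
  then show ?case by (auto intro: continuous_intros)
next
  case (Suc k)
  show ?case
    by (rule C_k_SucI[OF has_derivative_add[OF C_k_deriv(1)[OF Suc(2)] C_k_deriv(1)[OF Suc(3)]]])
       (intro Suc.IH C_k_deriv(2) Suc.prems)
qed

lemma C_k_mult: "C_k k f \<Longrightarrow> C_k k g \<Longrightarrow> C_k k (\<lambda>x. f x * g x)"
proof (induction k arbitrary: f g)
  case 0
  then show ?case by (auto intro: continuous_intros)
next
  case (Suc k)
  show ?case
    by (rule C_k_SucI[OF has_derivative_mult[OF C_k_deriv(1)[OF Suc(2)] C_k_deriv(1)[OF Suc(3)]]])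
       (intro C_k_add Suc.IH C_k_deriv(2) Suc.prems C_k_Suc_imp)
qed

lemma C_k_const: "C_k k (\<lambda>x. c)"
  by (induction k arbitrary: c) (auto intro!: C_k_SucI[where f'="\<lambda>x v. 0"] simp del: C_k.simps(2))

lemma C_k_affine: "C_k k (\<lambda>x::'a::euclidean_space. c * ((x - a) \<bullet> v))"
proof (cases k)
  case (Suc j)
  show ?thesis
    unfolding Suc
    by (rule C_k_SucI[where f'="\<lambda>x h. c * (h \<bullet> v)"])
       (auto intro!: derivative_eq_intros C_k_const)
qed (auto intro!: continuous_intros)

lemma C_k_exp_flat_radial: 
  "C_k j (\<lambda>y::'a::euclidean_space. exp_flat k (r - (y - x) \<bullet> (y - x)))"
proof (induction j arbitrary: k)
  case 0
  show ?case
    by (auto intro!: continuous_on_compose2[OF continuous_exp_flat] continuous_intros)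
next
  case (Suc j)
  let ?q = "\<lambda>y. r - (y - x) \<bullet> (y - x)"
  have der: "((\<lambda>y. exp_flat k (?q y)) has_derivative (\<lambda>v.
      (exp_flat (k + 2) (?q y) + (- real k) * exp_flat (k + 1) (?q y)) * ((-2) * ((y - x) \<bullet> v)))) (at y)" for y
  proof -
    have q: "(?q has_derivative (\<lambda>v. (-2) * ((y - x) \<bullet> v))) (at y)"
      by (auto intro!: derivative_eq_intros simp: inner_commute)
    show ?thesis
      using has_derivative_compose[OF q has_field_derivative_imp_has_derivative[OF exp_flat_has_derivative[of k "?q y"]]]
      by simp
  qed
  show ?case
    by (rule C_k_SucI[OF der])
       (intro C_k_mult C_k_add C_k_const Suc.IH C_k_affine)
qed

text \<open>The factor \<open>c\<close> is a slot for normalisation: translates of one mollifying kernel are of this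
form, so that they may be used as test functions.\<close>

lemma test_function_exp_flat_radial:
  fixes x :: "'a::euclidean_space"
  assumes "r > 0" "cball x r \<subseteq> \<Omega>"
  shows "test_function \<Omega> (\<lambda>y. c * exp_flat 0 (r\<^sup>2 - (y - x) \<bullet> (y - x)))"
proof -
  let ?\<phi> = "\<lambda>y. c * exp_flat 0 (r\<^sup>2 - (y - x) \<bullet> (y - x))"
  have "y \<in> cball x r" if "?\<phi> y \<noteq> 0" for y
  proof -
    have "(norm (y - x))\<^sup>2 < r\<^sup>2"
      using that by (auto simp: exp_flat_def power2_norm_eq_inner split: if_splits)
    then have "norm (y - x) < r"
      using assms(1) by (simp add: power_less_imp_less_base)
    then show ?thesis by (simp add: dist_norm norm_minus_commute)
  qed
  then have sub: "closure {y. ?\<phi> y \<noteq> 0} \<subseteq> cball x r"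
    by (intro closure_minimal) auto
  then have "compact (closure {y. ?\<phi> y \<noteq> 0})"
    unfolding compact_eq_bounded_closed
    by (intro conjI closed_closure bounded_subset[OF bounded_cball])
  then show ?thesis
    using sub assms by (auto simp: test_function_def intro!: C_k_mult C_k_const C_k_exp_flat_radial)
qed

section \<open>Mollification\<close>

lemma nn_integral_lborel_translate:
  fixes c :: "'a::euclidean_space"
  assumes [measurable]: "f \<in> borel_measurable borel"
  shows "(\<integral>\<^sup>+x. f (c + x) \<partial>lborel) = (\<integral>\<^sup>+x. f x \<partial>lborel)"
  by (subst (2) lborel_distr_plus[of c, symmetric]) (simp add: nn_integral_distr)

lemma lborel_distr_reflect: "distr lborel borel (\<lambda>x::'a::euclidean_space. c - x) = lborel"
  using lborel_affine[of "-1" c] by (simp add: density_1)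

lemma nn_integral_lborel_reflect:
  fixes c :: "'a::euclidean_space"
  assumes [measurable]: "f \<in> borel_measurable borel"
  shows "(\<integral>\<^sup>+x. f (c - x) \<partial>lborel) = (\<integral>\<^sup>+x. f x \<partial>lborel)"
  by (subst (2) lborel_distr_reflect[of c, symmetric]) (simp add: nn_integral_distr)

lemma integral_lborel_translate:
  fixes c :: "'a::euclidean_space" and f :: "'a \<Rightarrow> 'b::{banach, second_countable_topology}"
  assumes [measurable]: "f \<in> borel_measurable borel"
  shows "(LINT x|lborel. f (c + x)) = (LINT x|lborel. f x)"
  by (subst (2) lborel_distr_plus[of c, symmetric]) (simp add: integral_distr)

lemma integrable_lborel_translate:
  fixes c :: "'a::euclidean_space" and f :: "'a \<Rightarrow> 'b::{banach, second_countable_topology}"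
  assumes "integrable lborel f"
  shows "integrable lborel (\<lambda>x. f (c + x))"
proof -
  have "integrable (distr lborel borel ((+) c)) f" using assms by (simp add: lborel_distr_plus)
  then show ?thesis using borel_measurable_integrable[OF assms] by (subst (asm) integrable_distr_eq) auto
qed

lemma integral_lborel_reflect:
  fixes c :: "'a::euclidean_space" and f :: "'a \<Rightarrow> 'b::{banach, second_countable_topology}"
  assumes [measurable]: "f \<in> borel_measurable borel"
  shows "(LINT x|lborel. f (c - x)) = (LINT x|lborel. f x)"
  by (subst (2) lborel_distr_reflect[of c, symmetric]) (simp add: integral_distr)

lemma lborel_inner_compact:
  fixes A :: "'a::euclidean_space set"
  assumes A: "A \<in> sets borel" "emeasure lborel A < \<infinity>" and "e > 0"
  obtains K where "compact K" "K \<subseteq> A" "emeasure lborel (A - K) < ennreal e"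
proof -
  obtain T where T: "closed T" "T \<subseteq> A" "emeasure lebesgue (A - T) < ennreal (e / 2)"
    using sets_lebesgue_inner_closed[OF _ half_gt_zero[OF \<open>e > 0\<close>]] A(1)
    by (metis sets_completionI_sets sets_lborel)
  define D where "D n = A - cball 0 (real n)" for n
  have [measurable]: "A \<in> sets borel" "T \<in> sets borel" using A T by auto
  have "(\<lambda>n. emeasure lborel (D n)) \<longlonglongrightarrow> emeasure lborel (\<Inter>n. D n)"
  proof (rule Lim_emeasure_decseq)
    show "emeasure lborel (D n) \<noteq> \<infinity>" for n
      using emeasure_mono[of "D n" A lborel] A by (auto simp: D_def top_unique)
  qed (use A in \<open>auto simp: D_def decseq_def\<close>)
  moreover have "(\<Inter>n. D n) = {}"
    using real_arch_simple by (auto simp: D_def)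
  ultimately have "(\<lambda>n. emeasure lborel (D n)) \<longlonglongrightarrow> 0" by simp
  then have "\<forall>\<^sub>F n in sequentially. emeasure lborel (D n) < ennreal (e / 2)"
    using \<open>e > 0\<close> by (intro order_tendstoD) auto
  then obtain n where n: "emeasure lborel (D n) < ennreal (e / 2)"
    by (auto simp: eventually_sequentially)
  show ?thesis
  proof
    show "compact (T \<inter> cball 0 (real n))" using T by (simp add: closed_Int_compact)
    show "T \<inter> cball 0 (real n) \<subseteq> A" using T by auto
    have "emeasure lborel (A - T \<inter> cball 0 (real n)) \<le> emeasure lborel ((A - T) \<union> D n)"
      by (intro emeasure_mono) (auto simp: D_def)
    also have "\<dots> \<le> emeasure lborel (A - T) + emeasure lborel (D n)"
      by (intro emeasure_subadditive) (auto simp: D_def)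
    also have "\<dots> < ennreal (e / 2) + ennreal (e / 2)"
      using T n by (intro add_strict_mono) auto
    also have "\<dots> = ennreal e" using \<open>e > 0\<close> by (simp flip: ennreal_plus)
    finally show "emeasure lborel (A - T \<inter> cball 0 (real n)) < ennreal e" .
  qed
qed

text \<open>For the indicator of \<open>A\<close>, squeezed as \<open>K \<subseteq> A \<subseteq> U\<close> between a compact and an open set of almost
the same measure, a translation shorter than the distance from \<open>K\<close> to the complement of \<open>U\<close> moves points
in or out of \<open>A\<close> only through \<open>U - K\<close>.  The property is then inherited by sums and by
dominated limits.\<close>

lemma translation_continuous_L1:
  fixes f :: "'a::euclidean_space \<Rightarrow> 'b::{banach, second_countable_topology}"
  assumes "integrable lborel f"
  shows "\<forall>e>0. \<exists>d>0. \<forall>h. norm h < d \<longrightarrow> (\<integral>\<^sup>+x. norm (f (h + x) - f x) \<partial>lborel) \<le> ennreal e"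
  using assms
proof (induction rule: integrable_induct)
  case (base A c)
  show ?case
  proof safe
    fix e :: real assume "e > 0"
    define e' where "e' = e / (2 * (norm c + 1))"
    have e': "e' > 0" using \<open>e > 0\<close> by (simp add: e'_def add_nonneg_pos)
    have A[measurable]: "A \<in> sets borel" using base by simp
    obtain K where K: "compact K" "K \<subseteq> A" "emeasure lborel (A - K) < ennreal (e' / 2)"
      using lborel_inner_compact[OF A base(2) half_gt_zero[OF e']] by blast
    obtain U where U: "open U" "A \<subseteq> U" "emeasure lborel (U - A) < ennreal (e' / 2)"
      using outer_regular_lborel[OF A half_gt_zero[OF e']] by blast
    have [measurable]: "K \<in> sets borel" "U \<in> sets borel"
      by (simp_all add: K(1) U(1) borel_compact)
    have "emeasure lborel (U - K) \<le> emeasure lborel ((U - A) \<union> (A - K))"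
      by (intro emeasure_mono) auto
    also have "\<dots> \<le> emeasure lborel (U - A) + emeasure lborel (A - K)"
      by (intro emeasure_subadditive) auto
    also have "\<dots> \<le> ennreal (e' / 2) + ennreal (e' / 2)"
      using K U by (intro add_mono) auto
    also have "\<dots> = ennreal e'" using e' by (simp flip: ennreal_plus)
    finally have UK: "emeasure lborel (U - K) \<le> ennreal e'" .
    have "\<exists>d>0. \<forall>x\<in>K. \<forall>y\<in>- U. d \<le> dist x y"
      using separate_compact_closed[of K "- U"] K(1,2) U(1,2) by blast
    then obtain d where d: "d > 0" "\<And>x y. x \<in> K \<Longrightarrow> y \<notin> U \<Longrightarrow> d \<le> dist x y" by auto
    have "(\<integral>\<^sup>+x. norm (indicator A (h + x) *\<^sub>R c - indicator A x *\<^sub>R c) \<partial>lborel) \<le> ennreal e"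
      if "norm h < d" for h
    proof -
      have sh: "h + x \<in> U" if "x \<in> K" for x
        using d(2)[OF that, of "h + x"] \<open>norm h < d\<close> by (auto simp: dist_norm)
      have sh': "x \<in> U" if "h + x \<in> K" for x
        using d(2)[OF that, of x] \<open>norm h < d\<close> by (auto simp: dist_norm)
      have "ennreal (norm c) \<le> ennreal (norm c) * 2" by (simp add: mult_2_right)
      then have "(\<integral>\<^sup>+x. norm (indicator A (h + x) *\<^sub>R c - indicator A x *\<^sub>R c) \<partial>lborel)
          \<le> (\<integral>\<^sup>+x. ennreal (norm c) * (indicator (U - K) (h + x) + indicator (U - K) x) \<partial>lborel)"
        using sh sh' K(2) U(2) by (intro nn_integral_mono) (auto simp: indicator_def split: if_splits)
      also have "\<dots> = ennreal (norm c) * (emeasure lborel (U - K) + emeasure lborel (U - K))"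
        using nn_integral_lborel_translate[of "indicator (U - K)" h]
        by (simp add: nn_integral_cmult nn_integral_add)
      also have "\<dots> \<le> ennreal (norm c) * (ennreal e' + ennreal e')"
        by (intro mult_left_mono add_mono UK) auto
      also have "\<dots> = ennreal (norm c * (2 * e'))"
        using e' by (simp add: ennreal_mult' flip: ennreal_plus)
      also have "\<dots> \<le> ennreal e"
      proof (intro ennreal_leI)
        have "norm c * (2 * e') \<le> (norm c + 1) * (2 * e')"
          using e' by (intro mult_right_mono) auto
        also have "\<dots> = e" by (simp add: e'_def field_simps add_nonneg_eq_0_iff)
        finally show "norm c * (2 * e') \<le> e" .
      qed
      finally show ?thesis .
    qed
    then show "\<exists>d>0. \<forall>h. norm h < d \<longrightarrow>
        (\<integral>\<^sup>+x. norm (indicator A (h + x) *\<^sub>R c - indicator A x *\<^sub>R c) \<partial>lborel) \<le> ennreal e"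
      using d(1) by blast
  qed
next
  case (add f g)
  show ?case
  proof safe
    fix e :: real assume "e > 0"
    have [measurable]: "f \<in> borel_measurable borel" "g \<in> borel_measurable borel"
      using add by auto
    obtain d1 where d1: "d1 > 0"
      "\<And>h. norm h < d1 \<Longrightarrow> (\<integral>\<^sup>+x. norm (f (h + x) - f x) \<partial>lborel) \<le> ennreal (e / 2)"
      using add.IH(1) \<open>e > 0\<close> half_gt_zero by metis
    obtain d2 where d2: "d2 > 0"
      "\<And>h. norm h < d2 \<Longrightarrow> (\<integral>\<^sup>+x. norm (g (h + x) - g x) \<partial>lborel) \<le> ennreal (e / 2)"
      using add.IH(2) \<open>e > 0\<close> half_gt_zero by metis
    have "(\<integral>\<^sup>+x. norm (f (h + x) + g (h + x) - (f x + g x)) \<partial>lborel) \<le> ennreal e"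
      if h: "norm h < min d1 d2" for h
    proof -
      have "(\<integral>\<^sup>+x. norm (f (h + x) + g (h + x) - (f x + g x)) \<partial>lborel)
          \<le> (\<integral>\<^sup>+x. ennreal (norm (f (h + x) - f x)) + ennreal (norm (g (h + x) - g x)) \<partial>lborel)"
        by (intro nn_integral_mono)
           (auto simp flip: ennreal_plus intro!: ennreal_leI norm_triangle_le simp: norm_diff_triangle_ineq)
      also have "\<dots> \<le> ennreal (e / 2) + ennreal (e / 2)"
        using d1 d2 h by (subst nn_integral_add) (auto intro!: add_mono)
      also have "\<dots> = ennreal e" using \<open>e > 0\<close> by (simp flip: ennreal_plus)
      finally show ?thesis .
    qed
    then show "\<exists>d>0. \<forall>h. norm h < d \<longrightarrow>
        (\<integral>\<^sup>+x. norm (f (h + x) + g (h + x) - (f x + g x)) \<partial>lborel) \<le> ennreal e"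
      using d1(1) d2(1) by (intro exI[of _ "min d1 d2"]) auto
  qed
next
  case (lim f s)
  show ?case
  proof safe
    fix e :: real assume "e > 0"
    have [measurable]: "f \<in> borel_measurable borel" "\<And>i. s i \<in> borel_measurable borel"
      using lim by auto
    have fin: "(\<integral>\<^sup>+x. ennreal (norm (f x)) \<partial>lborel) < \<infinity>"
      using \<open>integrable lborel f\<close> by (simp add: integrable_iff_bounded)
    have "(\<lambda>i. \<integral>\<^sup>+x. norm (f x - s i x) \<partial>lborel) \<longlonglongrightarrow> 0"
      by (rule nn_integral_dominated_convergence_norm[where w="\<lambda>x. 2 * norm (f x)"])
         (use lim fin in \<open>auto simp: nn_integral_cmult ennreal_mult ennreal_mult_less_top\<close>)
    then have "\<forall>\<^sub>F i in sequentially. (\<integral>\<^sup>+x. norm (f x - s i x) \<partial>lborel) < ennreal (e / 3)"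
      using \<open>e > 0\<close> by (intro order_tendstoD) auto
    then obtain i where i: "(\<integral>\<^sup>+x. norm (f x - s i x) \<partial>lborel) < ennreal (e / 3)"
      by (auto simp: eventually_sequentially)
    obtain d where d: "d > 0"
      "\<And>h. norm h < d \<Longrightarrow> (\<integral>\<^sup>+x. norm (s i (h + x) - s i x) \<partial>lborel) \<le> ennreal (e / 3)"
      using lim.IH[of i] \<open>e > 0\<close> by (metis divide_pos_pos zero_less_numeral)
    have "(\<integral>\<^sup>+x. norm (f (h + x) - f x) \<partial>lborel) \<le> ennreal e" if h: "norm h < d" for h
    proof -
      have "(\<integral>\<^sup>+x. norm (f (h + x) - f x) \<partial>lborel)
          \<le> (\<integral>\<^sup>+x. (ennreal (norm (f (h + x) - s i (h + x))) + ennreal (norm (f x - s i x)))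
              + ennreal (norm (s i (h + x) - s i x)) \<partial>lborel)"
      proof (intro nn_integral_mono)
        fix x
        have "norm (f (h + x) - f x) \<le>
            norm (f (h + x) - s i (h + x)) + norm (f x - s i x) + norm (s i (h + x) - s i x)"
          using norm_triangle_ineq[of "f (h + x) - s i (h + x)" "s i (h + x) - f x"]
            norm_triangle_ineq[of "s i (h + x) - s i x" "s i x - f x"]
          by (simp add: norm_minus_commute)
        then show "ennreal (norm (f (h + x) - f x)) \<le>
            (ennreal (norm (f (h + x) - s i (h + x))) + ennreal (norm (f x - s i x)))
              + ennreal (norm (s i (h + x) - s i x))"
          by (simp flip: ennreal_plus)
      qed
      also have "\<dots> = (\<integral>\<^sup>+x. norm (f (h + x) - s i (h + x)) \<partial>lborel)
          + (\<integral>\<^sup>+x. norm (f x - s i x) \<partial>lborel) + (\<integral>\<^sup>+x. norm (s i (h + x) - s i x) \<partial>lborel)"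
        by (simp add: nn_integral_add)
      also have "(\<integral>\<^sup>+x. norm (f (h + x) - s i (h + x)) \<partial>lborel) = (\<integral>\<^sup>+x. norm (f x - s i x) \<partial>lborel)"
        using nn_integral_lborel_translate[of "\<lambda>x. ennreal (norm (f x - s i x))" h] by simp
      also have "(\<integral>\<^sup>+x. norm (f x - s i x) \<partial>lborel) + (\<integral>\<^sup>+x. norm (f x - s i x) \<partial>lborel)
          + (\<integral>\<^sup>+x. norm (s i (h + x) - s i x) \<partial>lborel) \<le> ennreal (e/3) + ennreal (e/3) + ennreal (e/3)"
        using i d(2)[OF h] by (intro add_mono) auto
      also have "\<dots> = ennreal e" using \<open>e > 0\<close> by (simp flip: ennreal_plus)
      finally show ?thesis .
    qed
    then show "\<exists>d>0. \<forall>h. norm h < d \<longrightarrow> (\<integral>\<^sup>+x. norm (f (h + x) - f x) \<partial>lborel) \<le> ennreal e"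
      using d(1) by blast
  qed
qed

definition mollify :: "('a::euclidean_space \<Rightarrow> real) \<Rightarrow> ('a \<Rightarrow> 'b::{banach, second_countable_topology}) \<Rightarrow> 'a \<Rightarrow> 'b" where
  "mollify \<rho> F x = (LINT y|lborel. \<rho> (x - y) *\<^sub>R F y)"

lemma integrable_bounded_scaleR:
  fixes F :: "'a \<Rightarrow> 'b::{banach, second_countable_topology}"
  assumes "integrable M F" "g \<in> borel_measurable M" "\<And>y. \<bar>g y\<bar> \<le> B"
  shows "integrable M (\<lambda>y. g y *\<^sub>R F y)"
proof (rule Bochner_Integration.integrable_bound)
  show "integrable M (\<lambda>y. B *\<^sub>R F y)" using assms by auto
  show "AE y in M. norm (g y *\<^sub>R F y) \<le> norm (B *\<^sub>R F y)"
    using assms(3) by (auto intro!: mult_right_mono order.trans[OF assms(3)])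
qed (use assms in auto)

text \<open>The error at \<open>x\<close> is an average of \<open>F (x - z) - F x\<close> over the small shifts \<open>z\<close> that \<open>\<rho>\<close> sees, and
each shift moves \<open>F\<close> by little in \<open>L\<^sup>1\<close>.\<close>

lemma mollify_L1:
  fixes F :: "'a::euclidean_space \<Rightarrow> 'b::{banach, second_countable_topology}"
  assumes F: "integrable lborel F" and "e > 0"
  shows "\<exists>d>0. \<forall>\<rho>. continuous_on UNIV \<rho> \<and> (\<forall>z. 0 \<le> \<rho> z) \<and> (\<forall>z. d \<le> norm z \<longrightarrow> \<rho> z = 0) \<and>
      (\<integral>\<^sup>+z. ennreal (\<rho> z) \<partial>lborel) = 1
      \<longrightarrow> (\<integral>\<^sup>+x. norm (mollify \<rho> F x - F x) \<partial>lborel) \<le> ennreal e"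
proof -
  have [measurable]: "F \<in> borel_measurable borel" using F by auto
  obtain d where d: "d > 0"
      "\<And>h. norm h < d \<Longrightarrow> (\<integral>\<^sup>+x. norm (F (h + x) - F x) \<partial>lborel) \<le> ennreal e"
    using translation_continuous_L1[OF F, rule_format, OF \<open>e > 0\<close>] by auto
  have "(\<integral>\<^sup>+x. norm (mollify \<rho> F x - F x) \<partial>lborel) \<le> ennreal e"
    if \<rho>: "continuous_on UNIV \<rho>" "\<And>z. 0 \<le> \<rho> z" "\<And>z. d \<le> norm z \<Longrightarrow> \<rho> z = 0"
      "(\<integral>\<^sup>+z. ennreal (\<rho> z) \<partial>lborel) = 1" for \<rho>
  proof -
    have [measurable]: "\<rho> \<in> borel_measurable borel" using \<rho>(1) by (rule borel_measurable_continuous_onI)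
    have "compact (\<rho> ` cball 0 d)"
      by (intro compact_continuous_image continuous_on_subset[OF \<rho>(1)]) auto
    then obtain B where B: "\<And>z. z \<in> cball 0 d \<Longrightarrow> \<bar>\<rho> z\<bar> \<le> B"
      by (fastforce dest!: compact_imp_bounded simp: bounded_iff)
    have B': "\<bar>\<rho> z\<bar> \<le> max B 0" for z
      using B[of z] \<rho>(3)[of z] by (cases "norm z \<le> d") auto
    have int_\<rho>: "integrable lborel \<rho>" and \<rho>1: "(LINT z|lborel. \<rho> z) = 1"
      using \<rho>(2,4) by (auto intro!: integrableI_nonneg simp: integral_eq_nn_integral)
    have ptw: "ennreal (norm (mollify \<rho> F x - F x)) \<le> (\<integral>\<^sup>+z. \<rho> z * norm (F (- z + x) - F x) \<partial>lborel)" for x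
    proof -
      have i1: "integrable lborel (\<lambda>z. \<rho> z *\<^sub>R F (x - z))"
      proof (rule integrable_bounded_scaleR[OF _ _ B'])
        have "integrable (distr lborel borel (\<lambda>z. x - z)) F" using F by (simp add: lborel_distr_reflect)
        then show "integrable lborel (\<lambda>z. F (x - z))" by (subst (asm) integrable_distr_eq) auto
      qed auto
      have i2: "integrable lborel (\<lambda>z. \<rho> z *\<^sub>R F x)" using int_\<rho> by auto
      have "mollify \<rho> F x = (LINT z|lborel. \<rho> z *\<^sub>R F (x - z))"
        unfolding mollify_def
        using integral_lborel_reflect[of "\<lambda>y. \<rho> (x - y) *\<^sub>R F y" x] by simp
      moreover have "F x = (LINT z|lborel. \<rho> z *\<^sub>R F x)" using \<rho>1 int_\<rho> by simp
      ultimately have "mollify \<rho> F x - F x = (LINT z|lborel. \<rho> z *\<^sub>R F (x - z) - \<rho> z *\<^sub>R F x)"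
        using i1 i2 by (metis Bochner_Integration.integral_diff)
      then have "ennreal (norm (mollify \<rho> F x - F x)) \<le>
          (\<integral>\<^sup>+z. norm (\<rho> z *\<^sub>R F (x - z) - \<rho> z *\<^sub>R F x) \<partial>lborel)"
        using integral_norm_bound_ennreal[OF Bochner_Integration.integrable_diff[OF i1 i2]] by simp
      also have "\<dots> = (\<integral>\<^sup>+z. \<rho> z * norm (F (- z + x) - F x) \<partial>lborel)"
        using \<rho>(2) by (simp flip: scaleR_diff_right)
      finally show ?thesis .
    qed
    have "(\<integral>\<^sup>+x. norm (mollify \<rho> F x - F x) \<partial>lborel)
        \<le> (\<integral>\<^sup>+x. \<integral>\<^sup>+z. \<rho> z * norm (F (- z + x) - F x) \<partial>lborel \<partial>lborel)"
      by (intro nn_integral_mono ptw)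
    also have "\<dots> = (\<integral>\<^sup>+z. \<integral>\<^sup>+x. \<rho> z * norm (F (- z + x) - F x) \<partial>lborel \<partial>lborel)"
      by (rule lborel_pair.Fubini') measurable
    also have "\<dots> = (\<integral>\<^sup>+z. \<rho> z * (\<integral>\<^sup>+x. norm (F (- z + x) - F x) \<partial>lborel) \<partial>lborel)"
      using \<rho>(2) by (simp add: ennreal_mult' nn_integral_cmult)
    also have "\<dots> \<le> (\<integral>\<^sup>+z. \<rho> z * ennreal e \<partial>lborel)"
    proof (intro nn_integral_mono)
      fix z
      show "ennreal (\<rho> z) * (\<integral>\<^sup>+x. norm (F (- z + x) - F x) \<partial>lborel) \<le> ennreal (\<rho> z) * ennreal e"
        using d(2)[of "- z"] \<rho>(3)[of z] by (cases "norm z < d") (auto intro!: mult_left_mono)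
    qed
    also have "\<dots> = ennreal e" using \<rho>(4) by (simp add: nn_integral_multc)
    finally show ?thesis .
  qed
  then show ?thesis using d(1) by blast
qed

text \<open>The derivative is carried along as a second argument so that the product rule, translation and
restriction to lines produce it explicitly.\<close>

definition C1 :: "('a::euclidean_space \<Rightarrow> 'b::real_normed_vector) \<Rightarrow> ('a \<Rightarrow> 'a \<Rightarrow> 'b) \<Rightarrow> bool" where
  "C1 F F' \<longleftrightarrow> (\<forall>x. (F has_derivative F' x) (at x)) \<and> (\<forall>v. continuous_on UNIV (\<lambda>x. F' x v))"

lemma C1_continuous: "C1 F F' \<Longrightarrow> continuous_on UNIV F"
  unfolding C1_def by (meson continuous_at_imp_continuous_on has_derivative_continuous)

lemma C1_linear: "C1 F F' \<Longrightarrow> linear (F' x)"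
  unfolding C1_def by (blast intro: has_derivative_linear)

lemma C1_zero_on_open:
  assumes "C1 F F'" "open T" "\<And>x. x \<in> T \<Longrightarrow> F x = 0" "x \<in> T"
  shows "F' x v = 0"
proof -
  have "(F has_derivative F' x) (at x)" using assms(1) by (simp add: C1_def)
  then have "((\<lambda>x. 0) has_derivative F' x) (at x)"
    by (rule has_derivative_transform_within_open[OF _ assms(2,4)]) (use assms(3) in simp)
  then have "F' x = (\<lambda>v. 0)"
    by (rule has_derivative_unique[OF _ has_derivative_const])
  then show ?thesis by simp
qed

lemma C1_vanish_outside:
  assumes "C1 F F'" "\<And>x. x \<notin> cball a r \<Longrightarrow> F x = 0" "x \<notin> cball a r"
  shows "F' x v = 0"
  by (rule C1_zero_on_open[OF assms(1), of "- cball a r"]) (use assms in auto)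

lemma C1_compact_support_bound:
  fixes F :: "'a::euclidean_space \<Rightarrow> 'b::real_normed_vector"
  assumes F: "C1 F F'" and z: "\<And>x. x \<notin> cball a r \<Longrightarrow> F x = 0"
  obtains B where "B \<ge> 0" "\<And>x v. norm (F' x v) \<le> B * norm v"
    "\<And>x y. norm (F x - F y) \<le> B * norm (x - y)"
proof -
  have "\<exists>B. \<forall>x. norm (F' x b) \<le> B" for b
  proof -
    have "compact ((\<lambda>x. F' x b) ` cball a r)"
      using F unfolding C1_def
      by (intro compact_continuous_image) (auto intro: continuous_on_subset)
    then obtain B where "\<And>x. x \<in> cball a r \<Longrightarrow> norm (F' x b) \<le> B"
      by (fastforce dest!: compact_imp_bounded simp: bounded_iff)
    then have "norm (F' x b) \<le> max B 0" for x
    proof (cases "x \<in> cball a r")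
      case False
      have "F' x b = 0" by (rule C1_vanish_outside[OF F z False])
      then show ?thesis by simp
    qed (simp add: le_max_iff_disj)
    then show ?thesis by blast
  qed
  then have "\<forall>b. \<exists>B. \<forall>x. norm (F' x b) \<le> B" by simp
  from choice[OF this] obtain B where B: "\<And>x b. norm (F' x b) \<le> B b" by blast
  have B0: "B b \<ge> 0" for b by (rule order_trans[OF norm_ge_zero B[of undefined b]])
  have 1: "norm (F' x v) \<le> (\<Sum>b\<in>Basis. B b) * norm v" for x v
  proof -
    interpret linear "F' x" by (rule C1_linear[OF F])
    have "F' x v = (\<Sum>b\<in>Basis. (v \<bullet> b) *\<^sub>R F' x b)"
      by (subst euclidean_representation[of v, symmetric]) (simp add: sum scaleR)
    also have "norm \<dots> \<le> (\<Sum>b\<in>Basis. norm v * B b)"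
      by (intro sum_norm_le) (auto intro!: mult_mono B Basis_le_norm)
    finally show ?thesis by (simp add: sum_distrib_left sum_distrib_right mult.commute)
  qed
  have 2: "norm (F x - F y) \<le> (\<Sum>b\<in>Basis. B b) * norm (x - y)" for x y
    using F 1 unfolding C1_def
    by (intro differentiable_bound[of UNIV F F']) (auto intro!: onorm_le)
  show ?thesis
    by (rule that[OF _ 1 2]) (simp add: B0 sum_nonneg)
qed

text \<open>Differentiation under the integral by dominated convergence: the difference quotients of \<open>\<rho>\<close> are
bounded by its Lipschitz constant.\<close>

lemma mollify_C1:
  fixes F :: "'a::euclidean_space \<Rightarrow> 'b::{banach, second_countable_topology}"
  assumes \<rho>: "C1 \<rho> \<rho>'" and z: "\<And>x. x \<notin> cball 0 r \<Longrightarrow> \<rho> x = 0" and F: "integrable lborel F"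
  shows "C1 (mollify \<rho> F) (\<lambda>x v. LINT y|lborel. \<rho>' (x - y) v *\<^sub>R F y)"
proof -
  obtain B where B: "B \<ge> 0" "\<And>x v. norm (\<rho>' x v) \<le> B * norm v"
    "\<And>x y. norm (\<rho> x - \<rho> y) \<le> B * norm (x - y)"
    using C1_compact_support_bound[OF \<rho> z] by blast
  have [measurable]: "F \<in> borel_measurable borel" using F by auto
  have [measurable]: "\<rho> \<in> borel_measurable borel"
    using C1_continuous[OF \<rho>] by (rule borel_measurable_continuous_onI)
  have [measurable]: "(\<lambda>x. \<rho>' x v) \<in> borel_measurable borel" for v
    using \<rho> by (intro borel_measurable_continuous_onI) (auto simp: C1_def)
  have [measurable]: "(\<lambda>y. \<rho>' (x - y) v) \<in> borel_measurable borel" for x v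
    by (rule measurable_compose[of "\<lambda>y. x - y" _ borel]) auto
  have "compact (\<rho> ` cball 0 r)"
    using C1_continuous[OF \<rho>] by (intro compact_continuous_image) (auto intro: continuous_on_subset)
  then obtain M where M: "\<And>x. x \<in> cball 0 r \<Longrightarrow> norm (\<rho> x) \<le> M"
    by (fastforce dest!: compact_imp_bounded simp: bounded_iff)
  have M': "\<bar>\<rho> x\<bar> \<le> max M 0" for x
    using M[of x] z[of x] by (cases "x \<in> cball 0 r") (auto simp: le_max_iff_disj)
  have i0: "integrable lborel (\<lambda>y. \<rho> (x - y) *\<^sub>R F y)" for x
    by (rule integrable_bounded_scaleR[OF F _ M']) measurable
  have i1: "integrable lborel (\<lambda>y. \<rho>' (x - y) v *\<^sub>R F y)" for x v
    by (rule integrable_bounded_scaleR[OF F]) (use B(2)[of _ v] in auto)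
  define D where "D x v = (LINT y|lborel. \<rho>' (x - y) v *\<^sub>R F y)" for x v
  have lin: "linear (D x)" for x
  proof
    fix v w :: 'a and c :: real
    have l: "linear (\<rho>' y)" for y by (rule C1_linear[OF \<rho>])
    show "D x (v + w) = D x v + D x w"
      unfolding D_def by (simp add: linear_add[OF l] scaleR_add_left i1)
    show "D x (c *\<^sub>R v) = c *\<^sub>R D x v"
      unfolding D_def by (simp add: linear_scale[OF l] i1 flip: scaleR_scaleR)
  qed
  have "(mollify \<rho> F has_derivative D x) (at x)" for x
    unfolding has_derivative_iff_norm
  proof (intro conjI)
    show "bounded_linear (D x)" using lin linear_conv_bounded_linear by blast
    show "((\<lambda>y. norm (mollify \<rho> F y - mollify \<rho> F x - D x (y - x)) / norm (y - x)) \<longlongrightarrow> 0) (at x)"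
      unfolding tendsto_at_iff_sequentially
    proof safe
      fix X :: "nat \<Rightarrow> 'a" assume X: "\<forall>i. X i \<in> UNIV - {x}" "X \<longlonglongrightarrow> x"
      define q where "q n y = (\<rho> (X n - y) - \<rho> (x - y) - \<rho>' (x - y) (X n - x)) / norm (X n - x)" for n y
      have eq: "norm (mollify \<rho> F (X n) - mollify \<rho> F x - D x (X n - x)) / norm (X n - x)
          = norm (LINT y|lborel. q n y *\<^sub>R F y)" for n
      proof -
        have "(LINT y|lborel. q n y *\<^sub>R F y) = (LINT y|lborel. inverse (norm (X n - x)) *\<^sub>R
            (\<rho> (X n - y) *\<^sub>R F y - \<rho> (x - y) *\<^sub>R F y - \<rho>' (x - y) (X n - x) *\<^sub>R F y))"
          unfolding q_def by (simp add: divide_inverse scaleR_diff_left mult.commute flip: scaleR_scaleR)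
        also have "\<dots> = inverse (norm (X n - x)) *\<^sub>R (mollify \<rho> F (X n) - mollify \<rho> F x - D x (X n - x))"
          unfolding mollify_def D_def by (simp add: i0 i1)
        finally show ?thesis by (simp add: divide_inverse mult.commute)
      qed
      have "(\<lambda>n. LINT y|lborel. q n y *\<^sub>R F y) \<longlonglongrightarrow> (LINT (y::'a)|lborel. (0::'b))"
      proof (rule integral_dominated_convergence[where w="\<lambda>y. 2 * B * norm (F y)"])
        show "integrable lborel (\<lambda>y. 2 * B * norm (F y))" using F by auto
        show "AE y in lborel. (\<lambda>n. q n y *\<^sub>R F y) \<longlonglongrightarrow> 0"
        proof (rule AE_I2)
          fix y
          have "((\<lambda>h. norm (\<rho> h - \<rho> (x - y) - \<rho>' (x - y) (h - (x - y))) / norm (h - (x - y))) \<longlongrightarrow> 0) (at (x - y))"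
            using \<rho> unfolding C1_def has_derivative_iff_norm by auto
          moreover have "filterlim (\<lambda>n. X n - y) (at (x - y)) sequentially"
            using X by (auto simp: filterlim_at intro!: tendsto_intros always_eventually)
          ultimately have "(\<lambda>n. norm (\<rho> (X n - y) - \<rho> (x - y) - \<rho>' (x - y) (X n - y - (x - y)))
              / norm (X n - y - (x - y))) \<longlonglongrightarrow> 0"
            by (rule filterlim_compose)
          then have "(\<lambda>n. norm (q n y)) \<longlonglongrightarrow> 0"
            by (simp add: q_def)
          then have "(\<lambda>n. q n y *\<^sub>R F y) \<longlonglongrightarrow> 0 *\<^sub>R F y"
            by (intro tendsto_scaleR tendsto_const) (rule tendsto_norm_zero_cancel)
          then show "(\<lambda>n. q n y *\<^sub>R F y) \<longlonglongrightarrow> 0" by simp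
        qed
        show "AE y in lborel. norm (q n y *\<^sub>R F y) \<le> 2 * B * norm (F y)" for n
        proof (rule AE_I2)
          fix y
          have "\<bar>\<rho> (X n - y) - \<rho> (x - y) - \<rho>' (x - y) (X n - x)\<bar> \<le> 2 * B * norm (X n - x)"
            using B(2)[of "x - y" "X n - x"] B(3)[of "X n - y" "x - y"] by auto
          then have "\<bar>q n y\<bar> \<le> 2 * B"
            using X(1) by (auto simp: q_def divide_le_eq)
          then show "norm (q n y *\<^sub>R F y) \<le> 2 * B * norm (F y)"
            by (auto intro!: mult_right_mono)
        qed
        show "(\<lambda>y. q n y *\<^sub>R F y) \<in> borel_measurable lborel" for n unfolding q_def by measurable
      qed auto
      then have "(\<lambda>n. norm (LINT y|lborel. q n y *\<^sub>R F y)) \<longlonglongrightarrow> 0"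
        by (simp add: tendsto_norm_zero)
      then show "((\<lambda>y. norm (mollify \<rho> F y - mollify \<rho> F x - D x (y - x)) / norm (y - x)) \<circ> X) \<longlonglongrightarrow> 0"
        by (simp add: o_def eq)
    qed
  qed
  moreover have "continuous_on UNIV (\<lambda>x. D x v)" for v
    unfolding continuous_on_sequentially
  proof safe
    fix X x assume X: "X \<longlonglongrightarrow> (x::'a)"
    have "(\<lambda>n. LINT y|lborel. \<rho>' (X n - y) v *\<^sub>R F y) \<longlonglongrightarrow> (LINT y|lborel. \<rho>' (x - y) v *\<^sub>R F y)"
    proof (rule integral_dominated_convergence[where w="\<lambda>y. B * norm v * norm (F y)"])
      show "AE y in lborel. (\<lambda>n. \<rho>' (X n - y) v *\<^sub>R F y) \<longlonglongrightarrow> \<rho>' (x - y) v *\<^sub>R F y"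
      proof (intro AE_I2 tendsto_scaleR tendsto_const)
        fix y
        have "isCont (\<lambda>x. \<rho>' x v) (x - y)"
          using \<rho> by (simp add: C1_def continuous_on_eq_continuous_at)
        then show "(\<lambda>n. \<rho>' (X n - y) v) \<longlonglongrightarrow> \<rho>' (x - y) v"
          by (rule isCont_tendsto_compose) (intro tendsto_intros X)
      qed
      show "AE y in lborel. norm (\<rho>' (X n - y) v *\<^sub>R F y) \<le> B * norm v * norm (F y)" for n
        using B(2) by (auto intro!: mult_right_mono)
    qed (use F in auto)
    then show "((\<lambda>x. D x v) \<circ> X) \<longlonglongrightarrow> D x v" by (simp add: D_def o_def)
  qed
  ultimately show ?thesis unfolding C1_def D_def by blast
qed

text \<open>The radius \<open>d\<close> is arbitrary, so the kernels of an approximate identity are obtained directly and not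
by rescaling one of them.\<close>

lemma bump_kernel:
  assumes "d > 0"
  obtains c where "c \<ge> 0" "(\<integral>\<^sup>+(z::'a::euclidean_space). ennreal (c * exp_flat 0 (d\<^sup>2 - z \<bullet> z)) \<partial>lborel) = 1"
proof -
  let ?f = "\<lambda>z::'a. exp_flat 0 (d\<^sup>2 - z \<bullet> z)"
  have cont: "continuous_on UNIV ?f"
    by (auto intro!: continuous_on_compose2[OF continuous_exp_flat] continuous_intros)
  then have [measurable]: "?f \<in> borel_measurable borel" by (rule borel_measurable_continuous_onI)
  have nn: "?f z \<ge> 0" for z by (simp add: exp_flat_def)
  define I where "I = (\<integral>\<^sup>+z. ennreal (?f z) \<partial>lborel)"
  have "?f z \<le> indicator (cball 0 d) z" for z
  proof (cases "z \<in> cball 0 d")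
    case False
    then have "d\<^sup>2 \<le> (norm z)\<^sup>2" using assms by (intro power_mono) auto
    then show ?thesis using False by (simp add: exp_flat_def power2_norm_eq_inner)
  qed (simp add: exp_flat_def)
  then have "ennreal (?f z) \<le> indicator (cball 0 d) z" for z
    by (metis ennreal_indicator ennreal_leI)
  then have "I \<le> (\<integral>\<^sup>+z. indicator (cball (0::'a) d) z \<partial>lborel)"
    unfolding I_def by (intro nn_integral_mono)
  also have "\<dots> < \<infinity>" using emeasure_lborel_cball_finite[of "0::'a" d] by simp
  finally have fin: "I < \<infinity>" .
  have "I \<noteq> 0"
  proof
    assume "I = 0"
    then have ae: "AE z in lborel. ?f z = 0"
      unfolding I_def using nn by (subst (asm) nn_integral_0_iff_AE) (auto simp: ennreal_eq_0_iff intro: antisym)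
    have "AE z in lborel. z \<notin> ball (0::'a) d"
      using ae
    proof eventually_elim
      fix z assume "?f z = 0"
      then have "\<not> z \<bullet> z < d\<^sup>2" by (auto simp: exp_flat_def split: if_splits)
      then have "\<not> norm z < d" 
        using power_strict_mono[of "norm z" d 2] by (auto simp: power2_norm_eq_inner)
      then show "z \<notin> ball 0 d" by simp
    qed
    then have "emeasure lborel (ball (0::'a) d) = 0"
      using AE_iff_measurable[of "ball (0::'a) d" lborel "\<lambda>z. z \<notin> ball 0 d"]
      by (simp add: ball_def)
    then show False
      using open_not_negligible[of "ball (0::'a) d"] assms
      by (auto simp: negligible_iff_null_sets null_sets_def)
  qed
  show ?thesis
  proof
    define c where "c = 1 / enn2real I"
    show "c \<ge> 0" by (simp add: c_def)
    have "(\<integral>\<^sup>+z. ennreal (c * ?f z) \<partial>lborel) = (\<integral>\<^sup>+z. ennreal c * ennreal (?f z) \<partial>lborel)"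
      using nn \<open>c \<ge> 0\<close> by (intro nn_integral_cong ennreal_mult) auto
    also have "\<dots> = ennreal c * I"
      unfolding I_def by (rule nn_integral_cmult) measurable
    also have "\<dots> = ennreal c * ennreal (enn2real I)" using fin by simp
    also have "\<dots> = ennreal (c * enn2real I)" using \<open>c \<ge> 0\<close> by (simp add: ennreal_mult)
    also have "c * enn2real I = 1"
      using fin \<open>I \<noteq> 0\<close> by (simp add: c_def enn2real_eq_0_iff less_top[symmetric])
    finally show "(\<integral>\<^sup>+z. ennreal (c * ?f z) \<partial>lborel) = 1" by simp
  qed
qed

text \<open>A translated reflected kernel \<open>y \<mapsto> \<rho> (x - y)\<close> is an admissible test function as long as the
ball of radius \<open>r\<close> about \<open>x\<close> stays in \<open>\<Omega>\<close>.  Testing with it moves the derivative from \<open>\<rho>\<close> to the weak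
derivative \<open>G\<close>: on \<open>K\<close> the derivative of the mollification is the mollification of \<open>G\<close>.\<close>

lemma friedrichs_approximation:
  fixes U :: "'a::euclidean_space \<Rightarrow> 'b::{banach, second_countable_topology}"
  assumes U: "integrable lborel U" and G: "\<And>b. b \<in> Basis \<Longrightarrow> integrable lborel (G b)"
    and weak: "\<And>b \<phi>. b \<in> Basis \<Longrightarrow> test_function \<Omega> \<phi> \<Longrightarrow>
      (LINT y|lborel. frechet_derivative \<phi> (at y) b *\<^sub>R U y) = - (LINT y|lborel. \<phi> y *\<^sub>R G b y)"
    and K: "r > 0" "\<And>x. x \<in> K \<Longrightarrow> cball x r \<subseteq> \<Omega>"
    and "e > 0"
  obtains F F' where "C1 F F'" "(\<integral>\<^sup>+x. norm (F x - U x) \<partial>lborel) \<le> ennreal e"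
    "\<And>b. b \<in> Basis \<Longrightarrow> (\<integral>\<^sup>+x\<in>K. norm (F' x b - G b x) \<partial>lborel) \<le> ennreal e"
proof -
  let ?good = "\<lambda>d (\<rho>::'a \<Rightarrow> real). continuous_on UNIV \<rho> \<and> (\<forall>z. 0 \<le> \<rho> z) \<and> (\<forall>z. d \<le> norm z \<longrightarrow> \<rho> z = 0) \<and>
      (\<integral>\<^sup>+z. ennreal (\<rho> z) \<partial>lborel) = 1"
  obtain d0 where d0: "d0 > 0" "\<And>\<rho>. ?good d0 \<rho> \<Longrightarrow> (\<integral>\<^sup>+x. norm (mollify \<rho> U x - U x) \<partial>lborel) \<le> ennreal e"
    using mollify_L1[OF U \<open>e > 0\<close>] by blast
  have "\<forall>b\<in>Basis. \<exists>d>0. \<forall>\<rho>. ?good d \<rho> \<longrightarrow> (\<integral>\<^sup>+x. norm (mollify \<rho> (G b) x - G b x) \<partial>lborel) \<le> ennreal e"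
    using mollify_L1[OF G \<open>e > 0\<close>] by blast
  from bchoice[OF this] obtain d1 where d1: "\<And>b. b \<in> Basis \<Longrightarrow> d1 b > 0" 
    "\<And>b \<rho>. b \<in> Basis \<Longrightarrow> ?good (d1 b) \<rho> \<Longrightarrow> (\<integral>\<^sup>+x. norm (mollify \<rho> (G b) x - G b x) \<partial>lborel) \<le> ennreal e"
    by blast
  define d where "d = Min (insert r (insert d0 (d1 ` Basis)))"
  have "d \<le> s" if "s \<in> insert r (insert d0 (d1 ` Basis))" for s
    unfolding d_def using that by (intro Min_le) auto
  moreover have "d > 0" unfolding d_def using d0(1) d1(1) K(1) by auto
  ultimately have d: "d > 0" "d \<le> r" "d \<le> d0" "\<And>b. b \<in> Basis \<Longrightarrow> d \<le> d1 b"
    by auto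
  obtain c where c: "c \<ge> 0" "(\<integral>\<^sup>+(z::'a). ennreal (c * exp_flat 0 (d\<^sup>2 - z \<bullet> z)) \<partial>lborel) = 1"
    by (rule bump_kernel[OF d(1)])
  define \<rho> where "\<rho> z = c * exp_flat 0 (d\<^sup>2 - z \<bullet> z)" for z :: 'a
  define \<rho>' where "\<rho>' z = frechet_derivative \<rho> (at z)" for z
  have z0: "\<rho> z = 0" if "d \<le> norm z" for z
  proof -
    have "d\<^sup>2 \<le> (norm z)\<^sup>2" using d(1) that by (intro power_mono) auto
    then show ?thesis by (simp add: \<rho>_def exp_flat_def power2_norm_eq_inner)
  qed
  have Ck: "C_k k \<rho>" for k
    unfolding \<rho>_def[abs_def] using C_k_mult[OF C_k_const C_k_exp_flat_radial[of k 0 "d\<^sup>2" 0]] by simp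
  have C1: "C1 \<rho> \<rho>'"
    unfolding C1_def \<rho>'_def using C_k_deriv(1)[OF Ck] C_k_deriv(2)[OF Ck, of 0] by auto
  have good: "?good d' \<rho>" if "d \<le> d'" for d'
    using C1_continuous[OF C1] c z0 that by (auto simp: \<rho>_def exp_flat_def)
  have z0': "x \<notin> cball 0 d \<Longrightarrow> \<rho> x = 0" for x using z0[of x] by auto
  define F' where "F' x v = (LINT y|lborel. \<rho>' (x - y) v *\<^sub>R U y)" for x v
  show ?thesis
  proof
    show "C1 (mollify \<rho> U) F'"
      unfolding F'_def[abs_def] by (rule mollify_C1[OF C1 z0' U])
    show "(\<integral>\<^sup>+x. norm (mollify \<rho> U x - U x) \<partial>lborel) \<le> ennreal e"
      using d0(2)[OF good[OF d(3)]] .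
    fix b :: 'a assume b: "b \<in> Basis"
    have "F' x b = mollify \<rho> (G b) x" if "x \<in> K" for x
    proof -
      let ?\<phi> = "\<lambda>y. c * exp_flat 0 (d\<^sup>2 - (y - x) \<bullet> (y - x))"
      have \<phi>: "?\<phi> = (\<lambda>y. \<rho> (x - y))"
        by (auto simp: \<rho>_def fun_eq_iff inner_diff algebra_simps inner_commute)
      have "test_function \<Omega> ?\<phi>"
        using K(2)[OF that] d(1,2) by (intro test_function_exp_flat_radial) auto
      then have t: "test_function \<Omega> (\<lambda>y. \<rho> (x - y))" unfolding \<phi> .
      have "frechet_derivative (\<lambda>y. \<rho> (x - y)) (at y) b = - \<rho>' (x - y) b" for y
      proof -
        have "((\<lambda>y. x - y) has_derivative (\<lambda>v. - v)) (at y)"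
          by (auto intro!: derivative_eq_intros)
        moreover have "(\<rho> has_derivative \<rho>' (x - y)) (at (x - y))"
          using C1 by (simp add: C1_def)
        ultimately have "((\<lambda>y. \<rho> (x - y)) has_derivative (\<lambda>v. \<rho>' (x - y) (- v))) (at y)"
          by (rule has_derivative_compose)
        then have "frechet_derivative (\<lambda>y. \<rho> (x - y)) (at y) = (\<lambda>v. \<rho>' (x - y) (- v))"
          using frechet_derivative_at by metis
        then show ?thesis by (simp add: linear_neg[OF C1_linear[OF C1]])
      qed
      then show ?thesis
        using weak[OF b t] by (simp add: F'_def mollify_def)
    qed
    then have "(\<integral>\<^sup>+x\<in>K. norm (F' x b - G b x) \<partial>lborel) \<le> (\<integral>\<^sup>+x. norm (mollify \<rho> (G b) x - G b x) \<partial>lborel)"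
      by (intro nn_integral_mono) (auto simp: indicator_def)
    also have "\<dots> \<le> ennreal e"
      using d1(2)[OF b good[OF d(4)[OF b]]] .
    finally show "(\<integral>\<^sup>+x\<in>K. norm (F' x b - G b x) \<partial>lborel) \<le> ennreal e" .
  qed
qed

section \<open>A Carleman inequality for the Cauchy-Riemann operator in the plane\<close>

text \<open>The antilinear part of a real-linear map \<open>D\<close>; for the derivative of a function this is
the Wirtinger derivative with respect to the conjugate variable.\<close>

definition dbar :: "(complex \<Rightarrow> complex) \<Rightarrow> complex" where
  "dbar D = (D 1 + \<i> * D \<i>) / 2"

lemma C1_mult:
  fixes f g :: "'a::euclidean_space \<Rightarrow> 'b::real_normed_algebra"
  assumes f: "C1 f f'" and g: "C1 g g'"
  shows "C1 (\<lambda>x. f x * g x) (\<lambda>x v. f x * g' x v + f' x v * g x)"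
  using C1_continuous[OF f] C1_continuous[OF g] assms unfolding C1_def
  by (auto intro!: continuous_intros has_derivative_mult)

lemma C1_translate:
  assumes "C1 f f'"
  shows "C1 (\<lambda>x. f (z + x)) (\<lambda>x. f' (z + x))"
proof -
  have "((\<lambda>x. f (z + x)) has_derivative f' (z + x)) (at x)" for x
  proof -
    have "((\<lambda>x. z + x) has_derivative (\<lambda>h. h)) (at x)"
      by (auto intro!: derivative_eq_intros)
    moreover have "(f has_derivative f' (z + x)) (at (z + x))"
      using assms by (simp add: C1_def)
    ultimately show ?thesis by (rule has_derivative_compose)
  qed
  moreover have "continuous_on UNIV (\<lambda>x. f' (z + x) v)" for v
    using assms unfolding C1_def
    by (auto intro!: continuous_on_compose2[of UNIV "\<lambda>x. f' x v" UNIV "\<lambda>x. z + x"] continuous_intros)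
  ultimately show ?thesis by (simp add: C1_def)
qed

lemma C1_borel_measurable:
  assumes "C1 f f'"
  shows "f \<in> borel_measurable borel" "(\<lambda>x. f' x v) \<in> borel_measurable borel"
  using C1_continuous[OF assms] assms
  by (auto intro!: borel_measurable_continuous_onI simp: C1_def)

text \<open>Difference quotients integrate to \<open>0\<close> by translation invariance.  This replaces Green's formula
below.\<close>

lemma integral_C1_derivative_eq_0:
  fixes F :: "'a::euclidean_space \<Rightarrow> 'b::euclidean_space"
  assumes F: "C1 F F'" and z: "\<And>x. x \<notin> cball a r \<Longrightarrow> F x = 0"
  shows "integrable lborel (\<lambda>x. F' x v)" "(LINT x|lborel. F' x v) = 0"
proof -
  note [measurable] = C1_borel_measurable[OF F]
  obtain B where B: "B \<ge> 0" "\<And>x v. norm (F' x v) \<le> B * norm v"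
    "\<And>x y. norm (F x - F y) \<le> B * norm (x - y)"
    using C1_compact_support_bound[OF F z] by blast
  have intF: "integrable lborel F"
  proof -
    have "integrable lborel (\<lambda>x. indicator (cball a r) x *\<^sub>R F x)"
      using borel_integrable_compact[of "cball a r" F] C1_continuous[OF F]
      by (auto simp: set_integrable_def intro: continuous_on_subset)
    moreover have "(\<lambda>x. indicator (cball a r) x *\<^sub>R F x) = F"
      using z by (auto simp: indicator_def)
    ultimately show ?thesis by simp
  qed
  define t where "t n = 1 / real (Suc n)" for n
  have t: "t n > 0" "t n \<le> 1" for n by (auto simp: t_def)
  have t0: "t \<longlonglongrightarrow> 0" unfolding t_def by (rule LIMSEQ_Suc[OF lim_1_over_n])
  let ?q = "\<lambda>n x. (F (t n *\<^sub>R v + x) - F x) /\<^sub>R t n"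
  let ?w = "\<lambda>x. B * norm v * indicator (cball a (r + norm v)) x"
  have w: "integrable lborel ?w"
    using emeasure_lborel_cball_finite[of a "r + norm v"] by (intro integrable_mult_right) auto
  have lim: "AE x in lborel. (\<lambda>n. ?q n x) \<longlonglongrightarrow> F' x v"
  proof (intro AE_I2)
    fix x
    have "((\<lambda>s. x + s *\<^sub>R v) has_derivative (\<lambda>s. s *\<^sub>R v)) (at 0)"
      by (auto intro!: derivative_eq_intros)
    moreover have "(F has_derivative F' x) (at (x + 0 *\<^sub>R v))"
      using F by (simp add: C1_def)
    ultimately have "((\<lambda>s. F (x + s *\<^sub>R v)) has_derivative (\<lambda>s. F' x (s *\<^sub>R v))) (at 0)"
      by (rule has_derivative_compose)
    then have "((\<lambda>s. norm (F (x + s *\<^sub>R v) - F x - F' x (s *\<^sub>R v)) / norm s) \<longlongrightarrow> 0) (at (0::real))"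
      unfolding has_derivative_iff_norm by simp
    moreover have "filterlim t (at 0) sequentially"
      using t t0 by (auto simp: filterlim_at intro!: always_eventually) (metis less_irrefl)
    ultimately have "(\<lambda>n. norm (F (x + t n *\<^sub>R v) - F x - F' x (t n *\<^sub>R v)) / norm (t n)) \<longlonglongrightarrow> 0"
      by (rule filterlim_compose)
    moreover have "norm (F (x + t n *\<^sub>R v) - F x - F' x (t n *\<^sub>R v)) / norm (t n) = norm (?q n x - F' x v)" for n
    proof -
      have "F (x + t n *\<^sub>R v) - F x - F' x (t n *\<^sub>R v) = t n *\<^sub>R (?q n x - F' x v)"
        using t(1)[of n] by (simp add: linear_scale[OF C1_linear[OF F]] scaleR_diff_right add.commute)
      then show ?thesis using t(1)[of n] by simp
    qed
    ultimately have "(\<lambda>n. norm (?q n x - F' x v)) \<longlonglongrightarrow> 0" by simp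
    then show "(\<lambda>n. ?q n x) \<longlonglongrightarrow> F' x v"
      by (simp add: tendsto_norm_zero_iff LIM_zero_iff)
  qed
  have bnd: "AE x in lborel. norm (?q n x) \<le> ?w x" for n
  proof (intro AE_I2)
    fix x
    have tv: "norm (t n *\<^sub>R v) \<le> norm v" using t[of n] by (simp add: mult_left_le_one_le)
    show "norm (?q n x) \<le> ?w x"
    proof (cases "x \<in> cball a (r + norm v)")
      case True
      have "norm (F (t n *\<^sub>R v + x) - F x) \<le> B * norm (t n *\<^sub>R v)"
        using B(3)[of "t n *\<^sub>R v + x" x] by simp
      then have "norm (?q n x) \<le> B * norm v"
        using t(1)[of n] by (simp add: mult_ac divide_le_eq flip: divide_inverse_commute)
      then show ?thesis using True by simp
    next
      case False
      have "t n *\<^sub>R v + x \<notin> cball a r" "x \<notin> cball a r"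
      proof -
        have *: "dist a x \<le> dist a (t n *\<^sub>R v + x) + norm (t n *\<^sub>R v)"
          using dist_triangle[of a x "t n *\<^sub>R v + x"] by (simp add: dist_norm)
        have far: "r + norm v < dist a x" using False by simp
        have "r < dist a (t n *\<^sub>R v + x)" using far tv * by linarith
        moreover have "r < dist a x" using far norm_ge_zero[of v] by linarith
        ultimately show "t n *\<^sub>R v + x \<notin> cball a r" "x \<notin> cball a r" by simp_all
      qed
      then show ?thesis using z B(1) by simp
    qed
  qed
  show "integrable lborel (\<lambda>x. F' x v)"
    by (rule integrable_dominated_convergence[OF _ _ w lim bnd]) measurable
  have L: "(\<lambda>n. LINT x|lborel. ?q n x) \<longlonglongrightarrow> (LINT x|lborel. F' x v)"
    by (rule integral_dominated_convergence[OF _ _ w lim bnd]) measurable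
  have q0: "(LINT x|lborel. ?q n x) = 0" for n
    using integrable_lborel_translate[OF intF, of "t n *\<^sub>R v"] intF integral_lborel_translate[of F "t n *\<^sub>R v"]
    by simp
  then have qz: "(\<lambda>n. LINT x|lborel. ?q n x) = (\<lambda>n. 0)" by (rule ext)
  show "(LINT x|lborel. F' x v) = 0"
    by (rule LIMSEQ_const_iff[THEN iffD1, symmetric]) (rule L[unfolded qz])
qed

text \<open>A \<open>C\<^sup>1\<close> step from \<open>0\<close> to \<open>1\<close>: with \<open>s t = (max 0 t)\<^sup>2\<close> it is \<open>1 - s (1 - s t)\<close>, so that one
derivative, that of \<open>s\<close>, is all one has to know.\<close>

definition step :: "real \<Rightarrow> real" where
  "step t = 1 - (max 0 (1 - (max 0 t)\<^sup>2))\<^sup>2"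

definition step' :: "real \<Rightarrow> real" where
  "step' t = 4 * max 0 (1 - (max 0 t)\<^sup>2) * max 0 t"

lemma max_squared_has_derivative:
  "((\<lambda>t::real. (max 0 t)\<^sup>2) has_real_derivative 2 * max 0 t) (at t)"
proof -
  consider "t > 0" | "t < 0" | "t = 0" by linarith
  then show ?thesis
  proof cases
    case 1
    have "((\<lambda>t::real. t\<^sup>2) has_real_derivative 2 * max 0 t) (at t)"
      using 1 by (auto intro!: derivative_eq_intros)
    then show ?thesis
      by (rule has_field_derivative_transform_within_open[where S="{0<..}"]) (use 1 in auto)
  next
    case 2
    have "((\<lambda>t::real. 0) has_real_derivative 2 * max 0 t) (at t)" using 2 by simp
    then show ?thesis
      by (rule has_field_derivative_transform_within_open[where S="{..<0}"]) (use 2 in auto)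
  next
    case 3
    have "((\<lambda>h::real. (max 0 h)\<^sup>2 / h) \<longlongrightarrow> 0) (at 0)"
    proof (rule Lim_null_comparison)
      show "((\<lambda>h. \<bar>h\<bar>) \<longlongrightarrow> (0::real)) (at 0)" by (auto intro!: tendsto_eq_intros)
      show "\<forall>\<^sub>F h in at 0. norm ((max 0 h)\<^sup>2 / h) \<le> \<bar>h\<bar>"
        by (intro always_eventually allI) (auto simp: max_def power2_eq_square)
    qed
    then show ?thesis using 3 by (simp add: DERIV_def)
  qed
qed

lemma step_has_derivative: "(step has_real_derivative step' t) (at t)"
proof -
  have 1: "((\<lambda>t::real. 1 - (max 0 t)\<^sup>2) has_real_derivative 0 - 2 * max 0 t) (at t)"
    by (intro DERIV_diff DERIV_const max_squared_has_derivative)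
  have 2: "((\<lambda>t::real. (max 0 (1 - (max 0 t)\<^sup>2))\<^sup>2) has_real_derivative
      2 * max 0 (1 - (max 0 t)\<^sup>2) * (0 - 2 * max 0 t)) (at t)"
    by (rule DERIV_chain2[OF max_squared_has_derivative 1])
  show ?thesis
    unfolding step_def[abs_def] step'_def
    by (rule DERIV_cong[OF DERIV_diff[OF DERIV_const 2]]) simp
qed

lemma step_bounds: "0 \<le> step t" "step t \<le> 1"
proof -
  have "(max 0 (1 - (max 0 t)\<^sup>2))\<^sup>2 \<le> 1"
    by (intro power_le_one) auto
  then show "0 \<le> step t" "step t \<le> 1" by (auto simp: step_def)
qed

lemma step_eq_0: "t \<le> 0 \<Longrightarrow> step t = 0"
  by (simp add: step_def)

lemma step_eq_1: "t \<ge> 1 \<Longrightarrow> step t = 1"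
  by (simp add: step_def)

lemma step'_nonneg: "0 \<le> step' t"
  by (simp add: step'_def)

lemma step'_eq_0: "t \<le> 0 \<or> t \<ge> 1 \<Longrightarrow> step' t = 0"
  by (auto simp: step'_def)

lemma step'_pos: "0 < t \<Longrightarrow> t < 1 \<Longrightarrow> 0 < step' t"
  by (simp add: step'_def abs_square_less_1)

lemma continuous_step': "continuous_on UNIV step'"
  unfolding step'_def[abs_def] by (intro continuous_intros)

lemma step'_le: "step' t \<le> 4"
proof (cases "t \<le> 0 \<or> t \<ge> 1")
  case False
  then have "(1 - t\<^sup>2) * t \<le> 1 * 1"
    by (intro mult_mono) (auto simp: power_le_one)
  then show ?thesis using False by (auto simp: step'_def max_def)
qed (simp add: step'_eq_0)

lemma C1_radial_step:
  "C1 (\<lambda>x::'a::euclidean_space. step (\<alpha> * (x \<bullet> x) + \<beta>))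
      (\<lambda>x v. step' (\<alpha> * (x \<bullet> x) + \<beta>) * (2 * \<alpha> * (x \<bullet> v)))"
proof -
  have "((\<lambda>x::'a. step (\<alpha> * (x \<bullet> x) + \<beta>)) has_derivative 
      (\<lambda>v. step' (\<alpha> * (x \<bullet> x) + \<beta>) * (2 * \<alpha> * (x \<bullet> v)))) (at x)" for x
  proof -
    have q: "((\<lambda>x::'a. \<alpha> * (x \<bullet> x) + \<beta>) has_derivative (\<lambda>v. 2 * \<alpha> * (x \<bullet> v))) (at x)"
      by (auto intro!: derivative_eq_intros simp: inner_commute)
    show ?thesis
      using has_derivative_compose[OF q has_field_derivative_imp_has_derivative[OF step_has_derivative]]
      by simp
  qed
  moreover have "continuous_on UNIV (\<lambda>x::'a. step' (\<alpha> * (x \<bullet> x) + \<beta>) * (2 * \<alpha> * (x \<bullet> v)))" for v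
    by (auto intro!: continuous_intros continuous_on_compose2[OF continuous_step'])
  ultimately show ?thesis by (simp add: C1_def)
qed

text \<open>A cutoff that vanishes near \<open>0\<close> removes the pole of \<open>x\<^sup>-\<^sup>m\<close>.  Case \<open>m = 1\<close> gives the Cauchy kernel,
large \<open>m\<close> the Carleman weights.\<close>

lemma C1_pole_weight:
  fixes q :: "complex \<Rightarrow> real"
  assumes q: "C1 q q'" and "\<epsilon> > 0" and z: "\<And>x. norm x < \<epsilon> \<Longrightarrow> q x = 0"
  shows "C1 (\<lambda>x. of_real (q x) * inverse x ^ m)
    (\<lambda>x v. of_real (q' x v) * inverse x ^ m - of_real (q x) * of_nat m * inverse x ^ Suc m * v)"
    (is "C1 ?f ?f'")
proof -
  have q'0: "q' x v = 0" if "norm x < \<epsilon>" for x v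
    by (rule C1_zero_on_open[OF q open_ball[of 0 \<epsilon>]]) (use z that in auto)
  have "(?f has_derivative ?f' x) (at x)" for x
  proof (cases "x = 0")
    case False
    have "(q has_derivative q' x) (at x)" using q by (simp add: C1_def)
    then have 1: "((\<lambda>x. complex_of_real (q x)) has_derivative (\<lambda>v. of_real (q' x v))) (at x)"
      by (rule has_derivative_of_real)
    have "((\<lambda>x. inverse x ^ m) has_field_derivative - (of_nat m * inverse x ^ Suc m)) (at x)"
    proof (rule DERIV_cong[OF DERIV_power[OF DERIV_inverse[OF False]]])
      show "of_nat m * (- (inverse x ^ Suc (Suc 0)) * inverse x ^ (m - Suc 0)) = - (of_nat m * inverse x ^ Suc m)"
        by (cases m) (simp_all add: mult_ac)
    qed
    then have 2: "((\<lambda>x. inverse x ^ m) has_derivative (\<lambda>v. - (of_nat m * inverse x ^ Suc m) * v)) (at x)"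
      by (rule has_field_derivative_imp_has_derivative)
    show ?thesis
      using has_derivative_mult[OF 1 2] by (simp add: algebra_simps)
  next
    case True
    have "?f' x = (\<lambda>v. 0)" using True q'0[of x] z[of x] \<open>\<epsilon> > 0\<close> by simp
    moreover have "(?f has_derivative (\<lambda>v. 0)) (at x)"
      by (rule has_derivative_transform_within_open[OF has_derivative_const open_ball[of 0 \<epsilon>]])
         (simp_all add: True z \<open>\<epsilon> > 0\<close>)
    ultimately show ?thesis by simp
  qed
  moreover have "continuous_on UNIV (\<lambda>x. ?f' x v)" for v
  proof -
    have "continuous_on (ball 0 \<epsilon> \<union> - {0}) (\<lambda>x. ?f' x v)"
    proof (rule continuous_on_open_Un)
      have "continuous_on (ball 0 \<epsilon>) (\<lambda>x. 0 :: complex)" by simp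
      then show "continuous_on (ball 0 \<epsilon>) (\<lambda>x. ?f' x v)"
        by (rule continuous_on_eq) (use q'0 z in auto)
      have "continuous_on (- {0}) (\<lambda>x. q' x v)" "continuous_on (- {0}) q"
        using q C1_continuous[OF q] by (auto simp: C1_def intro: continuous_on_subset)
      then show "continuous_on (- {0}) (\<lambda>x. ?f' x v)"
        by (auto intro!: continuous_intros)
    qed auto
    moreover have "ball 0 \<epsilon> \<union> - {0} = (UNIV :: complex set)" using \<open>\<epsilon> > 0\<close> by auto
    ultimately show ?thesis by simp
  qed
  ultimately show ?thesis by (simp add: C1_def)
qed

text \<open>Multiplication by \<open>- B\<close> is complex linear: the derivative of the holomorphic factor leaves no trace
in \<open>dbar\<close>.\<close>

lemma dbar_pole_weight:
  "dbar (\<lambda>v. of_real (q v) * A - B * v) = (of_real (q 1) + \<i> * of_real (q \<i>)) / 2 * A"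
proof -
  have "of_real (q 1) * A - B * 1 + \<i> * (of_real (q \<i>) * A - B * \<i>)
      = (of_real (q 1) + \<i> * of_real (q \<i>)) * A - B * (1 + \<i> * \<i>)"
    by (simp only: algebra_simps)
  then show ?thesis by (simp add: dbar_def)
qed

lemma dbar_mult:
  "dbar (\<lambda>v. a * D v + E v * b) = a * dbar D + dbar E * b"
  by (simp add: dbar_def algebra_simps add_divide_distrib)

text \<open>The shape of \<open>dbar\<close> of a radial function; the gradient of a function of \<open>x \<bullet> x\<close> has this form.\<close>

lemma complex_gradient_norm_squared: 
  "(complex_of_real (c * (x \<bullet> 1)) + \<i> * of_real (c * (x \<bullet> \<i>))) / 2 = of_real (c / 2) * x"
  by (simp add: complex_eq_iff inner_complex_def)

text \<open>The integral over the plane of \<open>step' (|w|\<^sup>2 - 1)\<close>.  It equals \<open>\<pi>\<close>, by polar coordinates.\<close>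

definition pompeiu_const :: real where
  "pompeiu_const = (LINT w::complex|lborel. step' (w \<bullet> w - 1))"

lemma step'_shell: 
  fixes w :: complex
  assumes "step' (w \<bullet> w - 1) \<noteq> 0"
  shows "w \<in> cball 0 2"
proof -
  have "w \<bullet> w < 2" using step'_eq_0[of "w \<bullet> w - 1"] assms by force
  then have "(norm w)\<^sup>2 < 2\<^sup>2" by (simp add: power2_norm_eq_inner)
  then have "norm w < 2" by (rule power_less_imp_less_base) simp
  then show ?thesis by simp
qed

lemma integrable_step'_shell: "integrable lborel (\<lambda>w::complex. step' (w \<bullet> w - 1))"
proof -
  have c: "continuous_on UNIV (\<lambda>w::complex. step' (w \<bullet> w - 1))"
    by (auto intro!: continuous_intros continuous_on_compose2[OF continuous_step'])
  have "integrable lborel (\<lambda>w::complex. indicator (cball 0 2) w *\<^sub>R step' (w \<bullet> w - 1))"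
    using borel_integrable_compact[OF compact_cball continuous_on_subset[OF c subset_UNIV]]
    by (simp add: set_integrable_def)
  moreover have "(\<lambda>w::complex. indicator (cball 0 2) w *\<^sub>R step' (w \<bullet> w - 1)) = (\<lambda>w. step' (w \<bullet> w - 1))"
    using step'_shell by (fastforce simp: indicator_def)
  ultimately show ?thesis by simp
qed

lemma pompeiu_const_pos: "pompeiu_const > 0"
proof -
  have "pompeiu_const \<ge> 0" 
    unfolding pompeiu_const_def by (intro integral_nonneg_AE) (simp add: step'_nonneg)
  moreover have "pompeiu_const \<noteq> 0"
  proof
    assume "pompeiu_const = 0"
    then have ae: "AE w::complex in lborel. step' (w \<bullet> w - 1) = 0"
      unfolding pompeiu_const_def
      by (subst (asm) integral_nonneg_eq_0_iff_AE[OF integrable_step'_shell]) (auto simp: step'_nonneg)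
    define S where "S = {w::complex. 1 < w \<bullet> w \<and> w \<bullet> w < 2}"
    have "open S" unfolding S_def by (intro open_Collect_conj open_Collect_less continuous_intros)
    have "of_real (5/4) \<in> S" by (simp add: S_def inner_complex_def)
    have "AE w in lborel. w \<notin> S"
      using ae
    proof eventually_elim
      fix w :: complex assume "step' (w \<bullet> w - 1) = 0"
      then have "\<not> (0 < w \<bullet> w - 1 \<and> w \<bullet> w - 1 < 1)"
        using step'_pos[of "w \<bullet> w - 1"] by linarith
      then show "w \<notin> S" by (simp add: S_def)
    qed
    then have "S \<in> null_sets lborel"
      using AE_iff_null_sets[of S lborel] \<open>open S\<close> by simp
    then have "negligible S" by (simp add: negligible_iff_null_sets null_sets_completionI)
    then show False using open_not_negligible[OF \<open>open S\<close>] \<open>of_real (5/4) \<in> S\<close> by blast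
  qed
  ultimately show ?thesis by linarith
qed

lemma integral_lborel_scale:
  fixes f :: "'a::euclidean_space \<Rightarrow> 'b::{banach, second_countable_topology}"
  assumes [measurable]: "f \<in> borel_measurable borel" and "\<epsilon> > 0"
  shows "(LINT x|lborel. f x) = \<epsilon> ^ DIM('a) *\<^sub>R (LINT x|lborel. f (\<epsilon> *\<^sub>R x))"
proof -
  let ?T = "\<lambda>x::'a. 0 + \<epsilon> *\<^sub>R x" and ?k = "\<epsilon> ^ DIM('a)"
  have eq: "density (distr lborel borel ?T) (\<lambda>_. ennreal ?k) = lborel"
    using lborel_affine[of \<epsilon> "0::'a", symmetric] \<open>\<epsilon> > 0\<close> by simp
  have "(LINT x|lborel. f x) = (LINT x|density (distr lborel borel ?T) (\<lambda>_. ennreal ?k). f x)"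
    unfolding eq ..
  also have "\<dots> = (LINT x|distr lborel borel ?T. ?k *\<^sub>R f x)"
    using \<open>\<epsilon> > 0\<close> by (intro integral_density) auto
  also have "\<dots> = (LINT x|lborel. ?k *\<^sub>R f (?T x))"
    by (intro integral_distr) auto
  finally show ?thesis by simp
qed

text \<open>The Cauchy-Pompeiu formula as an inequality.  The kernel \<open>1 / x\<close> is cut off to \<open>q x / x\<close>, where
\<open>q x = step (|x|\<^sup>2 / \<epsilon>\<^sup>2 - 1)\<close>.  The integral of \<open>dbar (f (z + x) q x / x)\<close> is \<open>0\<close>, and \<open>dbar q\<close> is \<open>x\<close> times
a radial bump of width \<open>\<epsilon>\<close>.  So \<open>f\<close> averaged over this bump is minus the integral of
\<open>q x / x\<close> times \<open>dbar f\<close>, and the average tends to \<open>pompeiu_const\<close> times \<open>f z\<close> as \<open>\<epsilon> \<longrightarrow> 0\<close>.\<close>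

lemma pompeiu_inequality:
  assumes f: "C1 f f'" and z: "\<And>x. x \<notin> cball 0 r \<Longrightarrow> f x = 0"
  shows "ennreal (pompeiu_const * cmod (f z)) \<le> (\<integral>\<^sup>+\<zeta>. cmod (dbar (f' \<zeta>)) / cmod (\<zeta> - z) \<partial>lborel)"
proof -
  note [measurable] = C1_borel_measurable[OF f]
  have dbar_meas[measurable]: "(\<lambda>\<zeta>. dbar (f' \<zeta>)) \<in> borel_measurable borel"
    unfolding dbar_def by measurable
  have [measurable]: "step' \<in> borel_measurable borel"
    by (rule borel_measurable_continuous_onI[OF continuous_step'])
  let ?R = "\<integral>\<^sup>+\<zeta>. cmod (dbar (f' (z + \<zeta>))) / cmod \<zeta> \<partial>lborel"
  \<comment> \<open>The average of \<open>f\<close> around \<open>z\<close> is written in the rescaled variable, so that the right side does not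
    depend on \<open>\<epsilon>\<close>.\<close>
  have key: "ennreal (cmod (LINT w|lborel. step' (w \<bullet> w - 1) *\<^sub>R f (z + \<epsilon> *\<^sub>R w))) \<le> ?R"
    if "\<epsilon> > 0" for \<epsilon> :: real
  proof -
    define \<alpha> where "\<alpha> = 1 / \<epsilon>\<^sup>2"
    have "\<alpha> > 0" using that by (simp add: \<alpha>_def)
    define q where "q x = step (\<alpha> * (x \<bullet> x) + (-1))" for x :: complex
    define q' where "q' x v = step' (\<alpha> * (x \<bullet> x) + (-1)) * (2 * \<alpha> * (x \<bullet> v))" for x v :: complex
    have q: "C1 q q'" unfolding q_def[abs_def] q'_def[abs_def] by (rule C1_radial_step)
    have q0: "q x = 0" if "norm x < \<epsilon>" for x
    proof -
      have "x \<bullet> x \<le> \<epsilon>\<^sup>2" using power_mono[of "norm x" \<epsilon> 2] that by (simp add: power2_norm_eq_inner)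
      then show ?thesis using \<open>\<epsilon> > 0\<close> unfolding q_def \<alpha>_def by (intro step_eq_0) (simp add: field_simps)
    qed
    have q1: "0 \<le> q x" "q x \<le> 1" for x by (auto simp: q_def step_bounds)
    note k = C1_pole_weight[OF q that q0, of 1]
    note F = C1_mult[OF C1_translate[OF f, of z] k]
    define F' where "F' x v = f (z + x) * (of_real (q' x v) * inverse x ^ 1 - of_real (q x) * of_nat 1 * inverse x ^ Suc 1 * v)
        + f' (z + x) v * (of_real (q x) * inverse x ^ 1)" for x v
    have Fz: "f (z + x) * (of_real (q x) * inverse x ^ 1) = 0" if "x \<notin> cball (- z) r" for x
      using z[of "z + x"] that by (auto simp: dist_norm norm_minus_commute add.commute)
    have int: "integrable lborel (\<lambda>x. F' x v)" "(LINT x|lborel. F' x v) = 0" for v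
      unfolding F'_def using integral_C1_derivative_eq_0[OF F Fz] by blast+
    have dbarF: "dbar (F' x) = (step' (\<alpha> * (x \<bullet> x) + (-1)) * \<alpha>) *\<^sub>R f (z + x) 
        + q x *\<^sub>R (dbar (f' (z + x)) * inverse x)" for x
    proof (cases "x = 0")
      case True
      then have "F' x = (\<lambda>v. 0)" using q0[of x] that by (simp add: F'_def q'_def fun_eq_iff)
      then show ?thesis using True by (simp add: dbar_def step'_eq_0)
    next
      case False
      have "dbar (F' x) = f (z + x) * ((of_real (q' x 1) + \<i> * of_real (q' x \<i>)) / 2 * inverse x ^ 1)
          + dbar (f' (z + x)) * (of_real (q x) * inverse x ^ 1)"
        unfolding F'_def by (simp only: dbar_mult dbar_pole_weight)
      also have "(of_real (q' x 1) + \<i> * of_real (q' x \<i>)) / 2 = of_real (step' (\<alpha> * (x \<bullet> x) + (-1)) * \<alpha>) * x"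
        unfolding q'_def
        using complex_gradient_norm_squared[of "step' (\<alpha> * (x \<bullet> x) + (-1)) * (2 * \<alpha>)" x]
        by (simp add: mult.assoc)
      finally show ?thesis using False by (simp add: scaleR_conv_of_real mult_ac)
    qed
    have i0: "integrable lborel (\<lambda>x. dbar (F' x))" "(LINT x|lborel. dbar (F' x)) = 0"
      unfolding dbar_def using int by auto
    let ?A = "\<lambda>x. (step' (\<alpha> * (x \<bullet> x) + (-1)) * \<alpha>) *\<^sub>R f (z + x)"
    let ?B = "\<lambda>x. q x *\<^sub>R (dbar (f' (z + x)) * inverse x)"
    have [measurable]: "q \<in> borel_measurable borel" using C1_borel_measurable(1)[OF q] .
    have A: "integrable lborel ?A"
    proof -
      have "continuous_on UNIV ?A"
        by (intro continuous_intros continuous_on_compose2[OF continuous_step']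
            continuous_on_compose2[OF C1_continuous[OF f]] subset_UNIV)
      then have "integrable lborel (\<lambda>x. indicator (cball (- z) r) x *\<^sub>R ?A x)"
        by (rule borel_integrable_compact[OF compact_cball continuous_on_subset[OF _ subset_UNIV]])
      moreover have "(\<lambda>x. indicator (cball (- z) r) x *\<^sub>R ?A x) = ?A"
        using z by (fastforce simp: indicator_def dist_norm norm_minus_commute add.commute)
      ultimately show ?thesis by simp
    qed
    have B: "integrable lborel ?B"
      using Bochner_Integration.integrable_diff[OF i0(1) A] unfolding dbarF by simp
    have "(LINT x|lborel. ?A x) = - (LINT x|lborel. ?B x)"
      using i0(2) A B unfolding dbarF by (simp add: add_eq_0_iff2)
    then have "ennreal (cmod (LINT x|lborel. ?A x)) \<le> (\<integral>\<^sup>+x. norm (?B x) \<partial>lborel)"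
      using integral_norm_bound_ennreal[OF B] by simp
    also have "\<dots> \<le> ?R"
    proof (intro nn_integral_mono ennreal_leI)
      fix x
      have "norm (?B x) = q x * (cmod (dbar (f' (z + x))) / cmod x)"
        using q1[of x] by (simp add: norm_mult norm_inverse divide_inverse)
      also have "\<dots> \<le> 1 * (cmod (dbar (f' (z + x))) / cmod x)"
        using q1[of x] by (intro mult_right_mono) auto
      finally show "norm (?B x) \<le> cmod (dbar (f' (z + x))) / cmod x" by simp
    qed
    also have "(LINT x|lborel. ?A x) = (LINT w|lborel. step' (w \<bullet> w - 1) *\<^sub>R f (z + \<epsilon> *\<^sub>R w))"
    proof -
      have "(LINT x|lborel. ?A x) = \<epsilon>\<^sup>2 *\<^sub>R (LINT w|lborel. ?A (\<epsilon> *\<^sub>R w))"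
        using integral_lborel_scale[of ?A \<epsilon>] that borel_measurable_integrable[OF A] by simp
      also have "\<dots> = (LINT w|lborel. \<epsilon>\<^sup>2 *\<^sub>R ?A (\<epsilon> *\<^sub>R w))"
        by (simp del: scaleR_scaleR)
      also have "(\<lambda>w. \<epsilon>\<^sup>2 *\<^sub>R ?A (\<epsilon> *\<^sub>R w)) = (\<lambda>w. step' (w \<bullet> w - 1) *\<^sub>R f (z + \<epsilon> *\<^sub>R w))"
        using that by (auto simp: \<alpha>_def fun_eq_iff power2_eq_square)
      finally show ?thesis .
    qed
    finally show ?thesis .
  qed
  obtain M where M: "\<And>x. cmod (f x) \<le> M"
  proof -
    have "compact (f ` cball 0 r)"
      using C1_continuous[OF f] by (intro compact_continuous_image) (auto intro: continuous_on_subset)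
    then obtain M where M: "\<And>x. x \<in> cball 0 r \<Longrightarrow> norm (f x) \<le> M"
      by (fastforce dest!: compact_imp_bounded simp: bounded_iff)
    have "norm (f x) \<le> max M 0" for x
    proof (cases "x \<in> cball 0 r")
      case False
      then show ?thesis using z by simp
    qed (use M in \<open>simp add: le_max_iff_disj\<close>)
    then show ?thesis using that by blast
  qed
  have "(\<lambda>n. LINT w|lborel. step' (w \<bullet> w - 1) *\<^sub>R f (z + (1 / real (Suc n)) *\<^sub>R w))
      \<longlonglongrightarrow> (LINT (w::complex)|lborel. step' (w \<bullet> w - 1) *\<^sub>R f z)"
  proof (rule integral_dominated_convergence[where w="\<lambda>w. M * step' (w \<bullet> w - 1)"])
    show "integrable lborel (\<lambda>w::complex. M * step' (w \<bullet> w - 1))"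
      using integrable_step'_shell by simp
    show "AE w in lborel. (\<lambda>n. step' (w \<bullet> w - 1) *\<^sub>R f (z + (1 / real (Suc n)) *\<^sub>R w)) \<longlonglongrightarrow> step' (w \<bullet> w - 1) *\<^sub>R f z"
    proof (intro AE_I2 tendsto_scaleR tendsto_const)
      fix w
      have "(\<lambda>n. z + (1 / real (Suc n)) *\<^sub>R w) \<longlonglongrightarrow> z + 0 *\<^sub>R w"
        by (intro tendsto_intros LIMSEQ_Suc[OF lim_1_over_n])
      moreover have "isCont f z"
        using C1_continuous[OF f] by (simp add: continuous_on_eq_continuous_at)
      ultimately show "(\<lambda>n. f (z + (1 / real (Suc n)) *\<^sub>R w)) \<longlonglongrightarrow> f z"
        using isCont_tendsto_compose by fastforce
    qed
    show "AE w in lborel. norm (step' (w \<bullet> w - 1) *\<^sub>R f (z + (1 / real (Suc n)) *\<^sub>R w)) \<le> M * step' (w \<bullet> w - 1)" for n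
      using M step'_nonneg by (auto simp: mult.commute[of M] intro!: mult_left_mono)
  qed measurable
  then have "(\<lambda>n. ennreal (cmod (LINT w|lborel. step' (w \<bullet> w - 1) *\<^sub>R f (z + (1 / real (Suc n)) *\<^sub>R w))))
      \<longlonglongrightarrow> ennreal (cmod (LINT (w::complex)|lborel. step' (w \<bullet> w - 1) *\<^sub>R f z))"
    by (intro tendsto_ennrealI tendsto_norm)
  then have "ennreal (cmod (LINT (w::complex)|lborel. step' (w \<bullet> w - 1) *\<^sub>R f z)) \<le> ?R"
    by (rule LIMSEQ_le_const2) (use key in auto)
  also have "(LINT (w::complex)|lborel. step' (w \<bullet> w - 1) *\<^sub>R f z) = pompeiu_const *\<^sub>R f z"
    using integrable_step'_shell by (simp add: pompeiu_const_def)
  also have "cmod (pompeiu_const *\<^sub>R f z) = pompeiu_const * cmod (f z)"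
    using pompeiu_const_pos by simp
  also have "?R = (\<integral>\<^sup>+\<zeta>. cmod (dbar (f' \<zeta>)) / cmod (\<zeta> - z) \<partial>lborel)"
    using nn_integral_lborel_translate[of "\<lambda>\<zeta>. ennreal (cmod (dbar (f' \<zeta>)) / cmod (\<zeta> - z))" z] by simp
  finally show ?thesis .
qed

text \<open>Tonelli's theorem applied to the product of \<open>w z\<close> with the Pompeiu inequality at \<open>z\<close>: the integral
over \<open>z\<close> is done first and is the Cauchy potential of \<open>w\<close>.\<close>

lemma carleman_inequality:
  fixes w :: "complex \<Rightarrow> ennreal"
  assumes f: "C1 f f'" and z: "\<And>x. x \<notin> cball 0 r \<Longrightarrow> f x = 0"
    and [measurable]: "w \<in> borel_measurable borel"
    and kato: "\<And>\<zeta>. (\<integral>\<^sup>+z. w z * ennreal (1 / cmod (\<zeta> - z)) \<partial>lborel) \<le> \<kappa>"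
  shows "ennreal pompeiu_const * (\<integral>\<^sup>+z. w z * cmod (f z) \<partial>lborel) \<le> \<kappa> * (\<integral>\<^sup>+\<zeta>. cmod (dbar (f' \<zeta>)) \<partial>lborel)"
proof -
  note [measurable] = C1_borel_measurable[OF f]
  have dbar_meas[measurable]: "(\<lambda>\<zeta>. dbar (f' \<zeta>)) \<in> borel_measurable borel"
    unfolding dbar_def by measurable
  have "ennreal pompeiu_const * (\<integral>\<^sup>+z. w z * cmod (f z) \<partial>lborel) = (\<integral>\<^sup>+z. w z * ennreal (pompeiu_const * cmod (f z)) \<partial>lborel)"
    using pompeiu_const_pos
    by (subst nn_integral_cmult[symmetric]) (auto simp: ennreal_mult mult_ac)
  also have "\<dots> \<le> (\<integral>\<^sup>+z. w z * (\<integral>\<^sup>+\<zeta>. cmod (dbar (f' \<zeta>)) / cmod (\<zeta> - z) \<partial>lborel) \<partial>lborel)"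
    by (intro nn_integral_mono mult_left_mono pompeiu_inequality[OF f z]) auto
  also have "\<dots> = (\<integral>\<^sup>+z. \<integral>\<^sup>+\<zeta>. w z * ennreal (cmod (dbar (f' \<zeta>)) / cmod (\<zeta> - z)) \<partial>lborel \<partial>lborel)"
    by (simp add: nn_integral_cmult)
  also have "\<dots> = (\<integral>\<^sup>+\<zeta>. \<integral>\<^sup>+z. w z * ennreal (cmod (dbar (f' \<zeta>)) / cmod (\<zeta> - z)) \<partial>lborel \<partial>lborel)"
    by (rule lborel_pair.Fubini') measurable
  also have "\<dots> = (\<integral>\<^sup>+\<zeta>. (\<integral>\<^sup>+z. w z * ennreal (1 / cmod (\<zeta> - z)) \<partial>lborel) * ennreal (cmod (dbar (f' \<zeta>))) \<partial>lborel)"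
  proof (intro nn_integral_cong)
    fix \<zeta>
    have "ennreal (cmod (dbar (f' \<zeta>)) / cmod (\<zeta> - z)) = ennreal (1 / cmod (\<zeta> - z)) * ennreal (cmod (dbar (f' \<zeta>)))" for z
      by (simp flip: ennreal_mult')
    then show "(\<integral>\<^sup>+z. w z * ennreal (cmod (dbar (f' \<zeta>)) / cmod (\<zeta> - z)) \<partial>lborel)
        = (\<integral>\<^sup>+z. w z * ennreal (1 / cmod (\<zeta> - z)) \<partial>lborel) * ennreal (cmod (dbar (f' \<zeta>)))"
      by (simp add: nn_integral_multc flip: mult.assoc)
  qed
  also have "\<dots> \<le> (\<integral>\<^sup>+\<zeta>. \<kappa> * ennreal (cmod (dbar (f' \<zeta>))) \<partial>lborel)"
    by (intro nn_integral_mono mult_right_mono kato) auto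
  also have "\<dots> = \<kappa> * (\<integral>\<^sup>+\<zeta>. cmod (dbar (f' \<zeta>)) \<partial>lborel)"
    by (simp add: nn_integral_cmult)
  finally show ?thesis .
qed

section \<open>Weakly singular integrals\<close>

lemma borel_ball [measurable]: "ball a r \<in> sets borel"
  by simp

lemma dyadic_scale:
  fixes y :: real
  assumes "0 < y" "y < 1"
  obtains k where "(1/2) ^ Suc k \<le> y" "y < (1/2) ^ k"
proof -
  define n where "n = (LEAST n. (1/2) ^ n \<le> y)"
  have "\<exists>m. (1/2) ^ m < y" by (rule real_arch_pow_inv[OF assms(1)]) simp
  then obtain m where "(1/2) ^ m < y" ..
  then have "(1/2) ^ m \<le> y" by (rule less_imp_le)
  then have n: "(1/2) ^ n \<le> y" unfolding n_def by (rule LeastI)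
  have "n \<noteq> 0" using n assms(2) by (intro notI) simp
  then obtain k where k: "n = Suc k" using not0_implies_Suc by blast
  have "\<not> (1/2) ^ k \<le> y" using not_less_Least[of k "\<lambda>n. (1/2) ^ n \<le> y"] k by (auto simp: n_def)
  then show ?thesis using that n k by auto
qed

text \<open>Cut the ball into the dyadic shells \<open>R / 2\<^sup>k\<^sup>+\<^sup>1 \<le> |x - a| < R / 2\<^sup>k\<close>, on which the weight is almost
constant.  The \<open>k\<close>-th shell contributes at most a constant times \<open>2\<^sup>-\<^sup>k\<^sup>(\<^sup>s\<^sup>-\<^sup>\<gamma>\<^sup>)\<close>.  This serves both for the
plain powers \<open>|z|\<^sup>-\<^sup>\<gamma>\<close> and for turning vanishing to infinite order into integrability against any pole.\<close>

lemma nn_integral_pole_weight_finite: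
  fixes h :: "'a::euclidean_space \<Rightarrow> ennreal"
  assumes [measurable]: "h \<in> borel_measurable borel" and "R > 0" "0 \<le> \<gamma>" "\<gamma> < s" "C \<ge> 0"
    and le: "\<And>r. 0 < r \<Longrightarrow> r \<le> R \<Longrightarrow> (\<integral>\<^sup>+x\<in>ball a r. h x \<partial>lborel) \<le> ennreal (C * r powr s)"
  shows "(\<integral>\<^sup>+x\<in>ball a R. h x * ennreal (norm (x - a) powr - \<gamma>) \<partial>lborel) < \<infinity>"
proof -
  define r where "r k = R * (1/2) ^ k" for k :: nat
  have r: "r k > 0" "r k \<le> R" for k
    using \<open>R > 0\<close> by (auto simp: r_def mult_le_cancel_left1 power_le_one)
  define c where "c k = r (Suc k) powr - \<gamma>" for k
  have ptw: "h x * ennreal (norm (x - a) powr - \<gamma>) * indicator (ball a R) x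
      \<le> (\<Sum>k. ennreal (c k) * (h x * indicator (ball a (r k)) x))" for x
  proof (cases "x \<in> ball a R \<and> x \<noteq> a")
    case True
    then have "0 < norm (x - a) / R" "norm (x - a) / R < 1"
      using \<open>R > 0\<close> by (auto simp: dist_norm norm_minus_commute)
    then obtain k where k: "(1/2) ^ Suc k \<le> norm (x - a) / R" "norm (x - a) / R < (1/2) ^ k"
      by (rule dyadic_scale)
    have k1: "r (Suc k) \<le> norm (x - a)" and k2: "norm (x - a) < r k"
      using k \<open>R > 0\<close> unfolding r_def by (simp_all add: pos_le_divide_eq pos_divide_less_eq mult_ac)
    have "norm (x - a) powr - \<gamma> \<le> c k"
      unfolding c_def using k1 r(1)[of "Suc k"] \<open>0 \<le> \<gamma>\<close> by (intro powr_mono2') auto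
    then have "h x * ennreal (norm (x - a) powr - \<gamma>) * indicator (ball a R) x
        \<le> ennreal (c k) * (h x * indicator (ball a (r k)) x)"
      using True k2 by (auto simp: dist_norm norm_minus_commute mult.commute intro!: mult_left_mono ennreal_leI)
    also have "\<dots> = (\<Sum>k\<in>{k}. ennreal (c k) * (h x * indicator (ball a (r k)) x))" by simp
    also have "\<dots> \<le> (\<Sum>k. ennreal (c k) * (h x * indicator (ball a (r k)) x))"
      by (rule sum_le_suminf) auto
    finally show ?thesis .
  next
    case False
    then show ?thesis by (auto simp: indicator_def)
  qed
  define \<theta> where "\<theta> = 2 powr - (s - \<gamma>)"
  have \<theta>: "0 < \<theta>" "\<theta> < 1" using \<open>\<gamma> < s\<close> by (auto simp: \<theta>_def powr_less_one)
  define D where "D = C * R powr (s - \<gamma>) * 2 powr \<gamma>"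
  have ck: "c k * (C * r k powr s) = D * \<theta> ^ k" for k
  proof -
    have h: "(1/2::real) ^ k = 2 powr - real k" for k
      by (simp add: powr_minus powr_realpow power_one_over inverse_eq_divide)
    have rk: "r k powr e = R powr e * 2 powr (- real k * e)" for k e
      unfolding r_def h using \<open>R > 0\<close> by (simp add: powr_mult powr_powr)
    have "c k * r k powr s = R powr (s - \<gamma>) * 2 powr (real (Suc k) * \<gamma> - real k * s)"
      unfolding c_def rk using \<open>R > 0\<close> by (simp add: powr_add[symmetric] powr_diff powr_minus field_simps)
    also have "2 powr (real (Suc k) * \<gamma> - real k * s) = 2 powr \<gamma> * 2 powr (- (s - \<gamma>) * real k)"
      by (simp add: powr_add[symmetric] algebra_simps)
    also have "2 powr (- (s - \<gamma>) * real k) = \<theta> ^ k"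
      unfolding \<theta>_def by (simp add: powr_powr[symmetric] powr_realpow)
    finally show ?thesis by (simp add: D_def mult_ac)
  qed
  have "(\<integral>\<^sup>+x\<in>ball a R. h x * ennreal (norm (x - a) powr - \<gamma>) \<partial>lborel)
      \<le> (\<integral>\<^sup>+x. (\<Sum>k. ennreal (c k) * (h x * indicator (ball a (r k)) x)) \<partial>lborel)"
    by (intro nn_integral_mono ptw)
  also have "\<dots> = (\<Sum>k. \<integral>\<^sup>+x. ennreal (c k) * (h x * indicator (ball a (r k)) x) \<partial>lborel)"
    by (rule nn_integral_suminf) measurable
  also have "\<dots> = (\<Sum>k. ennreal (c k) * (\<integral>\<^sup>+x. h x * indicator (ball a (r k)) x \<partial>lborel))"
    by (intro suminf_cong nn_integral_cmult) measurable
  also have "\<dots> \<le> (\<Sum>k. ennreal (D * \<theta> ^ k))"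
  proof (rule suminf_le)
    fix k
    have "ennreal (c k) * (\<integral>\<^sup>+x. h x * indicator (ball a (r k)) x \<partial>lborel)
        \<le> ennreal (c k) * ennreal (C * r k powr s)"
      by (intro mult_left_mono le r) auto
    also have "\<dots> = ennreal (D * \<theta> ^ k)"
      unfolding ck[symmetric] using \<open>C \<ge> 0\<close> by (simp add: ennreal_mult c_def)
    finally show "ennreal (c k) * (\<integral>\<^sup>+x. h x * indicator (ball a (r k)) x \<partial>lborel) \<le> ennreal (D * \<theta> ^ k)" .
  qed (rule summableI)+
  also have "\<dots> = ennreal (D * (1 / (1 - \<theta>)))"
    using \<theta> \<open>C \<ge> 0\<close> by (intro suminf_ennreal_eq sums_mult geometric_sums) (auto simp: D_def)
  also have "\<dots> < \<infinity>" by simp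
  finally show ?thesis .
qed

lemma nn_integral_pole_finite:
  assumes "R > 0" "0 \<le> \<gamma>" "\<gamma> < 2"
  shows "(\<integral>\<^sup>+z\<in>ball (0::complex) R. ennreal (norm z powr - \<gamma>) \<partial>lborel) < \<infinity>"
proof -
  have "(\<integral>\<^sup>+z\<in>ball (0::complex) r. 1 \<partial>lborel) \<le> ennreal (unit_ball_vol 2 * r powr 2)" if "r > 0" for r
    using that by (simp add: emeasure_ball powr_numeral)
  then show ?thesis
    using nn_integral_pole_weight_finite[of "\<lambda>_. 1" R \<gamma> 2 "unit_ball_vol 2" "0::complex"] assms by simp
qed

text \<open>Within distance \<open>t\<close> of \<open>\<zeta>\<close> the singularity has small integral by translation invariance, uniformly
in \<open>\<zeta>\<close>; farther away it is at most \<open>t\<^sup>-\<^sup>\<gamma>\<close>, and then the integrand no longer depends on \<open>\<zeta>\<close> and the thin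
annulus makes its integral small.  The annulus is open on the inner side, since for \<open>\<delta> \<longrightarrow> 0\<close> it has
to shrink to the empty set.\<close>

lemma thin_annulus_kato:
  fixes H :: "complex \<Rightarrow> ennreal"
  assumes [measurable]: "H \<in> borel_measurable borel" and H: "(\<integral>\<^sup>+z\<in>ball 0 1. H z \<partial>lborel) < \<infinity>"
    and \<gamma>: "0 \<le> \<gamma>" "\<gamma> < 2" and S: "0 \<le> S" "S < 1" and "\<kappa> > 0"
  obtains \<delta> where "\<delta> > 0" "S + \<delta> < 1"
    "\<And>\<zeta>. (\<integral>\<^sup>+z\<in>{z. S < norm z \<and> norm z < S + \<delta>}. (H z + ennreal (norm (z - \<zeta>) powr - \<gamma>)) \<partial>lborel) \<le> ennreal \<kappa>"
proof -
  let ?k = "\<lambda>z::complex. ennreal (norm z powr - \<gamma>)"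
  have "(\<lambda>n. \<integral>\<^sup>+z. ?k z * indicator (ball 0 (1 / real (Suc n))) z \<partial>lborel) \<longlonglongrightarrow> (\<integral>\<^sup>+(z::complex). 0 \<partial>lborel)"
  proof (rule nn_integral_dominated_convergence[where w="\<lambda>z. ?k z * indicator (ball 0 1) z"])
    show "(\<integral>\<^sup>+z. ?k z * indicator (ball 0 1) z \<partial>lborel) < \<infinity>"
      using nn_integral_pole_finite[of 1 \<gamma>] \<gamma> by simp
    show "AE z in lborel. ?k z * indicator (ball 0 (1 / real (Suc n))) z \<le> ?k z * indicator (ball 0 1) z" for n
    proof (intro AE_I2 mult_left_mono)
      fix z :: complex
      have "ball (0::complex) (1 / real (Suc n)) \<subseteq> ball 0 1" by (intro subset_ball) simp
      then show "indicator (ball 0 (1 / real (Suc n))) z \<le> (indicator (ball 0 1) z :: ennreal)"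
        by (auto simp: indicator_def)
    qed simp
    show "AE z in lborel. (\<lambda>n. ?k z * indicator (ball 0 (1 / real (Suc n))) z) \<longlonglongrightarrow> 0"
    proof (intro AE_I2)
      fix z :: complex
      show "(\<lambda>n. ?k z * indicator (ball 0 (1 / real (Suc n))) z) \<longlonglongrightarrow> 0"
      proof (cases "z = 0")
        case False
        have "(\<lambda>n. 1 / real (Suc n)) \<longlonglongrightarrow> 0" by (rule LIMSEQ_Suc[OF lim_1_over_n])
        then have "\<forall>\<^sub>F n in sequentially. 1 / real (Suc n) < norm z"
          using False by (intro order_tendstoD) auto
        then have "\<forall>\<^sub>F n in sequentially. ?k z * indicator (ball 0 (1 / real (Suc n))) z = 0"
          by eventually_elim auto
        then show ?thesis by (rule tendsto_eventually)
      qed simp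
    qed
  qed auto
  then have "\<forall>\<^sub>F n in sequentially. (\<integral>\<^sup>+z. ?k z * indicator (ball 0 (1 / real (Suc n))) z \<partial>lborel) < ennreal (\<kappa> / 2)"
    using \<open>\<kappa> > 0\<close> by (intro order_tendstoD) auto
  then obtain n where n: "(\<integral>\<^sup>+z. ?k z * indicator (ball 0 (1 / real (Suc n))) z \<partial>lborel) < ennreal (\<kappa> / 2)"
    by (auto simp: eventually_sequentially)
  define t where "t = 1 / real (Suc n)"
  have t: "t > 0" by (simp add: t_def)
  define H2 where "H2 z = H z + ennreal (t powr - \<gamma>)" for z
  define \<delta> where "\<delta> n = (1 - S) / real (Suc (Suc n))" for n
  have \<delta>: "\<delta> n > 0" "S + \<delta> n < 1" for n
  proof -
    show "\<delta> n > 0" using S by (simp add: \<delta>_def)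
    have "(1 - S) * 1 < (1 - S) * real (Suc (Suc n))" using S by (intro mult_strict_left_mono) auto
    then have "\<delta> n < 1 - S" unfolding \<delta>_def by (simp add: pos_divide_less_eq)
    then show "S + \<delta> n < 1" by simp
  qed
  define A where "A n = {z::complex. S < norm z \<and> norm z < S + \<delta> n}" for n
  have [measurable]: "A n \<in> sets borel" for n unfolding A_def by measurable
  have [measurable]: "H2 \<in> borel_measurable borel" unfolding H2_def[abs_def] by measurable
  have "(\<lambda>n. \<integral>\<^sup>+z. H2 z * indicator (A n) z \<partial>lborel) \<longlonglongrightarrow> (\<integral>\<^sup>+(z::complex). 0 \<partial>lborel)"
  proof (rule nn_integral_dominated_convergence[where w="\<lambda>z. H2 z * indicator (ball 0 1) z"])
    have "(\<integral>\<^sup>+z. H2 z * indicator (ball 0 1) z \<partial>lborel)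
        = (\<integral>\<^sup>+z\<in>ball 0 1. H z \<partial>lborel) + ennreal (t powr - \<gamma>) * emeasure lborel (ball (0::complex) 1)"
      unfolding H2_def by (simp add: distrib_right nn_integral_add nn_integral_cmult)
    also have "\<dots> < \<infinity>"
      using H by (simp add: ennreal_mult_less_top emeasure_lborel_ball_finite[simplified])
    finally show "(\<integral>\<^sup>+z. H2 z * indicator (ball 0 1) z \<partial>lborel) < \<infinity>" .
    show "AE z in lborel. H2 z * indicator (A n) z \<le> H2 z * indicator (ball 0 1) z" for n
      using \<delta>(2)[of n] by (intro AE_I2 mult_left_mono) (auto simp: A_def indicator_def)
    show "AE z in lborel. (\<lambda>n. H2 z * indicator (A n) z) \<longlonglongrightarrow> 0"
    proof (intro AE_I2)
      fix z :: complex
      show "(\<lambda>n. H2 z * indicator (A n) z) \<longlonglongrightarrow> 0"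
      proof (cases "S < norm z")
        case True
        have "(\<lambda>n. (1 - S) * (1 / real (Suc (Suc n)))) \<longlonglongrightarrow> (1 - S) * 0"
          by (intro tendsto_mult tendsto_const LIMSEQ_Suc[OF LIMSEQ_Suc[OF lim_1_over_n]])
        then have "\<delta> \<longlonglongrightarrow> 0" by (simp add: \<delta>_def[abs_def])
        then have "\<forall>\<^sub>F n in sequentially. \<delta> n < norm z - S"
          using True by (intro order_tendstoD) auto
        then have "\<forall>\<^sub>F n in sequentially. H2 z * indicator (A n) z = 0"
          by eventually_elim (auto simp: A_def)
        then show ?thesis by (rule tendsto_eventually)
      qed (simp add: A_def)
    qed
  qed auto
  then have "\<forall>\<^sub>F n in sequentially. (\<integral>\<^sup>+z. H2 z * indicator (A n) z \<partial>lborel) < ennreal (\<kappa> / 2)"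
    using \<open>\<kappa> > 0\<close> by (intro order_tendstoD) auto
  then obtain m where m: "(\<integral>\<^sup>+z. H2 z * indicator (A m) z \<partial>lborel) < ennreal (\<kappa> / 2)"
    by (auto simp: eventually_sequentially)
  show ?thesis
  proof (rule that[OF \<delta>(1)[of m] \<delta>(2)[of m]])
    fix \<zeta> :: complex
    have ptw: "(H z + ?k (z - \<zeta>)) * indicator (A m) z \<le> H2 z * indicator (A m) z + ?k (- \<zeta> + z) * indicator (ball 0 t) (- \<zeta> + z)" for z
    proof (cases "norm (z - \<zeta>) < t")
      case True
      then have "ennreal (norm (z - \<zeta>) powr - \<gamma>) * indicator (A m) z \<le> ?k (- \<zeta> + z) * indicator (ball 0 t) (- \<zeta> + z)"
        by (auto simp: indicator_def)
      moreover have "H z * indicator (A m) z \<le> H2 z * indicator (A m) z"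
        by (intro mult_right_mono) (auto simp: H2_def)
      ultimately show ?thesis unfolding distrib_right by (rule add_mono[rotated])
    next
      case False
      then have "norm (z - \<zeta>) powr - \<gamma> \<le> t powr - \<gamma>"
        using t \<gamma> by (intro powr_mono2') auto
      then have "(H z + ?k (z - \<zeta>)) * indicator (A m) z \<le> H2 z * indicator (A m) z"
        by (intro mult_right_mono) (auto simp: H2_def intro!: add_mono ennreal_leI)
      then show ?thesis by (simp add: add_increasing2)
    qed
    have "(\<integral>\<^sup>+z. (H z + ?k (z - \<zeta>)) * indicator (A m) z \<partial>lborel)
        \<le> (\<integral>\<^sup>+z. H2 z * indicator (A m) z + ?k (- \<zeta> + z) * indicator (ball 0 t) (- \<zeta> + z) \<partial>lborel)"
      by (intro nn_integral_mono ptw)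
    also have "\<dots> = (\<integral>\<^sup>+z. H2 z * indicator (A m) z \<partial>lborel) + (\<integral>\<^sup>+z. ?k (- \<zeta> + z) * indicator (ball 0 t) (- \<zeta> + z) \<partial>lborel)"
      by (rule nn_integral_add) measurable
    also have "(\<integral>\<^sup>+z. ?k (- \<zeta> + z) * indicator (ball 0 t) (- \<zeta> + z) \<partial>lborel) = (\<integral>\<^sup>+z. ?k z * indicator (ball 0 t) z \<partial>lborel)"
      by (rule nn_integral_lborel_translate[of "\<lambda>z. ?k z * indicator (ball 0 t) z"]) measurable
    also have "(\<integral>\<^sup>+z. H2 z * indicator (A m) z \<partial>lborel) + \<dots> \<le> ennreal (\<kappa> / 2) + ennreal (\<kappa> / 2)"
      using m n unfolding t_def by (intro add_mono) auto
    also have "\<dots> = ennreal \<kappa>" using \<open>\<kappa> > 0\<close> by (simp flip: ennreal_plus)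
    finally show "(\<integral>\<^sup>+z\<in>{z. S < norm z \<and> norm z < S + \<delta> m}. (H z + ?k (z - \<zeta>)) \<partial>lborel) \<le> ennreal \<kappa>"
      unfolding A_def .
  qed
qed

text \<open>Young's inequality for the factors \<open>V x\<^sup>a\<^sup>/\<^sup>p\<close> and \<open>x\<^sup>-\<^sup>a\<^sup>/\<^sup>p / y\<close> with exponents \<open>p\<close> and \<open>p / (p - 1)\<close>;
the second one is a product of negative powers of \<open>x\<close> and \<open>y\<close>, which is at most the same total power of
\<open>min x y\<close>.\<close>

lemma young_kernel_bound:
  fixes V x y a p :: real
  assumes p: "p > 1" and a: "a \<ge> 0" and V: "V \<ge> 0" and x: "x > 0" and y: "y \<ge> 0"
  shows "V / y \<le> V powr p * x powr a + (x powr - ((a + p) / (p - 1)) + y powr - ((a + p) / (p - 1)))"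
proof (cases "y = 0")
  case False
  then have y: "y > 0" using y by simp
  let ?\<gamma> = "(a + p) / (p - 1)" and ?q = "p / (p - 1)"
  define A where "A = V * x powr (a / p)"
  define B where "B = x powr - (a / p) * y powr - 1"
  have q: "?q > 1" "1 / p + 1 / ?q = 1" using p by (auto simp: field_simps)
  have AB: "A \<ge> 0" "B \<ge> 0" using V y by (auto simp: A_def B_def)
  have "V / y = A * B"
    using x y by (simp add: A_def B_def powr_minus divide_inverse)
  also have "\<dots> \<le> A powr p / p + B powr ?q / ?q"
    using Youngs_inequality[OF p q AB] .
  also have "\<dots> \<le> A powr p + B powr ?q"
  proof -
    have "A powr p / p \<le> A powr p / 1" using p by (intro divide_left_mono) auto
    moreover have "B powr ?q / ?q \<le> B powr ?q / 1" using q by (intro divide_left_mono) auto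
    ultimately show ?thesis by simp
  qed
  also have "A powr p = V powr p * x powr a"
    using p V by (simp add: A_def powr_mult powr_powr)
  also have "B powr ?q = x powr - (a / (p - 1)) * y powr - ?q"
  proof -
    have "B powr ?q = (x powr - (a / p)) powr ?q * (y powr - 1) powr ?q"
      unfolding B_def by (rule powr_mult)
    then show ?thesis unfolding powr_powr using p by simp
  qed
  also have "\<dots> \<le> x powr - ?\<gamma> + y powr - ?\<gamma>"
  proof -
    define m where "m = min x y"
    have m: "m > 0" "m \<le> x" "m \<le> y" using x y by (auto simp: m_def)
    have "x powr - (a / (p - 1)) * y powr - ?q \<le> m powr - (a / (p - 1)) * m powr - ?q"
      using m p a by (intro mult_mono powr_mono2') auto
    also have "\<dots> = m powr - ?\<gamma>"
      by (simp add: powr_add[symmetric] add_divide_distrib)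
    also have "\<dots> \<le> x powr - ?\<gamma> + y powr - ?\<gamma>"
      by (auto simp: m_def min_def)
    finally show ?thesis .
  qed
  finally show ?thesis by simp
qed (use V in simp)

section \<open>Unique continuation in the disc\<close>

lemma ennreal_le_plus: "a \<le> b + c \<Longrightarrow> 0 \<le> b \<Longrightarrow> 0 \<le> c \<Longrightarrow> ennreal a \<le> ennreal b + ennreal c"
  by (simp add: ennreal_leI flip: ennreal_plus)

text \<open>The potential \<open>w\<close> of the Carleman inequality is unbounded, and \<open>L\<^sup>1\<close> convergence of the
approximations is of use only against its truncations.\<close>

lemma nn_integral_min_le_imp_le:
  fixes w h :: "'a \<Rightarrow> ennreal"
  assumes [measurable]: "w \<in> borel_measurable M" "h \<in> borel_measurable M"
    and h: "\<And>x. h x < \<infinity>"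
    and le: "\<And>N::nat. c * (\<integral>\<^sup>+x. min (w x) (of_nat N) * h x \<partial>M) \<le> B"
  shows "c * (\<integral>\<^sup>+x. w x * h x \<partial>M) \<le> B"
proof -
  have sup: "(SUP N. min (w x) (of_nat N) * h x) = w x * h x" for x
  proof -
    have "(SUP N::nat. min (w x) (of_nat N)) = inf (w x) (SUP N::nat. of_nat N)"
      by (simp only: inf_min[symmetric] inf_SUP)
    also have "\<dots> = w x" by (simp add: ennreal_SUP_of_nat_eq_top)
    finally show ?thesis by (simp add: SUP_mult_right_ennreal[symmetric])
  qed
  have "(\<integral>\<^sup>+x. w x * h x \<partial>M) = (\<integral>\<^sup>+x. (SUP N. min (w x) (of_nat N) * h x) \<partial>M)"
    by (simp add: sup)
  also have "\<dots> = (SUP N. \<integral>\<^sup>+x. min (w x) (of_nat N) * h x \<partial>M)"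
  proof (rule nn_integral_monotone_convergence_SUP)
    show "incseq (\<lambda>N x. min (w x) (of_nat N) * h x)"
      by (auto simp: incseq_def le_fun_def intro!: mult_right_mono min.mono)
  qed measurable
  finally have "c * (\<integral>\<^sup>+x. w x * h x \<partial>M) = (SUP N. c * (\<integral>\<^sup>+x. min (w x) (of_nat N) * h x \<partial>M))"
    by (simp add: SUP_mult_left_ennreal)
  also have "\<dots> \<le> B" by (intro SUP_least le)
  finally show ?thesis .
qed

text \<open>The weighted inequality for \<open>L\<^sup>1\<close> limits \<open>f\<close>, \<open>g\<close> of \<open>C\<^sup>1\<close> functions and their \<open>dbar\<close>, where \<open>\<psi>\<close>
is a cutoff, possibly multiplied by a power of \<open>1 / z\<close>.  The convergence is assumed with a weight \<open>|z|\<^sup>\<alpha>\<close>, as it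
comes out of slicing; the weight is harmless because \<open>\<psi>\<close> vanishes near \<open>0\<close>.\<close>

lemma carleman_inequality_limit:
  fixes f g :: "complex \<Rightarrow> complex" and w :: "complex \<Rightarrow> ennreal"
  assumes F: "\<And>i. C1 (F i) (F' i)"
    and [measurable]: "f \<in> borel_measurable borel" "g \<in> borel_measurable borel" "w \<in> borel_measurable borel"
    and conv: "(\<lambda>i. \<integral>\<^sup>+z\<in>ball 0 1. ennreal (norm z powr \<alpha> * (cmod (F i z - f z) + cmod (dbar (F' i z) - g z))) \<partial>lborel)
        \<longlonglongrightarrow> 0"
    and \<alpha>: "\<alpha> \<ge> 0"
    and \<psi>: "C1 \<psi> \<psi>'" and \<epsilon>: "0 < \<epsilon>" "\<And>z. norm z < \<epsilon> \<Longrightarrow> \<psi> z = 0"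
    and r: "r < 1" "\<And>z. z \<notin> cball 0 r \<Longrightarrow> \<psi> z = 0"
    and kato: "\<And>\<zeta>. (\<integral>\<^sup>+z. w z * ennreal (1 / cmod (\<zeta> - z)) \<partial>lborel) \<le> ennreal \<kappa>"
  shows "ennreal pompeiu_const * (\<integral>\<^sup>+z. w z * cmod (\<psi> z * f z) \<partial>lborel)
      \<le> ennreal \<kappa> * (\<integral>\<^sup>+z. cmod (\<psi> z * g z + dbar (\<psi>' z) * f z) \<partial>lborel)"
proof -
  note [measurable] = C1_borel_measurable[OF F] C1_borel_measurable[OF \<psi>]
  have [measurable]: "(\<lambda>z. dbar (F' i z)) \<in> borel_measurable borel" "(\<lambda>z. dbar (\<psi>' z)) \<in> borel_measurable borel" for i
    unfolding dbar_def by measurable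
  obtain B where B: "B \<ge> 0" "\<And>x v. norm (\<psi>' x v) \<le> B * norm v" "\<And>x y. norm (\<psi> x - \<psi> y) \<le> B * norm (x - y)"
    using C1_compact_support_bound[OF \<psi> r(2)] by blast
  let ?E = "\<lambda>i z. cmod (F i z - f z) + cmod (dbar (F' i z) - g z)"
  let ?I = "\<lambda>i. \<integral>\<^sup>+z\<in>ball 0 1. ennreal (norm z powr \<alpha> * ?E i z) \<partial>lborel"
  define M where "M = B * \<epsilon> powr - \<alpha>"
  have "M \<ge> 0" using B by (simp add: M_def)
  have d0: "dbar (\<psi>' z) = 0" if "norm z < \<epsilon> \<or> z \<notin> cball 0 r" for z
  proof -
    have "\<psi>' z v = 0" for v
    proof (cases "norm z < \<epsilon>")
      case True
      show ?thesis by (rule C1_zero_on_open[OF \<psi> open_ball[of 0 \<epsilon>]]) (use True \<epsilon>(2) in auto)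
    next
      case False
      then show ?thesis using that C1_vanish_outside[OF \<psi>, of 0 r z v] r(2) by blast
    qed
    then show ?thesis by (simp add: dbar_def)
  qed
  have \<psi>B: "cmod (\<psi> z) \<le> B" for z
  proof (cases "z \<in> cball 0 r")
    case True
    have "cmod (\<psi> z - \<psi> 0) \<le> B * cmod (z - 0)" by (rule B(3))
    also have "\<dots> \<le> B * 1" using True r(1) B(1) by (intro mult_left_mono) auto
    finally show ?thesis using \<epsilon> by simp
  qed (use r(2) B(1) in simp)
  have dB: "cmod (dbar (\<psi>' z)) \<le> B" for z
  proof -
    have "cmod (\<psi>' z 1 + \<i> * \<psi>' z \<i>) \<le> cmod (\<psi>' z 1) + cmod (\<i> * \<psi>' z \<i>)" by (rule norm_triangle_ineq)
    also have "\<dots> \<le> B + B" using B(2)[of z 1] B(2)[of z \<i>] by (intro add_mono) (auto simp: norm_mult)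
    finally show ?thesis by (simp add: dbar_def norm_divide)
  qed
  have wt: "B * e \<le> M * (norm z powr \<alpha> * e)" if "norm z \<ge> \<epsilon>" "e \<ge> 0" for z e
  proof -
    have "1 = \<epsilon> powr - \<alpha> * \<epsilon> powr \<alpha>" using \<epsilon>(1) by (simp add: powr_minus)
    also have "\<dots> \<le> \<epsilon> powr - \<alpha> * norm z powr \<alpha>" using that(1) \<epsilon>(1) \<alpha> by (intro mult_left_mono powr_mono2) auto
    finally have "B * e * 1 \<le> B * e * (\<epsilon> powr - \<alpha> * norm z powr \<alpha>)"
      using B(1) that(2) by (intro mult_left_mono) auto
    then show ?thesis by (simp add: M_def mult_ac)
  qed
  have err1: "cmod (\<psi> z * F i z - \<psi> z * f z) \<le> M * (norm z powr \<alpha> * ?E i z) * indicator (ball 0 1) z" for i z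
  proof (cases "norm z < \<epsilon> \<or> z \<notin> cball 0 r")
    case True
    then have "\<psi> z = 0" using \<epsilon>(2) r(2) by blast
    then show ?thesis using \<open>M \<ge> 0\<close> by simp
  next
    case False
    have "cmod (\<psi> z * F i z - \<psi> z * f z) = cmod (\<psi> z) * cmod (F i z - f z)"
      by (simp add: norm_mult flip: right_diff_distrib)
    also have "\<dots> \<le> B * ?E i z" using \<psi>B by (intro mult_mono) (auto simp: B)
    also have "\<dots> \<le> M * (norm z powr \<alpha> * ?E i z)" using False by (intro wt) auto
    finally show ?thesis using False r(1) by simp
  qed
  have err2: "cmod ((\<psi> z * dbar (F' i z) + dbar (\<psi>' z) * F i z) - (\<psi> z * g z + dbar (\<psi>' z) * f z))
      \<le> M * (norm z powr \<alpha> * ?E i z) * indicator (ball 0 1) z" for i z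
  proof (cases "norm z < \<epsilon> \<or> z \<notin> cball 0 r")
    case True
    then have "\<psi> z = 0" "dbar (\<psi>' z) = 0" using \<epsilon>(2) r(2) d0 by blast+
    then show ?thesis using \<open>M \<ge> 0\<close> by simp
  next
    case False
    have "(\<psi> z * dbar (F' i z) + dbar (\<psi>' z) * F i z) - (\<psi> z * g z + dbar (\<psi>' z) * f z)
        = dbar (\<psi>' z) * (F i z - f z) + \<psi> z * (dbar (F' i z) - g z)" by (simp add: algebra_simps)
    also have "cmod \<dots> \<le> cmod (dbar (\<psi>' z) * (F i z - f z)) + cmod (\<psi> z * (dbar (F' i z) - g z))"
      by (rule norm_triangle_ineq)
    also have "\<dots> \<le> B * cmod (F i z - f z) + B * cmod (dbar (F' i z) - g z)"
      unfolding norm_mult using \<psi>B dB by (intro add_mono mult_right_mono) auto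
    also have "\<dots> = B * ?E i z" by (simp add: distrib_left)
    also have "\<dots> \<le> M * (norm z powr \<alpha> * ?E i z)" using False by (intro wt) auto
    finally show ?thesis using False r(1) by simp
  qed
  have E_int: "(\<integral>\<^sup>+z. ennreal (M * (norm z powr \<alpha> * ?E i z) * indicator (ball 0 1) z) \<partial>lborel) = ennreal M * ?I i" for i
  proof -
    have "(\<integral>\<^sup>+z. ennreal (M * (norm z powr \<alpha> * ?E i z) * indicator (ball 0 1) z) \<partial>lborel)
        = (\<integral>\<^sup>+z. ennreal M * (ennreal (norm z powr \<alpha> * ?E i z) * indicator (ball 0 1) z) \<partial>lborel)"
      using \<open>M \<ge> 0\<close> by (intro nn_integral_cong) (auto simp: indicator_def ennreal_mult)
    also have "\<dots> = ennreal M * ?I i" by (rule nn_integral_cmult) measurable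
    finally show ?thesis .
  qed
  let ?R = "\<integral>\<^sup>+z. cmod (\<psi> z * g z + dbar (\<psi>' z) * f z) \<partial>lborel"
  have dbarF: "dbar (\<lambda>v. \<psi> z * F' i z v + \<psi>' z v * F i z) = \<psi> z * dbar (F' i z) + dbar (\<psi>' z) * F i z" for i z
    by (rule dbar_mult)
  have rhs: "(\<integral>\<^sup>+z. cmod (dbar (\<lambda>v. \<psi> z * F' i z v + \<psi>' z v * F i z)) \<partial>lborel) \<le> ?R + ennreal M * ?I i" for i
  proof -
    have "(\<integral>\<^sup>+z. cmod (dbar (\<lambda>v. \<psi> z * F' i z v + \<psi>' z v * F i z)) \<partial>lborel)
        \<le> (\<integral>\<^sup>+z. ennreal (cmod (\<psi> z * g z + dbar (\<psi>' z) * f z)) + ennreal (M * (norm z powr \<alpha> * ?E i z) * indicator (ball 0 1) z) \<partial>lborel)"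
    proof (intro nn_integral_mono)
      fix z
      have "cmod (\<psi> z * dbar (F' i z) + dbar (\<psi>' z) * F i z)
          \<le> cmod (\<psi> z * g z + dbar (\<psi>' z) * f z) + M * (norm z powr \<alpha> * ?E i z) * indicator (ball 0 1) z"
        using err2[of z i] norm_triangle_sub[of "\<psi> z * dbar (F' i z) + dbar (\<psi>' z) * F i z" "\<psi> z * g z + dbar (\<psi>' z) * f z"]
        by linarith
      then show "ennreal (cmod (dbar (\<lambda>v. \<psi> z * F' i z v + \<psi>' z v * F i z)))
          \<le> ennreal (cmod (\<psi> z * g z + dbar (\<psi>' z) * f z)) + ennreal (M * (norm z powr \<alpha> * ?E i z) * indicator (ball 0 1) z)"
        unfolding dbarF using \<open>M \<ge> 0\<close> by (intro ennreal_le_plus) auto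
    qed
    also have "\<dots> = ?R + (\<integral>\<^sup>+z. ennreal (M * (norm z powr \<alpha> * ?E i z) * indicator (ball 0 1) z) \<partial>lborel)"
      by (rule nn_integral_add) measurable
    finally show ?thesis unfolding E_int .
  qed
  have trunc: "ennreal pompeiu_const * (\<integral>\<^sup>+z. min (w z) (of_nat N) * ennreal (cmod (\<psi> z * f z)) \<partial>lborel) \<le> ennreal \<kappa> * ?R" for N :: nat
  proof -
    let ?w = "\<lambda>z. min (w z) (of_nat N :: ennreal)"
    have lhs: "(\<integral>\<^sup>+z. ?w z * ennreal (cmod (\<psi> z * f z)) \<partial>lborel)
        \<le> (\<integral>\<^sup>+z. ?w z * ennreal (cmod (\<psi> z * F i z)) \<partial>lborel) + of_nat N * (ennreal M * ?I i)" for i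
    proof -
      have "(\<integral>\<^sup>+z. ?w z * ennreal (cmod (\<psi> z * f z)) \<partial>lborel)
          \<le> (\<integral>\<^sup>+z. ?w z * ennreal (cmod (\<psi> z * F i z)) + of_nat N * ennreal (M * (norm z powr \<alpha> * ?E i z) * indicator (ball 0 1) z) \<partial>lborel)"
      proof (intro nn_integral_mono)
        fix z
        have "cmod (\<psi> z * f z) \<le> cmod (\<psi> z * F i z) + M * (norm z powr \<alpha> * ?E i z) * indicator (ball 0 1) z"
          using err1[of z i] norm_triangle_sub[of "\<psi> z * f z" "\<psi> z * F i z"] by (simp add: norm_minus_commute)
        then have "ennreal (cmod (\<psi> z * f z)) \<le> ennreal (cmod (\<psi> z * F i z)) + ennreal (M * (norm z powr \<alpha> * ?E i z) * indicator (ball 0 1) z)"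
          using \<open>M \<ge> 0\<close> by (intro ennreal_le_plus) auto
        then have "?w z * ennreal (cmod (\<psi> z * f z)) \<le> ?w z * (ennreal (cmod (\<psi> z * F i z)) + ennreal (M * (norm z powr \<alpha> * ?E i z) * indicator (ball 0 1) z))"
          by (rule mult_left_mono) simp
        also have "\<dots> \<le> ?w z * ennreal (cmod (\<psi> z * F i z)) + of_nat N * ennreal (M * (norm z powr \<alpha> * ?E i z) * indicator (ball 0 1) z)"
          unfolding distrib_left by (intro add_left_mono mult_right_mono) auto
        finally show "?w z * ennreal (cmod (\<psi> z * f z)) \<le> ?w z * ennreal (cmod (\<psi> z * F i z)) + of_nat N * ennreal (M * (norm z powr \<alpha> * ?E i z) * indicator (ball 0 1) z)" .
      qed
      also have "\<dots> = (\<integral>\<^sup>+z. ?w z * ennreal (cmod (\<psi> z * F i z)) \<partial>lborel)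
          + (\<integral>\<^sup>+z. of_nat N * ennreal (M * (norm z powr \<alpha> * ?E i z) * indicator (ball 0 1) z) \<partial>lborel)"
        by (rule nn_integral_add) measurable
      also have "(\<integral>\<^sup>+z. of_nat N * ennreal (M * (norm z powr \<alpha> * ?E i z) * indicator (ball 0 1) z) \<partial>lborel)
          = of_nat N * (\<integral>\<^sup>+z. ennreal (M * (norm z powr \<alpha> * ?E i z) * indicator (ball 0 1) z) \<partial>lborel)"
        by (rule nn_integral_cmult) measurable
      finally show ?thesis unfolding E_int .
    qed
    have car: "ennreal pompeiu_const * (\<integral>\<^sup>+z. ?w z * ennreal (cmod (\<psi> z * F i z)) \<partial>lborel)
        \<le> ennreal \<kappa> * (?R + ennreal M * ?I i)" for i
    proof -
      have "ennreal pompeiu_const * (\<integral>\<^sup>+z. ?w z * ennreal (cmod (\<psi> z * F i z)) \<partial>lborel)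
          \<le> ennreal \<kappa> * (\<integral>\<^sup>+z. cmod (dbar (\<lambda>v. \<psi> z * F' i z v + \<psi>' z v * F i z)) \<partial>lborel)"
      proof (rule carleman_inequality[OF C1_mult[OF \<psi> F]])
        show "\<psi> x * F i x = 0" if "x \<notin> cball 0 r" for x using r(2)[OF that] by simp
        fix \<zeta>
        have "(\<integral>\<^sup>+z. ?w z * ennreal (1 / cmod (\<zeta> - z)) \<partial>lborel) \<le> (\<integral>\<^sup>+z. w z * ennreal (1 / cmod (\<zeta> - z)) \<partial>lborel)"
          by (intro nn_integral_mono mult_right_mono) auto
        also have "\<dots> \<le> ennreal \<kappa>" by (rule kato)
        finally show "(\<integral>\<^sup>+z. ?w z * ennreal (1 / cmod (\<zeta> - z)) \<partial>lborel) \<le> ennreal \<kappa>" .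
      qed measurable
      also have "\<dots> \<le> ennreal \<kappa> * (?R + ennreal M * ?I i)"
        by (intro mult_left_mono rhs) auto
      finally show ?thesis .
    qed
    have bound: "ennreal pompeiu_const * (\<integral>\<^sup>+z. ?w z * ennreal (cmod (\<psi> z * f z)) \<partial>lborel)
        \<le> ennreal \<kappa> * (?R + ennreal M * ?I i) + ennreal pompeiu_const * (of_nat N * (ennreal M * ?I i))" for i
    proof -
      have "ennreal pompeiu_const * (\<integral>\<^sup>+z. ?w z * ennreal (cmod (\<psi> z * f z)) \<partial>lborel)
        \<le> ennreal pompeiu_const * ((\<integral>\<^sup>+z. ?w z * ennreal (cmod (\<psi> z * F i z)) \<partial>lborel) + of_nat N * (ennreal M * ?I i))"
        by (intro mult_left_mono lhs) auto
      also have "\<dots> \<le> ennreal \<kappa> * (?R + ennreal M * ?I i) + ennreal pompeiu_const * (of_nat N * (ennreal M * ?I i))"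
        unfolding distrib_left[of "ennreal pompeiu_const"] by (intro add_right_mono car)
      finally show ?thesis .
    qed
    have MI: "(\<lambda>i. c * (ennreal M * ?I i)) \<longlonglongrightarrow> 0" if "c < \<infinity>" for c
    proof -
      have "(\<lambda>i. (c * ennreal M) * ?I i) \<longlonglongrightarrow> (c * ennreal M) * 0"
        using that by (intro ennreal_tendsto_cmult conv) (simp add: ennreal_mult_less_top)
      then show ?thesis by (simp add: mult.assoc)
    qed
    have "(\<lambda>i. ennreal \<kappa> * ?R + ennreal \<kappa> * (ennreal M * ?I i) + (ennreal pompeiu_const * of_nat N) * (ennreal M * ?I i))
        \<longlonglongrightarrow> ennreal \<kappa> * ?R + 0 + 0"
      by (intro tendsto_add tendsto_const MI) (auto simp: ennreal_mult_less_top of_nat_less_top)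
    then have lim: "(\<lambda>i. ennreal \<kappa> * (?R + ennreal M * ?I i) + ennreal pompeiu_const * (of_nat N * (ennreal M * ?I i)))
        \<longlonglongrightarrow> ennreal \<kappa> * ?R"
      by (simp add: distrib_left mult.assoc)
    show ?thesis by (rule LIMSEQ_le_const[OF lim]) (use bound in blast)
  qed
  have m: "w \<in> borel_measurable lborel" "(\<lambda>z. ennreal (cmod (\<psi> z * f z))) \<in> borel_measurable lborel"
    by measurable
  show ?thesis
    by (rule nn_integral_min_le_imp_le[OF m _ trunc]) simp
qed

lemma AE_norm_neq:
  fixes S :: real
  shows "AE z::complex in lborel. norm z \<noteq> S"
proof -
  have "sphere (0::complex) S \<in> null_sets lborel"
  proof -
    have "sphere (0::complex) S \<in> null_sets lebesgue"
      using negligible_sphere[of "0::complex" S] by (simp add: negligible_iff_null_sets)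
    then show ?thesis by (subst (asm) null_sets_completion_iff) auto
  qed
  then have "AE z::complex in lborel. z \<notin> sphere 0 S" by (rule AE_not_in)
  then show ?thesis by simp
qed

text \<open>Absorption of \<open>X\<close> into the left side; it is here that finiteness of \<open>X\<close> has to be known beforehand.\<close>

lemma ennreal_absorb:
  fixes X Y :: ennreal
  assumes "c > 0" "X < \<infinity>" and le: "ennreal c * X \<le> ennreal (c / 2) * (X + Y)"
  shows "X \<le> Y"
proof (cases Y)
  case (real y)
  obtain x where x: "X = ennreal x" "x \<ge> 0" using \<open>X < \<infinity>\<close> by (cases X) auto
  have "ennreal (c * x) \<le> ennreal (c / 2 * (x + y))"
  proof -
    have "ennreal (c * x) = ennreal c * X" using x \<open>c > 0\<close> by (simp add: ennreal_mult)
    also note le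
    also have "ennreal (c / 2) * (X + Y) = ennreal (c / 2 * (x + y))"
      unfolding x real using x real \<open>c > 0\<close> by (subst ennreal_mult) (simp_all add: ennreal_plus)
    finally show ?thesis .
  qed
  then have "c * x \<le> c / 2 * (x + y)"
    using real x \<open>c > 0\<close> by (subst (asm) ennreal_le_iff) auto
  then have "c * (2 * x) \<le> c * (x + y)" by (simp add: field_simps)
  then have "2 * x \<le> x + y" using \<open>c > 0\<close> by (subst (asm) mult_le_cancel_left_pos)
  then show ?thesis using real x by (simp add: ennreal_leI)
qed simp

text \<open>Equal to \<open>1\<close> for \<open>2 \<epsilon> \<le> |z| \<le> b1\<close> and to \<open>0\<close> for \<open>|z| \<le> \<epsilon>\<close> and \<open>|z| \<ge> b2\<close>.  The arguments of \<open>step\<close>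
are written in the form required by \<open>C1_radial_step\<close>.\<close>

definition ring_cutoff :: "real \<Rightarrow> real \<Rightarrow> real \<Rightarrow> complex \<Rightarrow> real" where
  "ring_cutoff \<epsilon> b1 b2 z = step (1 / \<epsilon>\<^sup>2 * (z \<bullet> z) + - 1)
     * step (- (1 / (b2\<^sup>2 - b1\<^sup>2)) * (z \<bullet> z) + b2\<^sup>2 / (b2\<^sup>2 - b1\<^sup>2))"

definition ring_cutoff' :: "real \<Rightarrow> real \<Rightarrow> real \<Rightarrow> complex \<Rightarrow> complex \<Rightarrow> real" where
  "ring_cutoff' \<epsilon> b1 b2 z v =
     step (1 / \<epsilon>\<^sup>2 * (z \<bullet> z) + - 1)
       * (step' (- (1 / (b2\<^sup>2 - b1\<^sup>2)) * (z \<bullet> z) + b2\<^sup>2 / (b2\<^sup>2 - b1\<^sup>2)) * (2 * - (1 / (b2\<^sup>2 - b1\<^sup>2)) * (z \<bullet> v)))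
     + step' (1 / \<epsilon>\<^sup>2 * (z \<bullet> z) + - 1) * (2 * (1 / \<epsilon>\<^sup>2) * (z \<bullet> v))
       * step (- (1 / (b2\<^sup>2 - b1\<^sup>2)) * (z \<bullet> z) + b2\<^sup>2 / (b2\<^sup>2 - b1\<^sup>2))"

lemma C1_ring_cutoff: "C1 (ring_cutoff \<epsilon> b1 b2) (ring_cutoff' \<epsilon> b1 b2)"
  unfolding ring_cutoff_def[abs_def] ring_cutoff'_def[abs_def]
  by (rule C1_mult[OF C1_radial_step C1_radial_step])

lemma ring_cutoff_bounds: "0 \<le> ring_cutoff \<epsilon> b1 b2 z" "ring_cutoff \<epsilon> b1 b2 z \<le> 1"
  unfolding ring_cutoff_def by (auto intro!: mult_nonneg_nonneg mult_le_one step_bounds)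

context
  fixes \<epsilon> b1 b2 :: real
  assumes \<epsilon>: "0 < \<epsilon>" and b: "0 < b1" "b1 < b2" "b2 < 1"
begin

lemma ring_cutoff_diff_pos: "b2\<^sup>2 - b1\<^sup>2 > 0"
  using b by (simp add: power_strict_mono)

lemma ring_cutoff_inner: "norm z \<le> \<epsilon> \<Longrightarrow> ring_cutoff \<epsilon> b1 b2 z = 0"
proof -
  assume "norm z \<le> \<epsilon>"
  then have "z \<bullet> z \<le> \<epsilon>\<^sup>2" using power_mono[of "norm z" \<epsilon> 2] by (simp add: power2_norm_eq_inner)
  then have "1 / \<epsilon>\<^sup>2 * (z \<bullet> z) + - 1 \<le> 0" using \<epsilon> by (simp add: divide_le_eq)
  then show ?thesis unfolding ring_cutoff_def by (simp only: step_eq_0 mult_zero_left)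
qed

lemma ring_cutoff_outer: "b2 \<le> norm z \<Longrightarrow> ring_cutoff \<epsilon> b1 b2 z = 0"
proof -
  assume "b2 \<le> norm z"
  then have "b2\<^sup>2 \<le> z \<bullet> z" using b power_mono[of b2 "norm z" 2] by (simp add: power2_norm_eq_inner)
  then have "- (1 / (b2\<^sup>2 - b1\<^sup>2)) * (z \<bullet> z) + b2\<^sup>2 / (b2\<^sup>2 - b1\<^sup>2) \<le> 0"
    using ring_cutoff_diff_pos by (simp add: divide_right_mono)
  then show ?thesis unfolding ring_cutoff_def by (simp only: step_eq_0 mult_zero_right)
qed

lemma ring_cutoff_eq_1: "2 * \<epsilon> \<le> norm z \<Longrightarrow> norm z \<le> b1 \<Longrightarrow> ring_cutoff \<epsilon> b1 b2 z = 1"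
proof -
  assume z: "2 * \<epsilon> \<le> norm z" "norm z \<le> b1"
  have "(2 * \<epsilon>)\<^sup>2 \<le> z \<bullet> z" using z \<epsilon> power_mono[of "2 * \<epsilon>" "norm z" 2] by (simp add: power2_norm_eq_inner)
  then have "2 * \<epsilon>\<^sup>2 \<le> z \<bullet> z" by (simp add: power_mult_distrib) (smt (verit) zero_le_power2)
  then have 1: "1 \<le> 1 / \<epsilon>\<^sup>2 * (z \<bullet> z) + - 1" using \<epsilon> by (simp add: le_divide_eq)
  have "z \<bullet> z \<le> b1\<^sup>2" using z b power_mono[of "norm z" b1 2] by (simp add: power2_norm_eq_inner)
  then have "1 \<le> (b2\<^sup>2 - z \<bullet> z) / (b2\<^sup>2 - b1\<^sup>2)" using ring_cutoff_diff_pos by (simp add: le_divide_eq)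
  then have 2: "1 \<le> - (1 / (b2\<^sup>2 - b1\<^sup>2)) * (z \<bullet> z) + b2\<^sup>2 / (b2\<^sup>2 - b1\<^sup>2)"
    by (simp add: diff_divide_distrib)
  show ?thesis unfolding ring_cutoff_def step_eq_1[OF 1] step_eq_1[OF 2] by simp
qed

text \<open>On the inner transition, where \<open>\<epsilon> \<le> |z| < 2 \<epsilon>\<close>, the derivative is of size \<open>1 / \<epsilon>\<close>.  Writing this as
\<open>1 / |z|\<close> gives a bound in which \<open>\<epsilon>\<close> enters through the domain only, so that infinite order of
vanishing, used once with exponent \<open>m + 1\<close>, disposes of this part.\<close>

lemma ring_cutoff_dbar_bound:
  "cmod ((of_real (ring_cutoff' \<epsilon> b1 b2 z 1) + \<i> * of_real (ring_cutoff' \<epsilon> b1 b2 z \<i>)) / 2)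
    \<le> 4 / (b2\<^sup>2 - b1\<^sup>2) * indicator {z. b1 \<le> norm z \<and> norm z \<le> b2} z
      + 16 * inverse (norm z) * indicator (ball 0 (2 * \<epsilon>)) z"
proof -
  let ?d = "b2\<^sup>2 - b1\<^sup>2"
  let ?i = "1 / \<epsilon>\<^sup>2 * (z \<bullet> z) + - 1" and ?o = "- (1 / ?d) * (z \<bullet> z) + b2\<^sup>2 / ?d"
  define c where "c = step ?i * (step' ?o * (2 * - (1 / ?d))) + step' ?i * (2 * (1 / \<epsilon>\<^sup>2)) * step ?o"
  have "ring_cutoff' \<epsilon> b1 b2 z v = c * (z \<bullet> v)" for v
    unfolding ring_cutoff'_def c_def by (simp only: algebra_simps)
  then have "(of_real (ring_cutoff' \<epsilon> b1 b2 z 1) + \<i> * of_real (ring_cutoff' \<epsilon> b1 b2 z \<i>)) / 2 = of_real (c / 2) * z"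
    using complex_gradient_norm_squared[of c z] by simp
  moreover have "cmod (of_real (c / 2) * z) = \<bar>c / 2\<bar> * norm z"
    by (simp only: norm_mult norm_of_real)
  moreover have "\<bar>c / 2\<bar> * norm z \<le> 4 / ?d * indicator {z. b1 \<le> norm z \<and> norm z \<le> b2} z
      + 16 * inverse (norm z) * indicator (ball 0 (2 * \<epsilon>)) z"
  proof -
    have d: "?d > 0" by (rule ring_cutoff_diff_pos)
    have "c / 2 = - (step ?i * (step' ?o * (1 / ?d))) + step' ?i * (1 / \<epsilon>\<^sup>2) * step ?o"
    proof -
      have "(A * (B * (2 * - D)) + E * (2 * F) * G) / 2 = - (A * (B * D)) + E * F * G"
        for A B D E F G :: real
        by (simp add: field_simps)
      then show ?thesis unfolding c_def .
    qed
    then have "\<bar>c / 2\<bar> \<le> \<bar>step ?i * (step' ?o * (1 / ?d))\<bar> + \<bar>step' ?i * (1 / \<epsilon>\<^sup>2) * step ?o\<bar>"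
      by linarith
    also have "\<bar>step ?i * (step' ?o * (1 / ?d))\<bar> = step ?i * (step' ?o * (1 / ?d))"
      by (intro abs_of_nonneg mult_nonneg_nonneg step_bounds step'_nonneg) (use d in simp)
    also have "\<bar>step' ?i * (1 / \<epsilon>\<^sup>2) * step ?o\<bar> = step' ?i * (1 / \<epsilon>\<^sup>2) * step ?o"
      by (intro abs_of_nonneg mult_nonneg_nonneg step_bounds step'_nonneg) simp
    finally have "\<bar>c / 2\<bar> * norm z \<le> (step ?i * (step' ?o * (1 / ?d)) + step' ?i * (1 / \<epsilon>\<^sup>2) * step ?o) * norm z"
      by (rule mult_right_mono) simp
    also have "\<dots> = step ?i * (step' ?o * (1 / ?d)) * norm z + step' ?i * (1 / \<epsilon>\<^sup>2) * step ?o * norm z"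
      by (rule distrib_right)
    also have "step ?i * (step' ?o * (1 / ?d)) * norm z \<le> 4 / ?d * indicator {z. b1 \<le> norm z \<and> norm z \<le> b2} z"
    proof (cases "b1 \<le> norm z \<and> norm z \<le> b2")
      case True
      have "step ?i * (step' ?o * (1 / ?d)) * norm z \<le> 1 * (4 * (1 / ?d)) * 1"
        using True b d by (intro mult_mono step_bounds step'_le mult_nonneg_nonneg step'_nonneg) auto
      then show ?thesis using True by simp
    next
      case False
      have "step' ?o = 0"
      proof (rule step'_eq_0)
        show "?o \<le> 0 \<or> 1 \<le> ?o"
        proof (cases "b2 \<le> norm z")
          case True
          then have "b2\<^sup>2 \<le> z \<bullet> z" using b power_mono[of b2 "norm z" 2] by (simp add: power2_norm_eq_inner)
          then show ?thesis using d by (simp add: divide_right_mono)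
        next
          case outside: False
          then have "z \<bullet> z \<le> b1\<^sup>2" using False b power_mono[of "norm z" b1 2] by (simp add: power2_norm_eq_inner)
          then have "1 \<le> (b2\<^sup>2 - z \<bullet> z) / ?d" using d by (simp add: le_divide_eq)
          then show ?thesis by (simp add: diff_divide_distrib)
        qed
      qed
      then show ?thesis by (simp only: mult_zero_left mult_zero_right) (use d in simp)
    qed
    also have "step' ?i * (1 / \<epsilon>\<^sup>2) * step ?o * norm z \<le> 16 * inverse (norm z) * indicator (ball 0 (2 * \<epsilon>)) z"
    proof (cases "norm z < 2 * \<epsilon> \<and> z \<noteq> 0")
      case True
      have "step' ?i * (1 / \<epsilon>\<^sup>2) * step ?o * norm z \<le> 4 * (1 / \<epsilon>\<^sup>2) * 1 * norm z"
        by (intro mult_right_mono mult_mono step_bounds step'_le mult_nonneg_nonneg) auto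
      also have "4 * (1 / \<epsilon>\<^sup>2) * 1 * norm z \<le> 16 * inverse (norm z)"
      proof -
        have "(norm z)\<^sup>2 \<le> (2 * \<epsilon>)\<^sup>2" using True by (intro power_mono) auto
        then have "(norm z * norm z) * (4 / \<epsilon>\<^sup>2) \<le> 16"
          using \<epsilon> by (simp add: power2_eq_square divide_le_eq)
        then show ?thesis using True \<epsilon> by (simp add: inverse_eq_divide pos_le_divide_eq mult_ac)
      qed
      finally show ?thesis using True by simp
    next
      case False
      show ?thesis
      proof (cases "z = 0")
        case nz: False
        then have "2 * \<epsilon> \<le> norm z" using False by simp
        then have "(2 * \<epsilon>)\<^sup>2 \<le> z \<bullet> z" using \<epsilon> power_mono[of "2 * \<epsilon>" "norm z" 2] by (simp add: power2_norm_eq_inner)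
        moreover have "2 * \<epsilon>\<^sup>2 \<le> (2 * \<epsilon>)\<^sup>2" by (simp add: power_mult_distrib)
        ultimately have "2 * \<epsilon>\<^sup>2 \<le> z \<bullet> z" by (rule order_trans[rotated])
        then have "1 \<le> ?i" using \<epsilon> by (simp add: le_divide_eq)
        then have "step' ?i = 0" by (intro step'_eq_0) simp
        then show ?thesis by (simp only: mult_zero_left) simp
      qed simp
    qed
    finally show ?thesis by (simp add: add_mono)
  qed
  ultimately show ?thesis by (simp only:)
qed

end

text \<open>The system \<open>|dbar f| \<le> W |f|\<close> in the unit disc, with \<open>f\<close> and \<open>g = dbar f\<close> given as limits of
\<open>C\<^sup>1\<close> functions.  The function \<open>H\<close> is a majorant for the local size of the potential: it absorbs
whatever does not depend on the pole \<open>\<zeta>\<close>.  The potential is \<open>W + 1\<close> instead of \<open>W\<close> so that the left side of the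
Carleman inequality controls \<open>f\<close> together with \<open>g\<close>.\<close>

lemma disc_unique_continuation:
  fixes f g :: "'k::finite \<Rightarrow> complex \<Rightarrow> complex" and W :: "complex \<Rightarrow> real" and H :: "complex \<Rightarrow> ennreal"
  assumes F: "\<And>i k. C1 (F i k) (F' i k)"
    and f[measurable]: "\<And>k. f k \<in> borel_measurable borel" and g[measurable]: "\<And>k. g k \<in> borel_measurable borel"
    and W[measurable]: "W \<in> borel_measurable borel" and H[measurable]: "H \<in> borel_measurable borel"
    and conv: "\<And>k. (\<lambda>i. \<integral>\<^sup>+z\<in>ball 0 1. ennreal (norm z powr \<alpha> * (cmod (F i k z - f k z) + cmod (dbar (F' i k z) - g k z))) \<partial>lborel)
        \<longlonglongrightarrow> 0"
    and \<alpha>: "\<alpha> \<ge> 0"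
    and ineq: "AE z in lborel. z \<in> ball 0 1 \<longrightarrow> (\<Sum>k\<in>UNIV. cmod (g k z)) \<le> W z * (\<Sum>k\<in>UNIV. cmod (f k z))"
    and W0: "\<And>z. W z \<ge> 0"
    and kato: "\<And>z \<zeta>. z \<in> ball 0 1 \<Longrightarrow> z \<noteq> 0 \<Longrightarrow>
        ennreal ((W z + 1) / cmod (\<zeta> - z)) \<le> ennreal C * (H z + ennreal (norm (z - \<zeta>) powr - \<gamma>))"
    and C: "C \<ge> 0" and H_fin: "(\<integral>\<^sup>+z\<in>ball 0 1. H z \<partial>lborel) < \<infinity>" and \<gamma>: "0 \<le> \<gamma>" "\<gamma> < 2"
    and flat: "\<And>m. (\<integral>\<^sup>+z\<in>ball 0 1. ennreal ((\<Sum>k\<in>UNIV. cmod (f k z)) * inverse (norm z) ^ m) \<partial>lborel) < \<infinity>"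
  shows "AE z in lborel. z \<in> ball 0 1 \<longrightarrow> (\<forall>k. f k z = 0)"
proof -
  define a where "a z = (\<Sum>k\<in>UNIV. cmod (f k z))" for z
  define G where "G z = (\<Sum>k\<in>UNIV. cmod (g k z))" for z
  have [measurable]: "a \<in> borel_measurable borel" "G \<in> borel_measurable borel"
    unfolding a_def[abs_def] G_def[abs_def] by measurable
  have a0: "a z \<ge> 0" and G0: "G z \<ge> 0" for z by (auto simp: a_def G_def intro: sum_nonneg)
  note [measurable] = C1_borel_measurable[OF F]
  have [measurable]: "(\<lambda>z. dbar (F' i k z)) \<in> borel_measurable borel" for i k
    unfolding dbar_def by measurable
  \<comment> \<open>Needed to know beforehand that the term to be absorbed is finite.  Away from \<open>0\<close> the weight is bounded
    below, so one approximation with finite error suffices.\<close>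
  have g_fin: "(\<integral>\<^sup>+z\<in>{z. \<rho> \<le> norm z \<and> norm z \<le> b}. ennreal (G z) \<partial>lborel) < \<infinity>" if "0 < \<rho>" "b < 1" for \<rho> b
  proof -
    let ?A = "{z::complex. \<rho> \<le> norm z \<and> norm z \<le> b}"
    have [measurable]: "?A \<in> sets borel" by measurable
    have fin: "(\<integral>\<^sup>+z\<in>?A. ennreal (cmod (g k z)) \<partial>lborel) < \<infinity>" for k
    proof -
      let ?e = "\<lambda>i z. norm z powr \<alpha> * (cmod (F i k z - f k z) + cmod (dbar (F' i k z) - g k z))"
      have "\<forall>\<^sub>F i in sequentially. (\<integral>\<^sup>+z\<in>ball 0 1. ennreal (?e i z) \<partial>lborel) < 1"
        by (rule order_tendstoD(2)[OF conv]) simp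
      then obtain i where i: "(\<integral>\<^sup>+z\<in>ball 0 1. ennreal (?e i z) \<partial>lborel) < 1"
        by (auto simp: eventually_sequentially)
      have "compact ((\<lambda>z. dbar (F' i k z)) ` cball 0 1)"
      proof (rule compact_continuous_image)
        have "continuous_on (cball 0 1) (\<lambda>z. F' i k z v)" for v
          using F[of i k] unfolding C1_def by (auto intro: continuous_on_subset)
        then show "continuous_on (cball 0 1) (\<lambda>z. dbar (F' i k z))"
          unfolding dbar_def by (intro continuous_intros) auto
      qed simp
      then obtain M where M: "\<And>z. z \<in> cball 0 1 \<Longrightarrow> cmod (dbar (F' i k z)) \<le> M"
        by (fastforce dest!: compact_imp_bounded simp: bounded_iff)
      have ptw: "ennreal (cmod (g k z)) * indicator ?A z
          \<le> ennreal M * indicator (ball 0 1) z + ennreal (\<rho> powr - \<alpha>) * (ennreal (?e i z) * indicator (ball 0 1) z)" for z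
      proof (cases "z \<in> ?A")
        case True
        then have z1: "z \<in> ball 0 1" using \<open>b < 1\<close> by auto
        then have Mz: "cmod (dbar (F' i k z)) \<le> M" by (intro M) auto
        have "1 = \<rho> powr - \<alpha> * \<rho> powr \<alpha>" using \<open>0 < \<rho>\<close> by (simp add: powr_minus)
        also have "\<dots> \<le> \<rho> powr - \<alpha> * norm z powr \<alpha>"
          using True \<open>0 < \<rho>\<close> \<alpha> by (intro mult_left_mono powr_mono2) auto
        finally have one: "1 \<le> \<rho> powr - \<alpha> * norm z powr \<alpha>" .
        have "cmod (g k z) \<le> M + 1 * cmod (dbar (F' i k z) - g k z)"
          using norm_triangle_sub[of "g k z" "dbar (F' i k z)"] Mz by (simp add: norm_minus_commute)
        also have "\<dots> \<le> M + (\<rho> powr - \<alpha> * norm z powr \<alpha>) * (cmod (F i k z - f k z) + cmod (dbar (F' i k z) - g k z))"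
          by (intro add_left_mono mult_mono one) auto
        finally have "cmod (g k z) \<le> M + \<rho> powr - \<alpha> * ?e i z" by (simp add: mult.assoc)
        then have "ennreal (cmod (g k z)) \<le> ennreal M + ennreal (\<rho> powr - \<alpha> * ?e i z)"
          using order_trans[OF norm_ge_zero Mz] by (intro ennreal_le_plus) auto
        also have "ennreal (\<rho> powr - \<alpha> * ?e i z) = ennreal (\<rho> powr - \<alpha>) * ennreal (?e i z)"
          by (rule ennreal_mult) auto
        finally show ?thesis using True z1 by simp
      qed simp
      have "(\<integral>\<^sup>+z\<in>?A. ennreal (cmod (g k z)) \<partial>lborel)
          \<le> (\<integral>\<^sup>+z. ennreal M * indicator (ball 0 1) z + ennreal (\<rho> powr - \<alpha>) * (ennreal (?e i z) * indicator (ball 0 1) z) \<partial>lborel)"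
        by (intro nn_integral_mono ptw)
      also have "\<dots> = (\<integral>\<^sup>+z. ennreal M * indicator (ball (0::complex) 1) z \<partial>lborel)
          + (\<integral>\<^sup>+z. ennreal (\<rho> powr - \<alpha>) * (ennreal (?e i z) * indicator (ball 0 1) z) \<partial>lborel)"
        by (rule nn_integral_add) measurable
      also have "(\<integral>\<^sup>+z. ennreal M * indicator (ball (0::complex) 1) z \<partial>lborel) = ennreal M * emeasure lborel (ball (0::complex) 1)"
        by (rule nn_integral_cmult_indicator) simp
      also have "(\<integral>\<^sup>+z. ennreal (\<rho> powr - \<alpha>) * (ennreal (?e i z) * indicator (ball 0 1) z) \<partial>lborel)
          = ennreal (\<rho> powr - \<alpha>) * (\<integral>\<^sup>+z\<in>ball 0 1. ennreal (?e i z) \<partial>lborel)"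
        by (rule nn_integral_cmult) measurable
      also have "ennreal M * emeasure lborel (ball (0::complex) 1) + ennreal (\<rho> powr - \<alpha>) * (\<integral>\<^sup>+z\<in>ball 0 1. ennreal (?e i z) \<partial>lborel) < \<infinity>"
        using emeasure_lborel_ball_finite[of "0::complex" 1] less_trans[OF i ennreal_one_less_top]
        by (simp add: ennreal_mult_less_top)
      finally show ?thesis .
    qed
    have "(\<integral>\<^sup>+z\<in>?A. ennreal (G z) \<partial>lborel) = (\<integral>\<^sup>+z. (\<Sum>k\<in>UNIV. ennreal (cmod (g k z)) * indicator ?A z) \<partial>lborel)"
    proof (intro nn_integral_cong)
      fix z
      have "ennreal (G z) = (\<Sum>k\<in>UNIV. ennreal (cmod (g k z)))"
        unfolding G_def by (rule sum_ennreal[symmetric]) simp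
      then show "ennreal (G z) * indicator ?A z = (\<Sum>k\<in>UNIV. ennreal (cmod (g k z)) * indicator ?A z)"
        by (simp only: sum_distrib_right)
    qed
    also have "\<dots> = (\<Sum>k\<in>UNIV. \<integral>\<^sup>+z\<in>?A. ennreal (cmod (g k z)) \<partial>lborel)"
      by (rule nn_integral_sum) measurable
    also have "\<dots> < \<infinity>" using fin by simp
    finally show ?thesis .
  qed
  have GW: "AE z in lborel. z \<in> ball 0 1 \<longrightarrow> G z \<le> W z * a z" using ineq by (simp add: a_def G_def)
  define aI where "aI = (\<integral>\<^sup>+z\<in>ball 0 1. ennreal (a z) \<partial>lborel)"
  have aI: "aI < \<infinity>" using flat[of 0] by (simp add: aI_def a_def)
  define T where "T m \<epsilon> = (\<integral>\<^sup>+z\<in>ball 0 \<epsilon>. ennreal (a z * inverse (norm z) ^ m) \<partial>lborel)" for m \<epsilon>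
  have T_lim: "(\<lambda>n. T m (1 / real (Suc n))) \<longlonglongrightarrow> 0" for m
  proof -
    have "(\<lambda>n. T m (1 / real (Suc n))) \<longlonglongrightarrow> (\<integral>\<^sup>+(z::complex). 0 \<partial>lborel)"
      unfolding T_def
    proof (rule nn_integral_dominated_convergence[where w="\<lambda>z. ennreal (a z * inverse (norm z) ^ m) * indicator (ball 0 1) z"])
      show "(\<integral>\<^sup>+z. ennreal (a z * inverse (norm z) ^ m) * indicator (ball 0 1) z \<partial>lborel) < \<infinity>"
        using flat[of m] by (simp add: a_def)
      fix n
      have "ball (0::complex) (1 / real (Suc n)) \<subseteq> ball 0 1" by (intro subset_ball) simp
      then have "indicator (ball 0 (1 / real (Suc n))) z \<le> (indicator (ball 0 1) z :: ennreal)" for z :: complex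
        by (auto simp: indicator_def)
      then show "AE z in lborel. ennreal (a z * inverse (norm z) ^ m) * indicator (ball 0 (1 / real (Suc n))) z
          \<le> ennreal (a z * inverse (norm z) ^ m) * indicator (ball 0 1) z"
        by (intro AE_I2 mult_left_mono) auto
    next
      have lim: "(\<lambda>n. ennreal (a z * inverse (norm z) ^ m) * indicator (ball 0 (1 / real (Suc n))) z) \<longlonglongrightarrow> 0"
        if "z \<noteq> 0" for z :: complex
      proof -
        have "(\<lambda>n. 1 / real (Suc n)) \<longlonglongrightarrow> 0" by (rule LIMSEQ_Suc[OF lim_1_over_n])
        then have "\<forall>\<^sub>F n in sequentially. 1 / real (Suc n) < norm z"
          using that by (intro order_tendstoD) auto
        then have "\<forall>\<^sub>F n in sequentially. ennreal (a z * inverse (norm z) ^ m) * indicator (ball 0 (1 / real (Suc n))) z = 0"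
          by eventually_elim auto
        then show ?thesis by (rule tendsto_eventually)
      qed
      have "AE z::complex in lborel. z \<noteq> 0" using AE_norm_neq[of 0] by simp
      then show "AE z in lborel. (\<lambda>n. ennreal (a z * inverse (norm z) ^ m) * indicator (ball 0 (1 / real (Suc n))) z) \<longlonglongrightarrow> 0"
        by eventually_elim (rule lim)
    qed measurable
    then show ?thesis by simp
  qed
  have extend: "\<exists>b>S. b \<le> 1 \<and> (AE z in lborel. norm z < b \<longrightarrow> a z = 0)"
    if S: "0 \<le> S" "S < 1" and zero: "AE z in lborel. norm z < S \<longrightarrow> a z = 0" for S
  proof -
    \<comment> \<open>Half of the constant on the left of the Carleman inequality, so that half of the left side remains
      after absorption.\<close>
    define \<kappa> where "\<kappa> = pompeiu_const / 2"
    have \<kappa>: "\<kappa> > 0" using pompeiu_const_pos by (simp add: \<kappa>_def)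
    define \<kappa>0 where "\<kappa>0 = \<kappa> / (C + 1)"
    have \<kappa>0: "\<kappa>0 > 0" "C * \<kappa>0 \<le> \<kappa>" using \<kappa> C by (auto simp: \<kappa>0_def divide_le_eq)
    obtain \<delta> where \<delta>: "\<delta> > 0" "S + \<delta> < 1" and small:
      "\<And>\<zeta>. (\<integral>\<^sup>+z\<in>{z. S < norm z \<and> norm z < S + \<delta>}. (H z + ennreal (norm (z - \<zeta>) powr - \<gamma>)) \<partial>lborel) \<le> ennreal \<kappa>0"
      using thin_annulus_kato[OF H H_fin \<gamma> S \<kappa>0(1)] by blast
    \<comment> \<open>The cutoff falls from \<open>1\<close> to \<open>0\<close> between \<open>b1\<close> and \<open>b2\<close>.  Vanishing is obtained only up to \<open>b < b1\<close>,
      where the weight exceeds its value at \<open>b1\<close> by the factor \<open>(b1 / b)\<^sup>m\<close>.\<close>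
    define b2 where "b2 = S + \<delta>"
    define b1 where "b1 = S + \<delta> / 2"
    define b where "b = S + \<delta> / 4"
    have bb: "S < b" "b < b1" "b1 < b2" "b2 < 1" "0 < b" using \<delta> S by (auto simp: b_def b1_def b2_def)
    then have b1: "0 < b1" by simp
    define A where "A = {z::complex. S < norm z \<and> norm z < b2}"
    have [measurable]: "A \<in> sets borel" unfolding A_def by measurable
    define w where "w z = ennreal (W z + 1) * indicator A z" for z
    have [measurable]: "w \<in> borel_measurable borel" unfolding w_def[abs_def] by measurable
    have w_kato: "(\<integral>\<^sup>+z. w z * ennreal (1 / cmod (\<zeta> - z)) \<partial>lborel) \<le> ennreal \<kappa>" for \<zeta>
    proof -
      have "(\<integral>\<^sup>+z. w z * ennreal (1 / cmod (\<zeta> - z)) \<partial>lborel)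
          \<le> (\<integral>\<^sup>+z. ennreal C * ((H z + ennreal (norm (z - \<zeta>) powr - \<gamma>)) * indicator A z) \<partial>lborel)"
      proof (intro nn_integral_mono)
        fix z
        show "w z * ennreal (1 / cmod (\<zeta> - z)) \<le> ennreal C * ((H z + ennreal (norm (z - \<zeta>) powr - \<gamma>)) * indicator A z)"
        proof (cases "z \<in> A")
          case True
          then have "z \<in> ball 0 1" "z \<noteq> 0" using bb S by (auto simp: A_def)
          moreover have "ennreal (W z + 1) * ennreal (1 / cmod (\<zeta> - z)) = ennreal ((W z + 1) / cmod (\<zeta> - z))"
            using W0[of z] by (subst ennreal_mult[symmetric]) auto
          ultimately show ?thesis using True kato[of z \<zeta>] by (simp add: w_def)
        qed (simp add: w_def)
      qed
      also have "\<dots> = ennreal C * (\<integral>\<^sup>+z\<in>A. (H z + ennreal (norm (z - \<zeta>) powr - \<gamma>)) \<partial>lborel)"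
        by (rule nn_integral_cmult) measurable
      also have "\<dots> \<le> ennreal C * ennreal \<kappa>0"
        using small[of \<zeta>] unfolding A_def b2_def by (intro mult_left_mono) auto
      also have "\<dots> = ennreal (C * \<kappa>0)" using C \<kappa>0(1) by (simp add: ennreal_mult)
      also have "\<dots> \<le> ennreal \<kappa>" using \<kappa>0(2) by (rule ennreal_leI)
      finally show ?thesis .
    qed
    have zero': "AE z in lborel. norm z \<le> S \<longrightarrow> a z = 0"
      using zero AE_norm_neq[of S] by eventually_elim auto
    define L where "L = 4 / (b2\<^sup>2 - b1\<^sup>2)"
    have L: "L > 0" unfolding L_def using ring_cutoff_diff_pos[OF zero_less_one b1 bb(3,4)] by simp
    have main: "(\<integral>\<^sup>+z\<in>{z. 2 * \<epsilon> \<le> norm z \<and> S < norm z \<and> norm z < b}. ennreal (a z) \<partial>lborel)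
        \<le> ennreal (b ^ m) * (ennreal (L * inverse b1 ^ m) * aI + 16 * T (Suc m) (2 * \<epsilon>))" 
      if \<epsilon>: "0 < \<epsilon>" for m \<epsilon>
    proof -
      let ?q = "ring_cutoff \<epsilon> b1 b2" and ?q' = "ring_cutoff' \<epsilon> b1 b2"
      define d where "d z = (of_real (?q' z 1) + \<i> * of_real (?q' z \<i>)) / 2" for z
      let ?p = "\<lambda>z. inverse (norm z) ^ m"
      let ?\<psi> = "\<lambda>z. of_real (?q z) * inverse z ^ m"
      let ?\<psi>' = "\<lambda>x v. of_real (?q' x v) * inverse x ^ m - of_real (?q x) * of_nat m * inverse x ^ Suc m * v"
      note q_inner = ring_cutoff_inner[OF \<epsilon> b1 bb(3,4)] and q_outer = ring_cutoff_outer[OF \<epsilon> b1 bb(3,4)]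
      note q01 = ring_cutoff_bounds[of \<epsilon> b1 b2]
      have \<psi>: "C1 ?\<psi> ?\<psi>'"
        by (rule C1_pole_weight[OF C1_ring_cutoff \<epsilon>]) (rule q_inner, simp)
      have d\<psi>: "dbar (?\<psi>' z) = d z * inverse z ^ m" for z
        unfolding d_def by (rule dbar_pole_weight)
      have [measurable]: "?q \<in> borel_measurable borel" "(\<lambda>z. ?q' z v) \<in> borel_measurable borel" for v
        using C1_borel_measurable[OF C1_ring_cutoff] by blast+
      have [measurable]: "d \<in> borel_measurable borel" unfolding d_def[abs_def] by measurable
      have n\<psi>: "cmod (?\<psi> z * x) = ?q z * ?p z * cmod x" for z x
        using q01(1)[of z] by (simp add: norm_mult norm_power norm_inverse)
      \<comment> \<open>\<open>X\<close> is the term to be absorbed, \<open>Y\<close> collects the derivatives of the cutoff.\<close>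
      define X where "X = (\<integral>\<^sup>+z\<in>A. ennreal (?q z * ?p z * (G z + a z)) \<partial>lborel)"
      define Y where "Y = (\<integral>\<^sup>+z. ennreal (cmod (d z) * ?p z * a z) \<partial>lborel)"
      have comp: "ennreal pompeiu_const * (\<integral>\<^sup>+z. w z * ennreal (?q z * ?p z * cmod (f k z)) \<partial>lborel)
          \<le> ennreal \<kappa> * (\<integral>\<^sup>+z. ennreal (?q z * ?p z * cmod (g k z) + cmod (d z) * ?p z * cmod (f k z)) \<partial>lborel)" for k
      proof -
        have "ennreal pompeiu_const * (\<integral>\<^sup>+z. w z * ennreal (cmod (?\<psi> z * f k z)) \<partial>lborel)
          \<le> ennreal \<kappa> * (\<integral>\<^sup>+z. ennreal (cmod (?\<psi> z * g k z + dbar (?\<psi>' z) * f k z)) \<partial>lborel)"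
        proof (rule carleman_inequality_limit[OF F f g _ conv \<alpha> \<psi> \<epsilon> _ bb(4) _ w_kato])
          show "?\<psi> z = 0" if "norm z < \<epsilon>" for z using q_inner[of z] that by simp
          show "?\<psi> z = 0" if "z \<notin> cball 0 b2" for z using q_outer[of z] that by simp
        qed measurable
        also have "(\<integral>\<^sup>+z. ennreal (cmod (?\<psi> z * g k z + dbar (?\<psi>' z) * f k z)) \<partial>lborel)
            \<le> (\<integral>\<^sup>+z. ennreal (?q z * ?p z * cmod (g k z) + cmod (d z) * ?p z * cmod (f k z)) \<partial>lborel)"
        proof (intro nn_integral_mono ennreal_leI)
          fix z
          have "cmod (?\<psi> z * g k z + dbar (?\<psi>' z) * f k z) \<le> cmod (?\<psi> z * g k z) + cmod (dbar (?\<psi>' z) * f k z)"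
            by (rule norm_triangle_ineq)
          also have "cmod (dbar (?\<psi>' z) * f k z) = cmod (d z) * ?p z * cmod (f k z)"
            unfolding d\<psi> by (simp add: norm_mult norm_power norm_inverse)
          finally show "cmod (?\<psi> z * g k z + dbar (?\<psi>' z) * f k z) \<le> ?q z * ?p z * cmod (g k z) + cmod (d z) * ?p z * cmod (f k z)"
            unfolding n\<psi> .
        qed
        finally show ?thesis unfolding n\<psi> by (simp add: mult_left_mono)
      qed
      have sum_comp: "ennreal pompeiu_const * (\<integral>\<^sup>+z. w z * ennreal (?q z * ?p z * a z) \<partial>lborel)
          \<le> ennreal \<kappa> * (\<integral>\<^sup>+z. ennreal (?q z * ?p z * G z + cmod (d z) * ?p z * a z) \<partial>lborel)"
      proof -
        have "(\<integral>\<^sup>+z. w z * ennreal (?q z * ?p z * a z) \<partial>lborel) = (\<integral>\<^sup>+z. (\<Sum>k\<in>UNIV. w z * ennreal (?q z * ?p z * cmod (f k z))) \<partial>lborel)"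
        proof (intro nn_integral_cong)
          fix z
          have "ennreal (?q z * ?p z * a z) = (\<Sum>k\<in>UNIV. ennreal (?q z * ?p z * cmod (f k z)))"
            unfolding a_def sum_distrib_left using q01(1)[of z] by (intro sum_ennreal[symmetric]) auto
          then show "w z * ennreal (?q z * ?p z * a z) = (\<Sum>k\<in>UNIV. w z * ennreal (?q z * ?p z * cmod (f k z)))"
            by (simp only: sum_distrib_left)
        qed
        also have "\<dots> = (\<Sum>k\<in>UNIV. \<integral>\<^sup>+z. w z * ennreal (?q z * ?p z * cmod (f k z)) \<partial>lborel)"
          by (rule nn_integral_sum) measurable
        finally have "ennreal pompeiu_const * (\<integral>\<^sup>+z. w z * ennreal (?q z * ?p z * a z) \<partial>lborel)
            = (\<Sum>k\<in>UNIV. ennreal pompeiu_const * (\<integral>\<^sup>+z. w z * ennreal (?q z * ?p z * cmod (f k z)) \<partial>lborel))"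
          by (simp only: sum_distrib_left)
        also have "\<dots> \<le> (\<Sum>k\<in>UNIV. ennreal \<kappa> * (\<integral>\<^sup>+z. ennreal (?q z * ?p z * cmod (g k z) + cmod (d z) * ?p z * cmod (f k z)) \<partial>lborel))"
          by (intro sum_mono comp)
        also have "\<dots> = ennreal \<kappa> * (\<Sum>k\<in>UNIV. \<integral>\<^sup>+z. ennreal (?q z * ?p z * cmod (g k z) + cmod (d z) * ?p z * cmod (f k z)) \<partial>lborel)"
          by (simp only: sum_distrib_left)
        also have "(\<Sum>k\<in>UNIV. \<integral>\<^sup>+z. ennreal (?q z * ?p z * cmod (g k z) + cmod (d z) * ?p z * cmod (f k z)) \<partial>lborel)
            = (\<integral>\<^sup>+z. (\<Sum>k\<in>UNIV. ennreal (?q z * ?p z * cmod (g k z) + cmod (d z) * ?p z * cmod (f k z))) \<partial>lborel)"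
          by (rule nn_integral_sum[symmetric]) measurable
        also have "\<dots> = (\<integral>\<^sup>+z. ennreal (?q z * ?p z * G z + cmod (d z) * ?p z * a z) \<partial>lborel)"
        proof (intro nn_integral_cong)
          fix z
          have "(\<Sum>k\<in>UNIV. ennreal (?q z * ?p z * cmod (g k z) + cmod (d z) * ?p z * cmod (f k z)))
              = ennreal (\<Sum>k\<in>UNIV. ?q z * ?p z * cmod (g k z) + cmod (d z) * ?p z * cmod (f k z))"
            using q01(1)[of z] by (intro sum_ennreal) auto
          then show "(\<Sum>k\<in>UNIV. ennreal (?q z * ?p z * cmod (g k z) + cmod (d z) * ?p z * cmod (f k z)))
              = ennreal (?q z * ?p z * G z + cmod (d z) * ?p z * a z)"
            by (simp only: a_def G_def sum.distrib sum_distrib_left)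
        qed
        finally show ?thesis .
      qed
      have X1: "X \<le> (\<integral>\<^sup>+z. w z * ennreal (?q z * ?p z * a z) \<partial>lborel)"
        unfolding X_def
      proof (intro nn_integral_mono_AE)
        show "AE z in lborel. ennreal (?q z * ?p z * (G z + a z)) * indicator A z \<le> w z * ennreal (?q z * ?p z * a z)"
          using GW
        proof eventually_elim
          fix z assume z: "z \<in> ball 0 1 \<longrightarrow> G z \<le> W z * a z"
          show "ennreal (?q z * ?p z * (G z + a z)) * indicator A z \<le> w z * ennreal (?q z * ?p z * a z)"
          proof (cases "z \<in> A")
            case True
            then have "z \<in> ball 0 1" using bb by (auto simp: A_def)
            then have "G z + a z \<le> (W z + 1) * a z" using z by (simp add: distrib_right)
            then have "?q z * ?p z * (G z + a z) \<le> ?q z * ?p z * ((W z + 1) * a z)"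
              using q01(1)[of z] by (intro mult_left_mono) auto
            also have "\<dots> = (W z + 1) * (?q z * ?p z * a z)" by (simp only: mult_ac)
            finally have "ennreal (?q z * ?p z * (G z + a z)) \<le> ennreal ((W z + 1) * (?q z * ?p z * a z))"
              by (rule ennreal_leI)
            also have "\<dots> = ennreal (W z + 1) * ennreal (?q z * ?p z * a z)"
              using W0[of z] a0[of z] q01(1)[of z] by (intro ennreal_mult) auto
            finally show ?thesis using True by (simp add: w_def)
          qed simp
        qed
      qed
      \<comment> \<open>Outside \<open>A\<close> either the cutoff vanishes, or \<open>f\<close> does and then \<open>g\<close> as well.\<close>
      have X2: "(\<integral>\<^sup>+z. ennreal (?q z * ?p z * G z + cmod (d z) * ?p z * a z) \<partial>lborel) \<le> X + Y"
      proof -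
        have "(\<integral>\<^sup>+z. ennreal (?q z * ?p z * G z + cmod (d z) * ?p z * a z) \<partial>lborel)
            \<le> (\<integral>\<^sup>+z. ennreal (?q z * ?p z * (G z + a z)) * indicator A z + ennreal (cmod (d z) * ?p z * a z) \<partial>lborel)"
        proof (intro nn_integral_mono_AE)
          show "AE z in lborel. ennreal (?q z * ?p z * G z + cmod (d z) * ?p z * a z)
              \<le> ennreal (?q z * ?p z * (G z + a z)) * indicator A z + ennreal (cmod (d z) * ?p z * a z)"
            using GW zero'
          proof eventually_elim
            fix z assume z: "z \<in> ball 0 1 \<longrightarrow> G z \<le> W z * a z" "norm z \<le> S \<longrightarrow> a z = 0"
            have nn: "0 \<le> ?q z * ?p z" using q01(1)[of z] by simp
            have "?q z * ?p z * G z \<le> ?q z * ?p z * (G z + a z) * indicator A z"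
            proof (cases "z \<in> A")
              case True
              then show ?thesis using nn a0[of z] by (simp add: mult_left_mono)
            next
              case False
              then consider "norm z \<le> S" | "b2 \<le> norm z" by (force simp: A_def)
              then show ?thesis
              proof cases
                case 1
                then have "G z \<le> 0" using z S by auto
                then show ?thesis using G0[of z] False by simp
              next
                case 2
                then show ?thesis using q_outer[of z] by simp
              qed
            qed
            then have "?q z * ?p z * G z + cmod (d z) * ?p z * a z
                \<le> ?q z * ?p z * (G z + a z) * indicator A z + cmod (d z) * ?p z * a z" by simp
            then have "ennreal (?q z * ?p z * G z + cmod (d z) * ?p z * a z)
                \<le> ennreal (?q z * ?p z * (G z + a z) * indicator A z) + ennreal (cmod (d z) * ?p z * a z)"
              using nn a0[of z] G0[of z] by (intro ennreal_le_plus) auto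
            also have "ennreal (?q z * ?p z * (G z + a z) * indicator A z) = ennreal (?q z * ?p z * (G z + a z)) * indicator A z"
              by (auto simp: indicator_def)
            finally show "ennreal (?q z * ?p z * G z + cmod (d z) * ?p z * a z)
              \<le> ennreal (?q z * ?p z * (G z + a z)) * indicator A z + ennreal (cmod (d z) * ?p z * a z)" .
          qed
        qed
        also have "\<dots> = X + Y" unfolding X_def Y_def by (rule nn_integral_add) measurable
        finally show ?thesis .
      qed
      have X_fin: "X < \<infinity>"
      proof -
        let ?B = "{z::complex. \<epsilon> \<le> norm z \<and> norm z \<le> b2}"
        have "X \<le> (\<integral>\<^sup>+z. ennreal (inverse \<epsilon> ^ m) * (ennreal (G z) * indicator ?B z + ennreal (a z) * indicator (ball 0 1) z) \<partial>lborel)"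
          unfolding X_def
        proof (intro nn_integral_mono)
          fix z
          show "ennreal (?q z * ?p z * (G z + a z)) * indicator A z
              \<le> ennreal (inverse \<epsilon> ^ m) * (ennreal (G z) * indicator ?B z + ennreal (a z) * indicator (ball 0 1) z)"
          proof (cases "z \<in> A \<and> \<epsilon> \<le> norm z")
            case True
            then have mem: "z \<in> ?B" "z \<in> ball 0 1" using bb by (auto simp: A_def)
            have "?q z * ?p z * (G z + a z) \<le> 1 * inverse \<epsilon> ^ m * (G z + a z)"
              using True \<epsilon> q01[of z] a0[of z] G0[of z]
              by (intro mult_right_mono mult_mono power_mono le_imp_inverse_le) auto
            then have "ennreal (?q z * ?p z * (G z + a z)) \<le> ennreal (inverse \<epsilon> ^ m * (G z + a z))"
              by (intro ennreal_leI) simp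
            also have "\<dots> = ennreal (inverse \<epsilon> ^ m) * (ennreal (G z) + ennreal (a z))"
              using \<epsilon> a0[of z] G0[of z] by (simp add: ennreal_mult ennreal_plus)
            finally show ?thesis using True mem by simp
          next
            case False
            then have "?q z = 0 \<or> z \<notin> A" using q_inner[of z] by auto
            then show ?thesis by auto
          qed
        qed
        also have "\<dots> = ennreal (inverse \<epsilon> ^ m) * (\<integral>\<^sup>+z. ennreal (G z) * indicator ?B z + ennreal (a z) * indicator (ball 0 1) z \<partial>lborel)"
          by (rule nn_integral_cmult) measurable
        also have "(\<integral>\<^sup>+z. ennreal (G z) * indicator ?B z + ennreal (a z) * indicator (ball 0 1) z \<partial>lborel)
            = (\<integral>\<^sup>+z\<in>?B. ennreal (G z) \<partial>lborel) + aI"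
          unfolding aI_def by (rule nn_integral_add) measurable
        also have "ennreal (inverse \<epsilon> ^ m) * ((\<integral>\<^sup>+z\<in>?B. ennreal (G z) \<partial>lborel) + aI) < \<infinity>"
          using g_fin[OF \<epsilon> bb(4)] aI by (simp add: ennreal_mult_less_top)
        finally show ?thesis .
      qed
      have "ennreal pompeiu_const * X \<le> ennreal (pompeiu_const / 2) * (X + Y)"
      proof -
        have "ennreal pompeiu_const * X \<le> ennreal pompeiu_const * (\<integral>\<^sup>+z. w z * ennreal (?q z * ?p z * a z) \<partial>lborel)"
          by (intro mult_left_mono X1) simp
        also note sum_comp
        also have "ennreal \<kappa> * (\<integral>\<^sup>+z. ennreal (?q z * ?p z * G z + cmod (d z) * ?p z * a z) \<partial>lborel) \<le> ennreal \<kappa> * (X + Y)"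
          by (intro mult_left_mono X2) simp
        finally show ?thesis by (simp add: \<kappa>_def)
      qed
      then have XY: "X \<le> Y" by (rule ennreal_absorb[OF pompeiu_const_pos X_fin])
      have Y: "Y \<le> ennreal (L * inverse b1 ^ m) * aI + 16 * T (Suc m) (2 * \<epsilon>)"
      proof -
        have "Y \<le> (\<integral>\<^sup>+z. ennreal (L * inverse b1 ^ m) * (ennreal (a z) * indicator (ball 0 1) z)
            + 16 * (ennreal (a z * inverse (norm z) ^ Suc m) * indicator (ball 0 (2 * \<epsilon>)) z) \<partial>lborel)"
          unfolding Y_def
        proof (intro nn_integral_mono)
          fix z :: complex
          let ?i1 = "indicator {z. b1 \<le> norm z \<and> norm z \<le> b2} z :: real" and ?i2 = "indicator (ball 0 (2 * \<epsilon>)) z :: real"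
          have "cmod (d z) \<le> L * ?i1 + 16 * inverse (norm z) * ?i2"
            unfolding d_def L_def by (rule ring_cutoff_dbar_bound[OF \<epsilon> b1 bb(3,4)])
          then have "cmod (d z) * (?p z * a z) \<le> (L * ?i1 + 16 * inverse (norm z) * ?i2) * (?p z * a z)"
            using a0[of z] by (intro mult_right_mono) auto
          also have "\<dots> = L * ?i1 * (?p z * a z) + 16 * (a z * inverse (norm z) ^ Suc m) * ?i2"
            by (simp add: algebra_simps)
          also have "L * ?i1 * (?p z * a z) \<le> L * inverse b1 ^ m * a z * indicator (ball 0 1) z"
          proof (cases "b1 \<le> norm z \<and> norm z \<le> b2")
            case True
            have "L * (?p z * a z) \<le> L * (inverse b1 ^ m * a z)"
              using True b1 a0[of z] L by (intro mult_left_mono mult_right_mono power_mono le_imp_inverse_le) auto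
            then show ?thesis using True bb by (simp add: mult_ac)
          qed (use L b1 a0[of z] in simp)
          finally have "cmod (d z) * ?p z * a z \<le> L * inverse b1 ^ m * a z * indicator (ball 0 1) z
              + 16 * (a z * inverse (norm z) ^ Suc m) * ?i2" by (simp add: mult.assoc)
          then have "ennreal (cmod (d z) * ?p z * a z) \<le> ennreal (L * inverse b1 ^ m * a z * indicator (ball 0 1) z)
              + ennreal (16 * (a z * inverse (norm z) ^ Suc m) * ?i2)"
            using L b1 a0[of z] by (intro ennreal_le_plus) auto
          also have "ennreal (L * inverse b1 ^ m * a z * indicator (ball 0 1) z)
              = ennreal (L * inverse b1 ^ m) * (ennreal (a z) * indicator (ball 0 1) z)"
            using L b1 a0[of z] by (auto simp: indicator_def ennreal_mult)
          also have "ennreal (16 * (a z * inverse (norm z) ^ Suc m) * ?i2)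
              = 16 * (ennreal (a z * inverse (norm z) ^ Suc m) * indicator (ball 0 (2 * \<epsilon>)) z)"
            using a0[of z] by (auto simp: indicator_def ennreal_mult' simp del: power_Suc)
          finally show "ennreal (cmod (d z) * ?p z * a z) \<le> ennreal (L * inverse b1 ^ m) * (ennreal (a z) * indicator (ball 0 1) z)
            + 16 * (ennreal (a z * inverse (norm z) ^ Suc m) * indicator (ball 0 (2 * \<epsilon>)) z)" .
        qed
        also have "\<dots> = (\<integral>\<^sup>+z. ennreal (L * inverse b1 ^ m) * (ennreal (a z) * indicator (ball 0 1) z) \<partial>lborel)
            + (\<integral>\<^sup>+z. 16 * (ennreal (a z * inverse (norm z) ^ Suc m) * indicator (ball 0 (2 * \<epsilon>)) z) \<partial>lborel)"
          by (rule nn_integral_add) measurable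
        also have "(\<integral>\<^sup>+z. ennreal (L * inverse b1 ^ m) * (ennreal (a z) * indicator (ball 0 1) z) \<partial>lborel) = ennreal (L * inverse b1 ^ m) * aI"
          unfolding aI_def by (rule nn_integral_cmult) measurable
        also have "(\<integral>\<^sup>+z. 16 * (ennreal (a z * inverse (norm z) ^ Suc m) * indicator (ball 0 (2 * \<epsilon>)) z) \<partial>lborel) = 16 * T (Suc m) (2 * \<epsilon>)"
          unfolding T_def by (rule nn_integral_cmult) measurable
        finally show ?thesis .
      qed
      have "(\<integral>\<^sup>+z\<in>{z. 2 * \<epsilon> \<le> norm z \<and> S < norm z \<and> norm z < b}. ennreal (a z) \<partial>lborel)
          \<le> (\<integral>\<^sup>+z. ennreal (b ^ m) * (ennreal (?q z * ?p z * (G z + a z)) * indicator A z) \<partial>lborel)"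
      proof (intro nn_integral_mono)
        fix z
        show "ennreal (a z) * indicator {z. 2 * \<epsilon> \<le> norm z \<and> S < norm z \<and> norm z < b} z
            \<le> ennreal (b ^ m) * (ennreal (?q z * ?p z * (G z + a z)) * indicator A z)"
        proof (cases "2 * \<epsilon> \<le> norm z \<and> S < norm z \<and> norm z < b")
          case True
          then have "z \<in> A" "?q z = 1" using bb ring_cutoff_eq_1[OF \<epsilon> b1 bb(3,4), of z] by (auto simp: A_def)
          have nz: "norm z > 0" using True \<epsilon> by linarith
          have "1 = norm z ^ m * ?p z" using nz by (simp flip: power_mult_distrib)
          also have "\<dots> \<le> b ^ m * ?p z" using True by (intro mult_right_mono power_mono) auto
          finally have "1 * a z \<le> (b ^ m * ?p z) * (G z + a z)"
            using a0[of z] G0[of z] by (intro mult_mono) auto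
          then have "ennreal (a z) \<le> ennreal (b ^ m * (?p z * (G z + a z)))"
            by (intro ennreal_leI) (simp add: mult.assoc)
          also have "\<dots> = ennreal (b ^ m) * ennreal (?p z * (G z + a z))"
            using bb a0[of z] G0[of z] by (intro ennreal_mult) auto
          finally show ?thesis using True \<open>z \<in> A\<close> \<open>?q z = 1\<close> by simp
        qed simp
      qed
      also have "\<dots> = ennreal (b ^ m) * X" unfolding X_def by (rule nn_integral_cmult) measurable
      also have "\<dots> \<le> ennreal (b ^ m) * (ennreal (L * inverse b1 ^ m) * aI + 16 * T (Suc m) (2 * \<epsilon>))"
        using XY Y by (intro mult_left_mono) auto
      finally show ?thesis .
    qed
    \<comment> \<open>First \<open>\<epsilon>\<close> tends to \<open>0\<close> for fixed \<open>m\<close>, then \<open>m\<close> tends to infinity.\<close>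
    have main0: "(\<integral>\<^sup>+z\<in>{z. \<rho> \<le> norm z \<and> S < norm z \<and> norm z < b}. ennreal (a z) \<partial>lborel) = 0" if \<rho>: "0 < \<rho>" for \<rho>
    proof -
      let ?J = "\<integral>\<^sup>+z\<in>{z. \<rho> \<le> norm z \<and> S < norm z \<and> norm z < b}. ennreal (a z) \<partial>lborel"
      have step1: "?J \<le> ennreal (b ^ m) * (ennreal (L * inverse b1 ^ m) * aI)" for m
      proof -
        have ev: "\<forall>\<^sub>F n in sequentially. ?J \<le> ennreal (b ^ m) * (ennreal (L * inverse b1 ^ m) * aI + 16 * T (Suc m) (1 / real (Suc n)))"
        proof -
          have "(\<lambda>n. 1 / real (Suc n)) \<longlonglongrightarrow> 0" by (rule LIMSEQ_Suc[OF lim_1_over_n])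
          then have "\<forall>\<^sub>F n in sequentially. 1 / real (Suc n) < \<rho>" using \<rho> by (intro order_tendstoD) auto
          then show ?thesis
          proof eventually_elim
            fix n assume n: "1 / real (Suc n) < \<rho>"
            define e where "e = 1 / real (Suc n) / 2"
            have "e > 0" by (simp add: e_def)
            moreover have "2 * (x / 2) = x" for x :: real by simp
            then have "2 * e = 1 / real (Suc n)" unfolding e_def .
            ultimately have e: "e > 0" "2 * e = 1 / real (Suc n)" by blast+
            have "?J \<le> (\<integral>\<^sup>+z\<in>{z. 2 * e \<le> norm z \<and> S < norm z \<and> norm z < b}. ennreal (a z) \<partial>lborel)"
              using n unfolding e(2) by (intro nn_integral_mono mult_left_mono) (auto simp: indicator_def)
            also have "\<dots> \<le> ennreal (b ^ m) * (ennreal (L * inverse b1 ^ m) * aI + 16 * T (Suc m) (2 * e))"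
              by (rule main[OF e(1)])
            finally show "?J \<le> ennreal (b ^ m) * (ennreal (L * inverse b1 ^ m) * aI + 16 * T (Suc m) (1 / real (Suc n)))"
              unfolding e(2) .
          qed
        qed
        have "(\<lambda>n. ennreal (b ^ m) * (ennreal (L * inverse b1 ^ m) * aI + 16 * T (Suc m) (1 / real (Suc n))))
            \<longlonglongrightarrow> ennreal (b ^ m) * (ennreal (L * inverse b1 ^ m) * aI + 16 * 0)"
          by (intro ennreal_tendsto_cmult tendsto_add tendsto_const T_lim) auto
        then have "(\<lambda>n. ennreal (b ^ m) * (ennreal (L * inverse b1 ^ m) * aI + 16 * T (Suc m) (1 / real (Suc n))))
            \<longlonglongrightarrow> ennreal (b ^ m) * (ennreal (L * inverse b1 ^ m) * aI)" by simp
        then show ?thesis using ev by (intro tendsto_lowerbound[of _ _ sequentially]) auto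
      qed
      have "(\<lambda>m. (b / b1) ^ m) \<longlonglongrightarrow> 0" using bb b1 by (intro LIMSEQ_power_zero) simp
      then have "(\<lambda>m. ennreal L * aI * ennreal ((b / b1) ^ m)) \<longlonglongrightarrow> ennreal L * aI * ennreal 0"
        using aI by (intro ennreal_tendsto_cmult tendsto_ennrealI) (auto simp: ennreal_mult_less_top)
      moreover have "ennreal (b ^ m) * (ennreal (L * inverse b1 ^ m) * aI) = ennreal L * aI * ennreal ((b / b1) ^ m)" for m
      proof -
        have "ennreal ((b / b1) ^ m) = ennreal (b ^ m) * ennreal (inverse b1 ^ m)"
          using bb b1 by (simp add: divide_inverse power_mult_distrib ennreal_mult)
        moreover have "ennreal (L * inverse b1 ^ m) = ennreal L * ennreal (inverse b1 ^ m)"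
          using L b1 by (simp add: ennreal_mult)
        ultimately show ?thesis by (simp only: mult_ac)
      qed
      ultimately have "(\<lambda>m. ennreal (b ^ m) * (ennreal (L * inverse b1 ^ m) * aI)) \<longlonglongrightarrow> 0" by simp
      then have "?J \<le> 0" by (rule LIMSEQ_le_const) (use step1 in auto)
      then show ?thesis by simp
    qed
    have ae: "AE z in lborel. 1 / real (Suc n) \<le> norm z \<and> S < norm z \<and> norm z < b \<longrightarrow> a z = 0" for n
    proof -
      have m: "(\<lambda>z. ennreal (a z) * indicator {z. 1 / real (Suc n) \<le> norm z \<and> S < norm z \<and> norm z < b} z) \<in> borel_measurable lborel"
        by measurable
      have "AE z in lborel. ennreal (a z) * indicator {z. 1 / real (Suc n) \<le> norm z \<and> S < norm z \<and> norm z < b} z = 0"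
        using main0[of "1 / real (Suc n)"] nn_integral_0_iff_AE[OF m] by simp
      then show ?thesis
        by eventually_elim (use a0 in \<open>force simp: indicator_def ennreal_eq_0_iff intro: antisym\<close>)
    qed
    have "AE z in lborel. norm z < b \<longrightarrow> a z = 0"
      using AE_all_countable[THEN iffD2, rule_format, OF ae] zero' AE_norm_neq[of 0]
    proof eventually_elim
      fix z :: complex
      assume 1: "\<forall>n. 1 / real (Suc n) \<le> norm z \<and> S < norm z \<and> norm z < b \<longrightarrow> a z = 0"
        and 2: "norm z \<le> S \<longrightarrow> a z = 0" and 3: "norm z \<noteq> 0"
      obtain n where "inverse (real (Suc n)) < norm z"
        using reals_Archimedean[of "norm z"] 3 by auto
      then have "1 / real (Suc n) \<le> norm z" by (simp add: inverse_eq_divide)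
      then show "norm z < b \<longrightarrow> a z = 0" using 1 2 by (cases "norm z \<le> S") auto
    qed
    then show ?thesis using bb by (intro exI[of _ b]) auto
  qed
  define Q where "Q = {S. 0 \<le> S \<and> S \<le> 1 \<and> (AE z in lborel. norm z < S \<longrightarrow> a z = 0)}"
  have Q0: "0 \<in> Q" by (simp add: Q_def)
  have bdd: "bdd_above Q" by (auto simp: Q_def intro!: bdd_aboveI[of _ 1])
  define s where "s = Sup Q"
  have s: "0 \<le> s" "s \<le> 1"
  proof -
    show "0 \<le> s" unfolding s_def by (rule cSup_upper[OF Q0 bdd])
    show "s \<le> 1" unfolding s_def by (rule cSup_least) (use Q0 in blast, simp add: Q_def)
  qed
  have "AE z in lborel. norm z < s - 1 / real (Suc n) \<longrightarrow> a z = 0" for n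
  proof -
    have "s - 1 / real (Suc n) < Sup Q" by (simp add: s_def)
    then obtain t where t: "t \<in> Q" "s - 1 / real (Suc n) < t" using less_cSup_iff[of Q] Q0 bdd by blast
    then have "AE z in lborel. norm z < t \<longrightarrow> a z = 0" by (simp add: Q_def)
    then show ?thesis by eventually_elim (use t(2) in auto)
  qed
  then have "AE z in lborel. \<forall>n. norm z < s - 1 / real (Suc n) \<longrightarrow> a z = 0"
    unfolding AE_all_countable by blast
  then have s0: "AE z in lborel. norm z < s \<longrightarrow> a z = 0"
  proof eventually_elim
    fix z :: complex assume z: "\<forall>n. norm z < s - 1 / real (Suc n) \<longrightarrow> a z = 0"
    show "norm z < s \<longrightarrow> a z = 0"
    proof
      assume "norm z < s"
      then obtain n where "inverse (real (Suc n)) < s - norm z" using reals_Archimedean[of "s - norm z"] by auto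
      then show "a z = 0" using z[rule_format, of n] by (simp add: inverse_eq_divide)
    qed
  qed
  have "s = 1"
  proof (rule ccontr)
    assume "s \<noteq> 1"
    then obtain b where b: "b > s" "b \<le> 1" "AE z in lborel. norm z < b \<longrightarrow> a z = 0"
      using extend[OF s(1) _ s0] s(2) by auto
    then have "b \<in> Q" using s by (simp add: Q_def)
    then have "b \<le> s" unfolding s_def using bdd by (rule cSup_upper)
    then show False using b(1) by simp
  qed
  show ?thesis
    using s0
  proof eventually_elim
    fix z assume z: "norm z < s \<longrightarrow> a z = 0"
    show "z \<in> ball 0 1 \<longrightarrow> (\<forall>k. f k z = 0)"
    proof
      assume "z \<in> ball 0 1"
      then have "a z = 0" using z \<open>s = 1\<close> by simp
      then show "\<forall>k. f k z = 0" unfolding a_def by (simp add: sum_nonneg_eq_0_iff)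
    qed
  qed
qed

section \<open>Complex lines through a point\<close>

lemma norm_vector_scalar_mult:
  fixes x :: "complex ^ 'n"
  shows "norm (\<mu> *s x) = cmod \<mu> * norm x"
  unfolding norm_vec_def L2_set_def
  by (simp add: norm_mult power_mult_distrib sum_distrib_left[symmetric] real_sqrt_mult)

lemma vector_scalar_mult_axis_sum:
  fixes x :: "complex ^ 'n"
  shows "x = (\<Sum>j\<in>UNIV. Re (x $ j) *\<^sub>R axis j 1 + Im (x $ j) *\<^sub>R axis j \<i>)"
proof (subst vec_eq_iff, intro allI)
  fix i
  have "(\<Sum>j\<in>UNIV. Re (x $ j) *\<^sub>R axis j 1 + Im (x $ j) *\<^sub>R axis j \<i>) $ i
      = (\<Sum>j\<in>UNIV. if j = i then Re (x $ i) *\<^sub>R 1 + Im (x $ i) *\<^sub>R \<i> else 0)"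
    unfolding sum_component by (intro sum.cong) (auto simp: axis_def)
  also have "\<dots> = x $ i" by (simp add: complex_eq_iff)
  finally show "x $ i = (\<Sum>j\<in>UNIV. Re (x $ j) *\<^sub>R axis j 1 + Im (x $ j) *\<^sub>R axis j \<i>) $ i" ..
qed

lemma continuous_on_vector_scalar_mult [continuous_intros]:
  fixes f :: "'a::topological_space \<Rightarrow> complex" and g :: "'a \<Rightarrow> complex ^ 'n"
  assumes "continuous_on S f" "continuous_on S g"
  shows "continuous_on S (\<lambda>x. f x *s g x)"
  unfolding vector_scalar_mult_def using assms
  by (intro continuous_on_vec_lambda continuous_on_mult continuous_on_component)

lemma borel_measurable_vector_scalar_mult [measurable]:
  "(\<lambda>x::complex ^ 'n. \<mu> *s x) \<in> borel_measurable borel"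
  by (intro borel_measurable_continuous_onI continuous_intros)

lemma borel_measurable_vector_scalar_mult_line [measurable]:
  "(\<lambda>\<mu>. \<mu> *s (x::complex ^ 'n)) \<in> borel_measurable borel"
  by (intro borel_measurable_continuous_onI continuous_intros)

lemma borel_measurable_vector_scalar_mult_pair [measurable]:
  "(\<lambda>(x, \<mu>). \<mu> *s (x::complex ^ 'n)) \<in> borel_measurable (lborel \<Otimes>\<^sub>M lborel)"
proof -
  have "(\<lambda>p::(complex ^ 'n) \<times> complex. snd p *s fst p) \<in> borel_measurable borel"
    by (intro borel_measurable_continuous_onI continuous_intros)
  then show ?thesis by (simp add: lborel_prod case_prod_beta')
qed

text \<open>The uniqueness proof for Haar measure: evaluate the double integral of \<open>f (\<mu> x) g (y)\<close>, with \<open>g\<close> the indicator of the unit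
ball, in two ways, moving the shift \<open>y \<mapsto> \<mu> x + y\<close> from one factor to the other.  It
identifies the two integrals up to the ratio of the measures of the unit ball and its preimage, which is
again a ball as \<open>x \<mapsto> \<mu> x\<close> scales the norm.\<close>

lemma nn_integral_complex_scale:
  fixes f :: "complex ^ 'n \<Rightarrow> ennreal"
  assumes [measurable]: "f \<in> borel_measurable borel" and "\<mu> \<noteq> 0"
  shows "(\<integral>\<^sup>+x. f (\<mu> *s x) \<partial>lborel) = ennreal (cmod \<mu> powr - real DIM(complex ^ 'n)) * (\<integral>\<^sup>+x. f x \<partial>lborel)"
proof -
  let ?B = "ball (0::complex ^ 'n) 1"
  let ?g = "indicator ?B :: complex ^ 'n \<Rightarrow> ennreal"
  let ?d = "real DIM(complex ^ 'n)"
  have [measurable]: "?B \<in> sets borel" by simp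
  have T': "\<mu> *s (- (inverse \<mu> *s y) + x) = \<mu> *s x - y" for x y
    using \<open>\<mu> \<noteq> 0\<close> by (simp add: vec_eq_iff algebra_simps)
  have "emeasure lborel ?B * (\<integral>\<^sup>+x. f (\<mu> *s x) \<partial>lborel) = (\<integral>\<^sup>+x. f (\<mu> *s x) * (\<integral>\<^sup>+y. ?g y \<partial>lborel) \<partial>lborel)"
    by (subst nn_integral_multc) (simp_all add: mult.commute)
  also have "\<dots> = (\<integral>\<^sup>+x. \<integral>\<^sup>+y. f (\<mu> *s x) * ?g (\<mu> *s x + y) \<partial>lborel \<partial>lborel)"
  proof (intro nn_integral_cong)
    fix x
    have "(\<integral>\<^sup>+y. f (\<mu> *s x) * ?g (\<mu> *s x + y) \<partial>lborel) = f (\<mu> *s x) * (\<integral>\<^sup>+y. ?g (\<mu> *s x + y) \<partial>lborel)"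
      by (rule nn_integral_cmult) measurable
    also have "(\<integral>\<^sup>+y. ?g (\<mu> *s x + y) \<partial>lborel) = (\<integral>\<^sup>+y. ?g y \<partial>lborel)"
      by (rule nn_integral_lborel_translate) measurable
    finally show "f (\<mu> *s x) * (\<integral>\<^sup>+y. ?g y \<partial>lborel) = (\<integral>\<^sup>+y. f (\<mu> *s x) * ?g (\<mu> *s x + y) \<partial>lborel)" ..
  qed
  also have "\<dots> = (\<integral>\<^sup>+y. \<integral>\<^sup>+x. f (\<mu> *s x) * ?g (\<mu> *s x + y) \<partial>lborel \<partial>lborel)"
    by (rule lborel_pair.Fubini'[symmetric]) measurable
  also have "\<dots> = (\<integral>\<^sup>+y. \<integral>\<^sup>+x. f (\<mu> *s x - y) * ?g (\<mu> *s x) \<partial>lborel \<partial>lborel)"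
  proof (rule nn_integral_cong)
    fix y
    have "(\<integral>\<^sup>+x. f (\<mu> *s x) * ?g (\<mu> *s x + y) \<partial>lborel)
        = (\<integral>\<^sup>+x. f (\<mu> *s (- (inverse \<mu> *s y) + x)) * ?g (\<mu> *s (- (inverse \<mu> *s y) + x) + y) \<partial>lborel)"
      by (rule nn_integral_lborel_translate[symmetric]) measurable
    then show "(\<integral>\<^sup>+x. f (\<mu> *s x) * ?g (\<mu> *s x + y) \<partial>lborel) = (\<integral>\<^sup>+x. f (\<mu> *s x - y) * ?g (\<mu> *s x) \<partial>lborel)"
      unfolding T' by simp
  qed
  also have "\<dots> = (\<integral>\<^sup>+x. \<integral>\<^sup>+y. f (\<mu> *s x - y) * ?g (\<mu> *s x) \<partial>lborel \<partial>lborel)"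
    by (rule lborel_pair.Fubini') measurable
  also have "\<dots> = (\<integral>\<^sup>+x. (\<integral>\<^sup>+y. f y \<partial>lborel) * ?g (\<mu> *s x) \<partial>lborel)"
  proof (intro nn_integral_cong)
    fix x
    have "(\<integral>\<^sup>+y. f (\<mu> *s x - y) * ?g (\<mu> *s x) \<partial>lborel) = (\<integral>\<^sup>+y. f (\<mu> *s x - y) \<partial>lborel) * ?g (\<mu> *s x)"
      by (rule nn_integral_multc) measurable
    also have "(\<integral>\<^sup>+y. f (\<mu> *s x - y) \<partial>lborel) = (\<integral>\<^sup>+y. f y \<partial>lborel)"
      by (rule nn_integral_lborel_reflect) measurable
    finally show "(\<integral>\<^sup>+y. f (\<mu> *s x - y) * ?g (\<mu> *s x) \<partial>lborel) = (\<integral>\<^sup>+y. f y \<partial>lborel) * ?g (\<mu> *s x)" .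
  qed
  also have "\<dots> = (\<integral>\<^sup>+y. f y \<partial>lborel) * (\<integral>\<^sup>+x. ?g (\<mu> *s x) \<partial>lborel)"
    by (rule nn_integral_cmult) measurable
  also have "(\<integral>\<^sup>+x. ?g (\<mu> *s x) \<partial>lborel) = emeasure lborel (ball (0::complex ^ 'n) (1 / cmod \<mu>))"
  proof -
    have "?g (\<mu> *s x) = indicator (ball 0 (1 / cmod \<mu>)) x" for x
      using \<open>\<mu> \<noteq> 0\<close> by (simp add: indicator_def norm_vector_scalar_mult pos_less_divide_eq mult.commute)
    then show ?thesis by (simp add: nn_integral_indicator)
  qed
  also have "\<dots> = ennreal (cmod \<mu> powr - ?d) * emeasure lborel ?B"
  proof -
    have "(1 / cmod \<mu>) ^ DIM(complex ^ 'n) = cmod \<mu> powr - ?d"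
    proof -
      have "(1 / cmod \<mu>) ^ N = cmod \<mu> powr - real N" for N
        using \<open>\<mu> \<noteq> 0\<close> by (simp add: powr_minus powr_realpow power_one_over inverse_eq_divide)
      then show ?thesis .
    qed
    then show ?thesis
      using \<open>\<mu> \<noteq> 0\<close> by (simp add: emeasure_ball mult.commute flip: ennreal_mult')
  qed
  finally have eq: "emeasure lborel ?B * (\<integral>\<^sup>+x. f (\<mu> *s x) \<partial>lborel)
      = emeasure lborel ?B * (ennreal (cmod \<mu> powr - ?d) * (\<integral>\<^sup>+x. f x \<partial>lborel))"
    by (simp only: mult_ac)
  have "emeasure lborel ?B \<noteq> 0"
    using open_not_negligible[of ?B] by (auto simp: negligible_iff_null_sets null_sets_def)
  moreover have "emeasure lborel ?B \<noteq> \<infinity>" using emeasure_lborel_ball_finite[of "0::complex ^ 'n" 1] by simp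
  ultimately show ?thesis using eq by (simp add: ennreal_mult_cancel_left)
qed

text \<open>Exchanging the integrals, the one over \<open>\<omega>\<close> produces the factor \<open>|\<mu>|\<^sup>-\<^sup>d\<close> with \<open>d\<close> the real dimension, and
\<open>|\<mu>|\<^sup>a\<^sup>-\<^sup>d\<close> is integrable in the unit disc exactly because \<open>a > d - 2\<close>.\<close>

lemma AE_slice_integral_finite:
  fixes h :: "complex ^ 'n \<Rightarrow> ennreal"
  assumes [measurable]: "h \<in> borel_measurable borel" and "R > 0"
    and a: "real DIM(complex ^ 'n) - 2 < a" "a \<le> real DIM(complex ^ 'n)"
    and fin: "(\<integral>\<^sup>+x\<in>ball 0 R. h x \<partial>lborel) < \<infinity>"
  shows "AE \<omega> in lborel. \<omega> \<in> ball 0 R \<longrightarrow> (\<integral>\<^sup>+\<mu>\<in>ball 0 1. ennreal (cmod \<mu> powr a) * h (\<mu> *s \<omega>) \<partial>lborel) < \<infinity>"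
proof -
  let ?B = "ball (0::complex ^ 'n) R" and ?D = "ball (0::complex) 1" and ?d = "real DIM(complex ^ 'n)"
  have [measurable]: "?B \<in> sets borel" "?D \<in> sets borel" by simp_all
  let ?h = "\<lambda>\<omega> \<mu>. indicator ?B \<omega> * (ennreal (cmod \<mu> powr a) * h (\<mu> *s \<omega>) * indicator ?D \<mu>)"
  have hp[measurable]: "(\<lambda>(\<omega>, \<mu>). h (\<mu> *s \<omega>)) \<in> borel_measurable (lborel \<Otimes>\<^sub>M lborel)"
    using measurable_compose[OF borel_measurable_vector_scalar_mult_pair assms(1)] by (simp add: case_prod_beta')
  have m[measurable]: "(\<lambda>(\<omega>, \<mu>). ?h \<omega> \<mu>) \<in> borel_measurable (lborel \<Otimes>\<^sub>M lborel)" by measurable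
  have inner: "(\<integral>\<^sup>+\<omega>. ?h \<omega> \<mu> \<partial>lborel) \<le> (\<integral>\<^sup>+x\<in>?B. h x \<partial>lborel) * (ennreal (cmod \<mu> powr - (?d - a)) * indicator ?D \<mu>)"
    if "\<mu> \<noteq> 0" for \<mu>
  proof (cases "\<mu> \<in> ?D")
    case True
    have "(\<integral>\<^sup>+\<omega>. ?h \<omega> \<mu> \<partial>lborel) \<le> (\<integral>\<^sup>+\<omega>. ennreal (cmod \<mu> powr a) * (h (\<mu> *s \<omega>) * indicator ?B (\<mu> *s \<omega>)) \<partial>lborel)"
    proof (intro nn_integral_mono)
      fix \<omega>
      have "indicator ?B \<omega> \<le> (indicator ?B (\<mu> *s \<omega>) :: ennreal)"
      proof (cases "\<omega> \<in> ?B")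
        case in_B: True
        have "cmod \<mu> * norm \<omega> \<le> 1 * norm \<omega>" using True by (intro mult_right_mono) auto
        then have "\<mu> *s \<omega> \<in> ?B" using in_B by (simp add: norm_vector_scalar_mult)
        then show ?thesis using in_B by simp
      qed (simp add: indicator_def)
      then have "ennreal (cmod \<mu> powr a) * h (\<mu> *s \<omega>) * indicator ?B \<omega> \<le> ennreal (cmod \<mu> powr a) * h (\<mu> *s \<omega>) * indicator ?B (\<mu> *s \<omega>)"
        by (rule mult_left_mono) simp
      then show "?h \<omega> \<mu> \<le> ennreal (cmod \<mu> powr a) * (h (\<mu> *s \<omega>) * indicator ?B (\<mu> *s \<omega>))"
        using True by (simp add: mult_ac)
    qed
    also have "\<dots> = ennreal (cmod \<mu> powr a) * (\<integral>\<^sup>+\<omega>. h (\<mu> *s \<omega>) * indicator ?B (\<mu> *s \<omega>) \<partial>lborel)"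
      by (rule nn_integral_cmult) measurable
    also have "(\<integral>\<^sup>+\<omega>. h (\<mu> *s \<omega>) * indicator ?B (\<mu> *s \<omega>) \<partial>lborel) = ennreal (cmod \<mu> powr - ?d) * (\<integral>\<^sup>+x\<in>?B. h x \<partial>lborel)"
      by (rule nn_integral_complex_scale[OF _ that]) measurable
    also have "ennreal (cmod \<mu> powr a) * (ennreal (cmod \<mu> powr - ?d) * (\<integral>\<^sup>+x\<in>?B. h x \<partial>lborel))
        = (\<integral>\<^sup>+x\<in>?B. h x \<partial>lborel) * (ennreal (cmod \<mu> powr a) * ennreal (cmod \<mu> powr - ?d))" by (simp only: mult_ac)
    also have "ennreal (cmod \<mu> powr a) * ennreal (cmod \<mu> powr - ?d) = ennreal (cmod \<mu> powr - (?d - a))"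
      by (subst ennreal_mult[symmetric]) (simp_all flip: powr_add)
    finally show ?thesis using True by simp
  qed simp
  have "(\<integral>\<^sup>+\<omega>. \<integral>\<^sup>+\<mu>. ?h \<omega> \<mu> \<partial>lborel \<partial>lborel) = (\<integral>\<^sup>+\<mu>. \<integral>\<^sup>+\<omega>. ?h \<omega> \<mu> \<partial>lborel \<partial>lborel)"
    using lborel_pair.Fubini'[OF m] by simp
  also have "\<dots> \<le> (\<integral>\<^sup>+\<mu>. (\<integral>\<^sup>+x\<in>?B. h x \<partial>lborel) * (ennreal (cmod \<mu> powr - (?d - a)) * indicator ?D \<mu>) \<partial>lborel)"
  proof (rule nn_integral_mono_AE)
    have "AE \<mu>::complex in lborel. \<mu> \<noteq> 0" using AE_norm_neq[of 0] by simp
    then show "AE \<mu> in lborel. (\<integral>\<^sup>+\<omega>. ?h \<omega> \<mu> \<partial>lborel) \<le> (\<integral>\<^sup>+x\<in>?B. h x \<partial>lborel) * (ennreal (cmod \<mu> powr - (?d - a)) * indicator ?D \<mu>)"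
      by eventually_elim (rule inner)
  qed
  also have "\<dots> = (\<integral>\<^sup>+x\<in>?B. h x \<partial>lborel) * (\<integral>\<^sup>+\<mu>\<in>?D. ennreal (cmod \<mu> powr - (?d - a)) \<partial>lborel)"
    by (rule nn_integral_cmult) measurable
  also have "\<dots> < \<infinity>"
    using nn_integral_pole_finite[of 1 "?d - a"] a fin by (simp add: ennreal_mult_less_top)
  finally have "(\<integral>\<^sup>+\<omega>. \<integral>\<^sup>+\<mu>. ?h \<omega> \<mu> \<partial>lborel \<partial>lborel) \<noteq> \<infinity>" by simp
  moreover have "(\<lambda>\<omega>. \<integral>\<^sup>+\<mu>. ?h \<omega> \<mu> \<partial>lborel) \<in> borel_measurable lborel"
    using m by measurable
  ultimately have "AE \<omega> in lborel. (\<integral>\<^sup>+\<mu>. ?h \<omega> \<mu> \<partial>lborel) \<noteq> \<infinity>"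
    by (rule nn_integral_noteq_infinite[rotated])
  then show ?thesis
    by eventually_elim (auto simp: less_top)
qed

text \<open>A null set is one on which the function \<open>\<infinity>\<close> has finite integral, so this is a special case of the
integrability of slices.\<close>

lemma AE_ball_imp_AE_slices:
  fixes R :: real and N :: "(complex ^ 'n) set"
  assumes N[measurable]: "N \<in> sets borel" and "R > 0" and ae: "AE x in lborel. x \<in> ball 0 R \<longrightarrow> x \<notin> N"
  shows "AE \<omega> in lborel. \<omega> \<in> ball 0 R \<longrightarrow> (AE \<mu> in lborel. \<mu> \<in> ball 0 1 \<longrightarrow> \<mu> *s \<omega> \<notin> N)"
proof -
  let ?h = "\<lambda>x::complex ^ 'n. \<infinity> * indicator N x :: ennreal"
  let ?a = "real DIM(complex ^ 'n)"
  have "(\<integral>\<^sup>+x\<in>ball 0 R. ?h x \<partial>lborel) = (\<integral>\<^sup>+(x::complex ^ 'n). 0 \<partial>lborel)"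
    using ae by (intro nn_integral_cong_AE) (auto elim!: eventually_mono simp: indicator_def)
  then have "AE \<omega> in lborel. \<omega> \<in> ball 0 R \<longrightarrow> (\<integral>\<^sup>+\<mu>\<in>ball 0 1. ennreal (cmod \<mu> powr ?a) * ?h (\<mu> *s \<omega>) \<partial>lborel) < \<infinity>"
    using \<open>R > 0\<close> by (intro AE_slice_integral_finite) auto
  then show ?thesis
  proof eventually_elim
    fix \<omega> :: "complex ^ 'n"
    assume fin: "\<omega> \<in> ball 0 R \<longrightarrow> (\<integral>\<^sup>+\<mu>\<in>ball 0 1. ennreal (cmod \<mu> powr ?a) * ?h (\<mu> *s \<omega>) \<partial>lborel) < \<infinity>"
    show "\<omega> \<in> ball 0 R \<longrightarrow> (AE \<mu> in lborel. \<mu> \<in> ball 0 1 \<longrightarrow> \<mu> *s \<omega> \<notin> N)"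
    proof
      assume "\<omega> \<in> ball 0 R"
      then have "(\<integral>\<^sup>+\<mu>\<in>ball 0 1. ennreal (cmod \<mu> powr ?a) * ?h (\<mu> *s \<omega>) \<partial>lborel) \<noteq> \<infinity>" using fin by simp
      then have "AE \<mu> in lborel. ennreal (cmod \<mu> powr ?a) * ?h (\<mu> *s \<omega>) * indicator (ball 0 1) \<mu> \<noteq> \<infinity>"
        by (rule nn_integral_noteq_infinite[rotated]) measurable
      moreover have "AE \<mu>::complex in lborel. \<mu> \<noteq> 0" using AE_norm_neq[of 0] by simp
      ultimately show "AE \<mu> in lborel. \<mu> \<in> ball 0 1 \<longrightarrow> \<mu> *s \<omega> \<notin> N"
      proof eventually_elim
        fix \<mu> :: complex
        assume 1: "ennreal (cmod \<mu> powr ?a) * ?h (\<mu> *s \<omega>) * indicator (ball 0 1) \<mu> \<noteq> \<infinity>" and 2: "\<mu> \<noteq> 0"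
        show "\<mu> \<in> ball 0 1 \<longrightarrow> \<mu> *s \<omega> \<notin> N"
        proof (intro impI notI)
          assume "\<mu> \<in> ball 0 1" "\<mu> *s \<omega> \<in> N"
          moreover have "ennreal (cmod \<mu> powr ?a) \<noteq> 0" using 2 by (simp add: ennreal_eq_0_iff not_le)
          ultimately show False using 1 by (simp add: ennreal_mult_top)
        qed
      qed
    qed
  qed
qed

text \<open>By Fubini some \<open>\<mu>\<close> with \<open>|\<mu>|\<close> close to \<open>1\<close> has \<open>\<mu> \<omega> \<notin> N\<close> for almost all \<open>\<omega>\<close> in the ball, and scaling
by this \<open>\<mu>\<close> covers all but a thin shell of the ball.\<close>

lemma AE_slices_imp_AE_ball:
  fixes R :: real and N :: "(complex ^ 'n) set"
  assumes N[measurable]: "N \<in> sets borel" and "R > 0"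
    and ae: "AE \<omega> in lborel. \<omega> \<in> ball 0 R \<longrightarrow> (AE \<mu> in lborel. \<mu> \<in> ball 0 1 \<longrightarrow> \<mu> *s \<omega> \<notin> N)"
  shows "AE x in lborel. x \<in> ball 0 R \<longrightarrow> x \<notin> N"
proof -
  let ?B = "ball (0::complex ^ 'n) R" and ?D = "ball (0::complex) 1" and ?d = "real DIM(complex ^ 'n)"
  have [measurable]: "?B \<in> sets borel" "?D \<in> sets borel" by simp_all
  let ?h = "\<lambda>\<omega> \<mu>. indicator ?B \<omega> * (indicator N (\<mu> *s \<omega>) * indicator ?D \<mu>) :: ennreal"
  have [measurable]: "(\<lambda>(\<omega>, \<mu>). indicator N (\<mu> *s \<omega>) :: ennreal) \<in> borel_measurable (lborel \<Otimes>\<^sub>M lborel)"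
    using measurable_compose[OF borel_measurable_vector_scalar_mult_pair, of "indicator N" borel] by (simp add: case_prod_beta')
  have m[measurable]: "(\<lambda>(\<omega>, \<mu>). ?h \<omega> \<mu>) \<in> borel_measurable (lborel \<Otimes>\<^sub>M lborel)" by measurable
  have "(\<integral>\<^sup>+\<mu>. \<integral>\<^sup>+\<omega>. ?h \<omega> \<mu> \<partial>lborel \<partial>lborel) = (\<integral>\<^sup>+\<omega>. \<integral>\<^sup>+\<mu>. ?h \<omega> \<mu> \<partial>lborel \<partial>lborel)"
    using lborel_pair.Fubini'[OF m] by simp
  also have "\<dots> = (\<integral>\<^sup>+(\<omega>::complex ^ 'n). 0 \<partial>lborel)"
  proof (rule nn_integral_cong_AE)
    show "AE \<omega> in lborel. (\<integral>\<^sup>+\<mu>. ?h \<omega> \<mu> \<partial>lborel) = 0"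
      using ae
    proof eventually_elim
      fix \<omega> :: "complex ^ 'n"
      assume z: "\<omega> \<in> ?B \<longrightarrow> (AE \<mu> in lborel. \<mu> \<in> ?D \<longrightarrow> \<mu> *s \<omega> \<notin> N)"
      show "(\<integral>\<^sup>+\<mu>. ?h \<omega> \<mu> \<partial>lborel) = 0"
      proof (cases "\<omega> \<in> ?B")
        case True
        then have "AE \<mu> in lborel. \<mu> \<in> ?D \<longrightarrow> \<mu> *s \<omega> \<notin> N" using z by blast
        then have "AE \<mu> in lborel. ?h \<omega> \<mu> = 0" by eventually_elim (auto simp: indicator_def)
        then show ?thesis by (subst nn_integral_cong_AE[where v="\<lambda>_. 0"]) auto
      qed simp
    qed
  qed
  finally have "(\<integral>\<^sup>+\<mu>. \<integral>\<^sup>+\<omega>. ?h \<omega> \<mu> \<partial>lborel \<partial>lborel) = 0" by simp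
  moreover have "(\<lambda>\<mu>. \<integral>\<^sup>+\<omega>. ?h \<omega> \<mu> \<partial>lborel) \<in> borel_measurable lborel"
    using measurable_pair_swap[OF m] by measurable
  ultimately have ae\<mu>: "AE \<mu> in lborel. (\<integral>\<^sup>+\<omega>. ?h \<omega> \<mu> \<partial>lborel) = 0"
    using nn_integral_0_iff_AE by blast
  have null: "AE x in lborel. x \<in> ball 0 (t * R) \<longrightarrow> x \<notin> N" if t: "0 < t" "t < 1" for t
  proof -
    define O' where "O' = {\<mu>::complex. t < cmod \<mu> \<and> cmod \<mu> < 1}"
    have "open O'" unfolding O'_def by (intro open_Collect_conj open_Collect_less continuous_intros)
    have "of_real ((t + 1) / 2) \<in> O'" unfolding O'_def mem_Collect_eq norm_of_real using t by auto
    then have "\<not> negligible O'" using open_not_negligible[OF \<open>open O'\<close>] by blast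
    have "\<exists>\<mu>\<in>O'. (\<integral>\<^sup>+\<omega>. ?h \<omega> \<mu> \<partial>lborel) = 0"
    proof (rule ccontr)
      assume "\<not> ?thesis"
      then have "AE \<mu> in lborel. \<mu> \<notin> O'" using ae\<mu> by (auto elim!: eventually_mono)
      then have "O' \<in> null_sets lborel" using AE_iff_null_sets[of O' lborel] \<open>open O'\<close> by simp
      then show False using \<open>\<not> negligible O'\<close> by (simp add: negligible_iff_null_sets null_sets_completionI)
    qed
    then obtain \<mu> where \<mu>: "t < cmod \<mu>" "cmod \<mu> < 1" "(\<integral>\<^sup>+\<omega>. ?h \<omega> \<mu> \<partial>lborel) = 0" by (auto simp: O'_def)
    then have "\<mu> \<noteq> 0" using t by auto
    have "ennreal (cmod \<mu> powr - ?d) * (\<integral>\<^sup>+x. indicator N x * indicator (ball 0 (t * R)) x \<partial>lborel)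
        = (\<integral>\<^sup>+\<omega>. indicator N (\<mu> *s \<omega>) * indicator (ball 0 (t * R)) (\<mu> *s \<omega>) \<partial>lborel)"
      by (rule nn_integral_complex_scale[symmetric, OF _ \<open>\<mu> \<noteq> 0\<close>]) measurable
    also have "\<dots> \<le> (\<integral>\<^sup>+\<omega>. ?h \<omega> \<mu> \<partial>lborel)"
    proof (intro nn_integral_mono)
      fix \<omega> :: "complex ^ 'n"
      have "\<omega> \<in> ?B" if "\<mu> *s \<omega> \<in> ball 0 (t * R)"
      proof -
        have "t * norm \<omega> \<le> cmod \<mu> * norm \<omega>" using \<mu> by (intro mult_right_mono) auto
        also have "\<dots> < t * R" using that by (simp add: norm_vector_scalar_mult)
        finally show ?thesis using t by simp
      qed
      then show "indicator N (\<mu> *s \<omega>) * indicator (ball 0 (t * R)) (\<mu> *s \<omega>) \<le> ?h \<omega> \<mu>"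
        using \<mu>(2) by (auto simp: indicator_def)
    qed
    finally have "ennreal (cmod \<mu> powr - ?d) * (\<integral>\<^sup>+x. indicator N x * indicator (ball 0 (t * R)) x \<partial>lborel) = 0"
      using \<mu>(3) by simp
    moreover have "ennreal (cmod \<mu> powr - ?d) \<noteq> 0" using \<open>\<mu> \<noteq> 0\<close> by (simp add: ennreal_eq_0_iff not_le)
    ultimately have z: "(\<integral>\<^sup>+x. indicator N x * indicator (ball 0 (t * R)) x \<partial>lborel) = (0::ennreal)" by simp
    have mm: "(\<lambda>x. indicator N x * indicator (ball 0 (t * R)) x :: ennreal) \<in> borel_measurable lborel" by measurable
    have "AE x in lborel. indicator N x * indicator (ball 0 (t * R)) x = (0::ennreal)"
      using z nn_integral_0_iff_AE[OF mm] by simp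
    then show ?thesis by eventually_elim (auto simp: indicator_def split: if_splits)
  qed
  have "AE x in lborel. x \<in> ball 0 ((1 - 1 / real (Suc (Suc n))) * R) \<longrightarrow> x \<notin> N" for n
    by (rule null) auto
  then have "AE x in lborel. \<forall>n. x \<in> ball 0 ((1 - 1 / real (Suc (Suc n))) * R) \<longrightarrow> x \<notin> N"
    unfolding AE_all_countable by blast
  then show ?thesis
  proof eventually_elim
    fix x :: "complex ^ 'n"
    assume x: "\<forall>n. x \<in> ball 0 ((1 - 1 / real (Suc (Suc n))) * R) \<longrightarrow> x \<notin> N"
    show "x \<in> ?B \<longrightarrow> x \<notin> N"
    proof
      assume "x \<in> ?B"
      have "(\<lambda>n. (1 - 1 / real (Suc (Suc n))) * R) \<longlonglongrightarrow> (1 - 0) * R"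
        by (intro tendsto_intros LIMSEQ_Suc[OF LIMSEQ_Suc[OF lim_1_over_n]])
      then have "\<forall>\<^sub>F n in sequentially. norm x < (1 - 1 / real (Suc (Suc n))) * R"
        using \<open>x \<in> ?B\<close> by (intro order_tendstoD) auto
      then obtain n where "norm x < (1 - 1 / real (Suc (Suc n))) * R" by (auto simp: eventually_sequentially)
      then have "x \<in> ball 0 ((1 - 1 / real (Suc (Suc n))) * R)" by (simp only: mem_ball dist_0_norm)
      then show "x \<notin> N" using x by blast
    qed
  qed
qed

lemma AE_lborel_translate:
  fixes c :: "'a::euclidean_space"
  assumes "AE x in lborel. P x"
  shows "AE x in lborel. P (c + x)"
proof -
  obtain N where N: "{x \<in> space lborel. \<not> P x} \<subseteq> N" "N \<in> sets (lborel :: 'a measure)" "emeasure lborel N = 0"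
    using AE_E[OF assms] by blast
  then have [measurable]: "N \<in> sets borel" by simp
  have "(\<integral>\<^sup>+x. indicator N (c + x) \<partial>lborel) = 0"
    using nn_integral_lborel_translate[of "indicator N" c] N by simp
  moreover have m: "(\<lambda>x. indicator N (c + x) :: ennreal) \<in> borel_measurable lborel" by measurable
  ultimately have "AE x in lborel. indicator N (c + x) = (0::ennreal)"
    using nn_integral_0_iff_AE[OF m] by simp
  then show ?thesis
  proof eventually_elim
    fix x assume "indicator N (c + x) = (0::ennreal)"
    then show "P (c + x)" using N(1) by (auto simp: indicator_def split: if_splits)
  qed
qed

lemma nn_integral_ball_translate:
  fixes c :: "'a::euclidean_space"
  assumes [measurable]: "h \<in> borel_measurable borel"
  shows "(\<integral>\<^sup>+x\<in>ball 0 R. h (c + x) \<partial>lborel) = (\<integral>\<^sup>+x\<in>ball c R. h x \<partial>lborel)"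
proof -
  have "(\<integral>\<^sup>+x. h (c + x) * indicator (ball c R) (c + x) \<partial>lborel) = (\<integral>\<^sup>+x\<in>ball c R. h x \<partial>lborel)"
    by (rule nn_integral_lborel_translate) measurable
  moreover have "indicator (ball c R) (c + x) = (indicator (ball 0 R) x :: ennreal)" for x
    by (simp add: indicator_def dist_norm)
  ultimately show ?thesis by simp
qed

lemma AE_ball_imp_AE_slices_pred:
  fixes R :: real and P :: "complex ^ 'n \<Rightarrow> bool"
  assumes "R > 0" and "AE x in lborel. x \<in> ball 0 R \<longrightarrow> P x"
  shows "AE \<omega> in lborel. \<omega> \<in> ball 0 R \<longrightarrow> (AE \<mu> in lborel. \<mu> \<in> ball 0 1 \<longrightarrow> P (\<mu> *s \<omega>))"
proof -
  obtain N where N: "{x \<in> space lborel. \<not> (x \<in> ball 0 R \<longrightarrow> P x)} \<subseteq> N" "N \<in> sets (lborel :: (complex ^ 'n) measure)" "emeasure lborel N = 0"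
    using AE_E[OF assms(2)] by blast
  then have "N \<in> null_sets lborel" by (auto simp: null_sets_def)
  then have "AE x in lborel. x \<in> ball 0 R \<longrightarrow> x \<notin> N" using AE_not_in by fastforce
  then have "AE \<omega> in lborel. \<omega> \<in> ball 0 R \<longrightarrow> (AE \<mu> in lborel. \<mu> \<in> ball 0 1 \<longrightarrow> \<mu> *s \<omega> \<notin> N)"
    using N(2) \<open>R > 0\<close> by (intro AE_ball_imp_AE_slices) auto
  then show ?thesis
  proof eventually_elim
    fix \<omega> :: "complex ^ 'n"
    assume *: "\<omega> \<in> ball 0 R \<longrightarrow> (AE \<mu> in lborel. \<mu> \<in> ball 0 1 \<longrightarrow> \<mu> *s \<omega> \<notin> N)"
    show "\<omega> \<in> ball 0 R \<longrightarrow> (AE \<mu> in lborel. \<mu> \<in> ball 0 1 \<longrightarrow> P (\<mu> *s \<omega>))"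
    proof
      assume \<omega>: "\<omega> \<in> ball 0 R"
      with * have "AE \<mu> in lborel. \<mu> \<in> ball 0 1 \<longrightarrow> \<mu> *s \<omega> \<notin> N" by blast
      then show "AE \<mu> in lborel. \<mu> \<in> ball 0 1 \<longrightarrow> P (\<mu> *s \<omega>)"
      proof eventually_elim
        fix \<mu> :: complex
        assume n: "\<mu> \<in> ball 0 1 \<longrightarrow> \<mu> *s \<omega> \<notin> N"
        show "\<mu> \<in> ball 0 1 \<longrightarrow> P (\<mu> *s \<omega>)"
        proof
          assume \<mu>: "\<mu> \<in> ball 0 1"
          have "cmod \<mu> * norm \<omega> \<le> 1 * norm \<omega>" using \<mu> by (intro mult_right_mono) auto
          then have "\<mu> *s \<omega> \<in> ball 0 R" using \<omega> by (simp add: norm_vector_scalar_mult)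
          then show "P (\<mu> *s \<omega>)" using n \<mu> N(1) by auto
        qed
      qed
    qed
  qed
qed

lemma C1_slice:
  fixes F :: "complex ^ 'n \<Rightarrow> complex"
  assumes F: "C1 F F'"
  shows "C1 (\<lambda>\<mu>. F (z0 + \<mu> *s \<omega>)) (\<lambda>\<mu> v. F' (z0 + \<mu> *s \<omega>) (v *s \<omega>))"
proof -
  have lin: "bounded_linear (\<lambda>v::complex. v *s \<omega>)"
  proof -
    have "linear (\<lambda>v::complex. v *s \<omega>)"
      by (rule linearI) (simp_all add: vec_eq_iff distrib_right)
    then show ?thesis by (simp add: linear_conv_bounded_linear)
  qed
  have "((\<lambda>\<mu>. F (z0 + \<mu> *s \<omega>)) has_derivative (\<lambda>v. F' (z0 + \<mu> *s \<omega>) (v *s \<omega>))) (at \<mu>)" for \<mu>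
  proof -
    have "((\<lambda>\<mu>. z0 + \<mu> *s \<omega>) has_derivative (\<lambda>v. 0 + v *s \<omega>)) (at \<mu>)"
      by (intro has_derivative_add has_derivative_const bounded_linear_imp_has_derivative lin)
    then have "((\<lambda>\<mu>. z0 + \<mu> *s \<omega>) has_derivative (\<lambda>v. v *s \<omega>)) (at \<mu>)" by simp
    moreover have "(F has_derivative F' (z0 + \<mu> *s \<omega>)) (at (z0 + \<mu> *s \<omega>))" using F by (simp add: C1_def)
    ultimately show ?thesis by (rule has_derivative_compose)
  qed
  moreover have "continuous_on UNIV (\<lambda>\<mu>. F' (z0 + \<mu> *s \<omega>) (v *s \<omega>))" for v
  proof (rule continuous_on_compose2[of UNIV "\<lambda>x. F' x (v *s \<omega>)"])
    show "continuous_on UNIV (\<lambda>x. F' x (v *s \<omega>))" using F by (simp add: C1_def)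
    show "continuous_on UNIV (\<lambda>\<mu>. z0 + \<mu> *s \<omega>)" by (intro continuous_intros)
  qed simp
  ultimately show ?thesis by (simp add: C1_def)
qed

text \<open>The value of \<open>dbar\<close> along the line in direction \<open>\<omega>\<close>, as computed from the partial derivatives
\<open>D (axis j 1)\<close> and \<open>D (axis j \<i>)\<close>.  It makes sense for weak derivatives also, which have no values in other
directions.\<close>

definition line_dbar :: "(complex ^ 'n \<Rightarrow> complex) \<Rightarrow> complex ^ 'n \<Rightarrow> complex" where
  "line_dbar D \<omega> = (\<Sum>j\<in>UNIV. cnj (\<omega> $ j) * ((D (axis j 1) + \<i> * D (axis j \<i>)) / 2))"

lemma dbar_slice:
  fixes L :: "complex ^ 'n \<Rightarrow> complex"
  assumes "linear L"
  shows "dbar (\<lambda>v. L (v *s \<omega>)) = line_dbar L \<omega>"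
proof -
  interpret linear L by fact
  have L: "L (v *s \<omega>) = (\<Sum>j\<in>UNIV. of_real (Re (v * \<omega> $ j)) * L (axis j 1) + of_real (Im (v * \<omega> $ j)) * L (axis j \<i>))" for v
  proof -
    have "L (v *s \<omega>) = L (\<Sum>j\<in>UNIV. Re ((v *s \<omega>) $ j) *\<^sub>R axis j 1 + Im ((v *s \<omega>) $ j) *\<^sub>R axis j \<i>)"
      by (rule arg_cong[OF vector_scalar_mult_axis_sum])
    also have "\<dots> = (\<Sum>j\<in>UNIV. Re ((v *s \<omega>) $ j) *\<^sub>R L (axis j 1) + Im ((v *s \<omega>) $ j) *\<^sub>R L (axis j \<i>))"
      by (simp only: sum add scaleR)
    finally show ?thesis by (simp only: scaleR_conv_of_real vector_smult_component)
  qed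
  have "(of_real (Re (1 * \<omega> $ j)) * A + of_real (Im (1 * \<omega> $ j)) * B)
      + \<i> * (of_real (Re (\<i> * \<omega> $ j)) * A + of_real (Im (\<i> * \<omega> $ j)) * B) = cnj (\<omega> $ j) * (A + \<i> * B)" for j A B
    by (simp add: complex_eq_iff algebra_simps)
  then have "L (1 *s \<omega>) + \<i> * L (\<i> *s \<omega>) = (\<Sum>j\<in>UNIV. cnj (\<omega> $ j) * (L (axis j 1) + \<i> * L (axis j \<i>)))"
    unfolding L sum_distrib_left sum.distrib[symmetric] by (intro sum.cong) auto
  then show ?thesis by (simp add: dbar_def line_dbar_def sum_divide_distrib)
qed

lemma line_dbar_diff_bound:
  fixes D E :: "complex ^ 'n \<Rightarrow> complex"
  shows "cmod (line_dbar D \<omega> - line_dbar E \<omega>)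
    \<le> norm \<omega> * (\<Sum>j\<in>UNIV. cmod (D (axis j 1) - E (axis j 1)) + cmod (D (axis j \<i>) - E (axis j \<i>)))"
proof -
  let ?A = "\<lambda>j. D (axis j 1) - E (axis j 1)" and ?B = "\<lambda>j. D (axis j \<i>) - E (axis j \<i>)"
  have "line_dbar D \<omega> - line_dbar E \<omega> = (\<Sum>j\<in>UNIV. cnj (\<omega> $ j) * ((?A j + \<i> * ?B j) / 2))"
    unfolding line_dbar_def sum_subtractf[symmetric]
    by (intro sum.cong refl) (simp add: algebra_simps add_divide_distrib diff_divide_distrib)
  also have "cmod \<dots> \<le> (\<Sum>j\<in>UNIV. norm \<omega> * (cmod (?A j) + cmod (?B j)))"
  proof (rule sum_norm_le)
    fix j
    have "cmod (?A j + \<i> * ?B j) \<le> cmod (?A j) + cmod (?B j)"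
      using norm_triangle_ineq[of "?A j" "\<i> * ?B j"] by (simp add: norm_mult)
    then have "cmod ((?A j + \<i> * ?B j) / 2) \<le> cmod (?A j) + cmod (?B j)"
      by (simp add: norm_divide) (smt (verit) norm_ge_zero)
    then have "cmod (cnj (\<omega> $ j)) * cmod ((?A j + \<i> * ?B j) / 2) \<le> norm \<omega> * (cmod (?A j) + cmod (?B j))"
      by (intro mult_mono) (auto simp: Finite_Cartesian_Product.norm_nth_le)
    then show "cmod (cnj (\<omega> $ j) * ((?A j + \<i> * ?B j) / 2)) \<le> norm \<omega> * (cmod (?A j) + cmod (?B j))"
      unfolding norm_mult .
  qed
  finally show ?thesis by (simp only: sum_distrib_left)
qed

lemma ennreal_suminf_finite_imp_tendsto_0:
  fixes J :: "nat \<Rightarrow> ennreal"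
  assumes "(\<Sum>i. J i) < \<infinity>"
  shows "J \<longlonglongrightarrow> 0"
proof -
  have "J i < \<infinity>" for i
  proof -
    have "(\<Sum>i\<in>{i}. J i) \<le> (\<Sum>i. J i)" by (rule sum_le_suminf) auto
    then show ?thesis using assms by (simp add: le_less_trans)
  qed
  then have J: "J i = ennreal (enn2real (J i))" for i by simp
  have "summable (\<lambda>i. enn2real (J i))"
    using assms by (intro summable_suminf_not_top) (simp_all flip: J)
  then have "(\<lambda>i. ennreal (enn2real (J i))) \<longlonglongrightarrow> ennreal 0"
    by (intro tendsto_ennrealI summable_LIMSEQ_zero)
  then show ?thesis using J by simp
qed

text \<open>Here \<open>d\<close> is the real dimension \<open>2n\<close>: the lower bound on \<open>a\<close> makes slices integrable, and \<open>a < p - 2\<close> is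
equivalent to \<open>(a + p) / (p - 1) < 2\<close>.\<close>

lemma slice_exponent:
  fixes d p :: real
  assumes "2 \<le> d" "d < p"
  obtains a where "d - 2 < a" "a \<le> d" "a < p - 2" "0 \<le> a" "1 < p"
proof
  show "d - 2 < d - 2 + min 1 ((p - d) / 2)" "d - 2 + min 1 ((p - d) / 2) \<le> d"
    "d - 2 + min 1 ((p - d) / 2) < p - 2" "0 \<le> d - 2 + min 1 ((p - d) / 2)" "1 < p"
    using assms min.cobounded2[of 1 "(p - d) / 2"] by (auto simp: min_def)
qed

section \<open>Unique continuation in balls\<close>

text \<open>Everything is given by Borel functions, so that slicing raises no measurability problem.  The
approximations \<open>F i k\<close> have errors \<open>2\<^sup>-\<^sup>i\<close>.  Their sum \<open>E\<close> is integrable, hence integrable on almost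
every line, and there the errors tend to \<open>0\<close>.\<close>

lemma unique_continuation_ball:
  fixes U :: "'m::finite \<Rightarrow> complex ^ 'n \<Rightarrow> complex" and G :: "'m \<Rightarrow> complex ^ 'n \<Rightarrow> complex ^ 'n \<Rightarrow> complex"
    and V :: "complex ^ 'n \<Rightarrow> real"
  assumes U: "\<And>k. integrable lborel (U k)" and G: "\<And>k b. b \<in> Basis \<Longrightarrow> integrable lborel (G k b)"
    and weak: "\<And>k b \<phi>. b \<in> Basis \<Longrightarrow> test_function \<Omega> \<phi> \<Longrightarrow>
      (LINT y|lborel. frechet_derivative \<phi> (at y) b *\<^sub>R U k y) = - (LINT y|lborel. \<phi> y *\<^sub>R G k b y)"
    and R: "R > 0" and r: "r > 0" "\<And>x. x \<in> ball z0 R \<Longrightarrow> cball x r \<subseteq> \<Omega>"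
    and p: "p > 2 * real CARD('n)"
    and V[measurable]: "V \<in> borel_measurable borel" and V0: "\<And>x. V x \<ge> 0"
    and Vp: "(\<integral>\<^sup>+x\<in>ball z0 R. ennreal (V x powr p) \<partial>lborel) < \<infinity>"
    and ineq: "AE x in lborel. x \<in> ball z0 R \<longrightarrow>
      (\<forall>\<omega>. (\<Sum>k\<in>UNIV. cmod (line_dbar (\<lambda>b. G k b x) \<omega>)) \<le> norm \<omega> * V x * (\<Sum>k\<in>UNIV. cmod (U k x)))"
    and flat: "\<And>m. (\<integral>\<^sup>+x\<in>ball z0 R. ennreal ((\<Sum>k\<in>UNIV. cmod (U k x)) * inverse (norm (x - z0)) ^ m) \<partial>lborel) < \<infinity>"
  shows "AE x in lborel. x \<in> ball z0 R \<longrightarrow> (\<forall>k. U k x = 0)"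
proof -
  let ?d = "real DIM(complex ^ 'n)" and ?K = "ball z0 R"
  have d: "?d = 2 * real CARD('n)" by simp
  have d2: "?d \<ge> 2" unfolding d using zero_less_card_finite[where 'a='n] by linarith
  have dp: "?d < p" using p unfolding d .
  obtain a where a: "?d - 2 < a" "a \<le> ?d" "a < p - 2" "0 \<le> a" and p1: "p > 1"
    by (rule slice_exponent[OF d2 dp])
  define \<gamma> where "\<gamma> = (a + p) / (p - 1)"
  have \<gamma>: "1 \<le> \<gamma>" "\<gamma> < 2" using a(3,4) p1 by (simp_all add: \<gamma>_def le_divide_eq divide_less_eq)
  have [measurable]: "U k \<in> borel_measurable borel" for k using U[of k] by simp
  have Gm[measurable]: "G k (axis j 1) \<in> borel_measurable borel" "G k (axis j \<i>) \<in> borel_measurable borel" for k j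
    using G[of "axis j 1" k] G[of "axis j \<i>" k] by (auto simp: axis_in_Basis_iff Basis_complex_def)
  have B: "axis j 1 \<in> (Basis :: (complex ^ 'n) set)" "axis j \<i> \<in> (Basis :: (complex ^ 'n) set)" for j
    by (auto simp: axis_in_Basis_iff Basis_complex_def)
  define Q where "Q i k P \<longleftrightarrow> C1 (fst P) (snd P) \<and> (\<integral>\<^sup>+x. norm (fst P x - U k x) \<partial>lborel) \<le> ennreal ((1/2) ^ i) \<and>
    (\<forall>b\<in>Basis. (\<integral>\<^sup>+x\<in>?K. norm (snd P x b - G k b x) \<partial>lborel) \<le> ennreal ((1/2) ^ i))" for i :: nat and k P
  have "\<exists>P. Q i k P" for i k
  proof (rule friedrichs_approximation[of "U k" "G k" \<Omega> r ?K "(1/2) ^ i"])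
    fix F F'
    assume "C1 F F'" "(\<integral>\<^sup>+x. norm (F x - U k x) \<partial>lborel) \<le> ennreal ((1/2) ^ i)"
      "\<And>b. b \<in> Basis \<Longrightarrow> (\<integral>\<^sup>+x\<in>?K. norm (F' x b - G k b x) \<partial>lborel) \<le> ennreal ((1/2) ^ i)"
    then have "Q i k (F, F')" by (simp add: Q_def)
    then show "\<exists>P. Q i k P" ..
  qed (use U G weak r in auto)
  then have Q': "Q i k (SOME P. Q i k P)" for i k by (rule someI_ex)
  define P where "P i k = (SOME P. Q i k P)" for i k
  have Q: "Q i k (P i k)" for i k unfolding P_def by (rule Q')
  have P: "\<And>i k. C1 (fst (P i k)) (snd (P i k))" 
    "\<And>i k. (\<integral>\<^sup>+x. norm (fst (P i k) x - U k x) \<partial>lborel) \<le> ennreal ((1/2) ^ i)"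
    "\<And>i k b. b \<in> Basis \<Longrightarrow> (\<integral>\<^sup>+x\<in>?K. norm (snd (P i k) x b - G k b x) \<partial>lborel) \<le> ennreal ((1/2) ^ i)"
    using Q unfolding Q_def by blast+
  define F where "F i k = fst (P i k)" for i k
  define F' where "F' i k = snd (P i k)" for i k
  have F: "C1 (F i k) (F' i k)" for i k using P(1) by (simp add: F_def F'_def)
  have F1: "(\<integral>\<^sup>+x. cmod (F i k x - U k x) \<partial>lborel) \<le> ennreal ((1/2) ^ i)" for i k using P(2) by (simp add: F_def)
  have F2: "(\<integral>\<^sup>+x\<in>?K. cmod (F' i k x b - G k b x) \<partial>lborel) \<le> ennreal ((1/2) ^ i)" if "b \<in> Basis" for i k b
    using P(3)[OF that] by (simp add: F'_def)
  note [measurable] = C1_borel_measurable[OF F]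
  define dd where "dd i k x = (\<Sum>j\<in>UNIV. cmod (F' i k x (axis j 1) - G k (axis j 1) x) + cmod (F' i k x (axis j \<i>) - G k (axis j \<i>) x))" for i k x
  define e where "e i k x = cmod (F i k x - U k x) + dd i k x" for i k x
  have dd0: "dd i k x \<ge> 0" for i k x unfolding dd_def by (intro sum_nonneg) auto
  have [measurable]: "dd i k \<in> borel_measurable borel" for i k unfolding dd_def[abs_def] by measurable
  have [measurable]: "e i k \<in> borel_measurable borel" for i k unfolding e_def[abs_def] by measurable
  have e_int: "(\<integral>\<^sup>+x\<in>?K. ennreal (e i k x) \<partial>lborel) \<le> ennreal ((1 + ?d) * (1/2) ^ i)" for i k
  proof -
    let ?t = "ennreal ((1/2) ^ i)"
    let ?A = "\<lambda>j x. ennreal (cmod (F' i k x (axis j 1) - G k (axis j 1) x)) * indicator ?K x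
      + ennreal (cmod (F' i k x (axis j \<i>) - G k (axis j \<i>) x)) * indicator ?K x"
    have "ennreal (e i k x) * indicator ?K x = ennreal (cmod (F i k x - U k x)) * indicator ?K x + (\<Sum>j\<in>UNIV. ?A j x)" for x
      unfolding e_def dd_def by (simp add: indicator_def ennreal_plus sum_nonneg flip: sum_ennreal)
    then have "(\<integral>\<^sup>+x\<in>?K. ennreal (e i k x) \<partial>lborel)
        = (\<integral>\<^sup>+x. ennreal (cmod (F i k x - U k x)) * indicator ?K x + (\<Sum>j\<in>UNIV. ?A j x) \<partial>lborel)" by simp
    also have "\<dots> = (\<integral>\<^sup>+x\<in>?K. ennreal (cmod (F i k x - U k x)) \<partial>lborel) + (\<integral>\<^sup>+x. (\<Sum>j\<in>UNIV. ?A j x) \<partial>lborel)"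
      by (rule nn_integral_add) measurable
    also have "(\<integral>\<^sup>+x. (\<Sum>j\<in>UNIV. ?A j x) \<partial>lborel) = (\<Sum>j\<in>UNIV. \<integral>\<^sup>+x. ?A j x \<partial>lborel)"
      by (rule nn_integral_sum) measurable
    also have "(\<integral>\<^sup>+x\<in>?K. ennreal (cmod (F i k x - U k x)) \<partial>lborel) + (\<Sum>j\<in>UNIV. \<integral>\<^sup>+x. ?A j x \<partial>lborel) \<le> ?t + (\<Sum>(j::'n)\<in>UNIV. ?t + ?t)"
    proof (intro add_mono sum_mono)
      have "(\<integral>\<^sup>+x\<in>?K. ennreal (cmod (F i k x - U k x)) \<partial>lborel) \<le> (\<integral>\<^sup>+x. ennreal (cmod (F i k x - U k x)) \<partial>lborel)"
        by (intro nn_integral_mono) (auto simp: indicator_def)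
      also have "\<dots> \<le> ?t" by (rule F1)
      finally show "(\<integral>\<^sup>+x\<in>?K. ennreal (cmod (F i k x - U k x)) \<partial>lborel) \<le> ?t" .
      fix j
      have "(\<integral>\<^sup>+x. ?A j x \<partial>lborel) = (\<integral>\<^sup>+x\<in>?K. ennreal (cmod (F' i k x (axis j 1) - G k (axis j 1) x)) \<partial>lborel)
          + (\<integral>\<^sup>+x\<in>?K. ennreal (cmod (F' i k x (axis j \<i>) - G k (axis j \<i>) x)) \<partial>lborel)"
        by (rule nn_integral_add) measurable
      also have "\<dots> \<le> ?t + ?t" by (intro add_mono F2 B)
      finally show "(\<integral>\<^sup>+x. ?A j x \<partial>lborel) \<le> ?t + ?t" .
    qed
    also have "?t + (\<Sum>(j::'n)\<in>UNIV. ?t + ?t) = ennreal ((1/2) ^ i + (\<Sum>(j::'n)\<in>UNIV. (1/2) ^ i + (1/2) ^ i))"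
    proof -
      have A: "?t + ?t = ennreal ((1/2) ^ i + (1/2) ^ i)" by (rule ennreal_plus[symmetric]) auto
      have B: "(\<Sum>(j::'n)\<in>UNIV. ?t + ?t) = ennreal (\<Sum>(j::'n)\<in>UNIV. (1/2) ^ i + (1/2) ^ i)"
        unfolding A by (rule sum_ennreal) auto
      show ?thesis unfolding B by (rule ennreal_plus[symmetric]) (auto intro!: sum_nonneg)
    qed
    also have "(1/2) ^ i + (\<Sum>(j::'n)\<in>UNIV. (1/2) ^ i + (1/2) ^ i) = (1 + ?d) * (1/2) ^ i"
      unfolding d by (simp add: algebra_simps)
    finally show ?thesis .
  qed
  define E where "E x = (\<Sum>i. \<Sum>k\<in>UNIV. ennreal (e i k x))" for x
  have [measurable]: "E \<in> borel_measurable borel" unfolding E_def[abs_def] by measurable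
  have E_fin: "(\<integral>\<^sup>+x\<in>?K. E x \<partial>lborel) < \<infinity>"
  proof -
    have "(\<integral>\<^sup>+x\<in>?K. E x \<partial>lborel) = (\<integral>\<^sup>+x. (\<Sum>i. \<Sum>k\<in>UNIV. ennreal (e i k x) * indicator ?K x) \<partial>lborel)"
      unfolding E_def by (simp add: sum_distrib_right flip: ennreal_suminf_multc)
    also have "\<dots> = (\<Sum>i. \<integral>\<^sup>+x. (\<Sum>k\<in>UNIV. ennreal (e i k x) * indicator ?K x) \<partial>lborel)"
      by (rule nn_integral_suminf) measurable
    also have "\<dots> = (\<Sum>i. \<Sum>k\<in>UNIV. \<integral>\<^sup>+x. ennreal (e i k x) * indicator ?K x \<partial>lborel)"
      by (intro suminf_cong nn_integral_sum) measurable
    also have "\<dots> \<le> (\<Sum>i. ennreal (real CARD('m) * ((1 + ?d) * (1/2) ^ i)))"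
    proof (rule suminf_le)
      fix i
      have "(\<Sum>k\<in>UNIV. \<integral>\<^sup>+x. ennreal (e i k x) * indicator ?K x \<partial>lborel) \<le> (\<Sum>(k::'m)\<in>UNIV. ennreal ((1 + ?d) * (1/2) ^ i))"
        by (intro sum_mono e_int)
      also have "\<dots> = ennreal (\<Sum>(k::'m)\<in>UNIV. (1 + ?d) * (1/2) ^ i)" by (rule sum_ennreal) auto
      also have "(\<Sum>(k::'m)\<in>UNIV. (1 + ?d) * (1/2) ^ i) = real CARD('m) * ((1 + ?d) * (1/2) ^ i)"
        by (rule sum_constant)
      finally show "(\<Sum>k\<in>UNIV. \<integral>\<^sup>+x. ennreal (e i k x) * indicator ?K x \<partial>lborel) \<le> ennreal (real CARD('m) * ((1 + ?d) * (1/2) ^ i))" .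
    qed (rule summableI)+
    also have "\<dots> = ennreal (real CARD('m) * ((1 + ?d) * (1 / (1 - 1/2))))"
      by (intro suminf_ennreal_eq sums_mult geometric_sums) auto
    also have "\<dots> < \<infinity>" by simp
    finally show ?thesis .
  qed
  define u where "u x = (\<Sum>k\<in>UNIV. cmod (U k x))" for x
  have u0: "u x \<ge> 0" for x by (auto simp: u_def intro: sum_nonneg)
  have [measurable]: "u \<in> borel_measurable borel" unfolding u_def[abs_def] by measurable
  have sV: "AE \<omega> in lborel. \<omega> \<in> ball 0 R \<longrightarrow>
      (\<integral>\<^sup>+\<mu>\<in>ball 0 1. ennreal (cmod \<mu> powr a) * ennreal (V (z0 + \<mu> *s \<omega>) powr p) \<partial>lborel) < \<infinity>"
    by (rule AE_slice_integral_finite[OF _ R a(1,2), of "\<lambda>w. ennreal (V (z0 + w) powr p)"])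
       (measurable, use Vp nn_integral_ball_translate[of "\<lambda>x. ennreal (V x powr p)" z0 R] in simp)
  have sE: "AE \<omega> in lborel. \<omega> \<in> ball 0 R \<longrightarrow>
      (\<integral>\<^sup>+\<mu>\<in>ball 0 1. ennreal (cmod \<mu> powr a) * E (z0 + \<mu> *s \<omega>) \<partial>lborel) < \<infinity>"
    by (rule AE_slice_integral_finite[OF _ R a(1,2), of "\<lambda>w. E (z0 + w)"])
       (measurable, use E_fin nn_integral_ball_translate[of E z0 R] in simp)
  have su: "AE \<omega> in lborel. \<forall>m. \<omega> \<in> ball 0 R \<longrightarrow>
      (\<integral>\<^sup>+\<mu>\<in>ball 0 1. ennreal (cmod \<mu> powr a) * ennreal (u (z0 + \<mu> *s \<omega>) * inverse (norm (\<mu> *s \<omega>)) ^ m) \<partial>lborel) < \<infinity>"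
    unfolding AE_all_countable
  proof
    fix m
    have "(\<integral>\<^sup>+w\<in>ball 0 R. ennreal (u (z0 + w) * inverse (norm w) ^ m) \<partial>lborel) < \<infinity>"
      using flat[of m] nn_integral_ball_translate[of "\<lambda>x. ennreal (u x * inverse (norm (x - z0)) ^ m)" z0 R]
      by (simp add: u_def)
    then show "AE \<omega> in lborel. \<omega> \<in> ball 0 R \<longrightarrow>
      (\<integral>\<^sup>+\<mu>\<in>ball 0 1. ennreal (cmod \<mu> powr a) * ennreal (u (z0 + \<mu> *s \<omega>) * inverse (norm (\<mu> *s \<omega>)) ^ m) \<partial>lborel) < \<infinity>"
      by (intro AE_slice_integral_finite[OF _ R a(1,2), of "\<lambda>w. ennreal (u (z0 + w) * inverse (norm w) ^ m)"]) measurable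
  qed
  have si: "AE \<omega> in lborel. \<omega> \<in> ball 0 R \<longrightarrow> (AE \<mu> in lborel. \<mu> \<in> ball 0 1 \<longrightarrow>
      (\<forall>\<omega>'. (\<Sum>k\<in>UNIV. cmod (line_dbar (\<lambda>b. G k b (z0 + \<mu> *s \<omega>)) \<omega>')) \<le> norm \<omega>' * V (z0 + \<mu> *s \<omega>) * u (z0 + \<mu> *s \<omega>)))"
  proof (rule AE_ball_imp_AE_slices_pred[OF R])
    show "AE x in lborel. x \<in> ball 0 R \<longrightarrow>
      (\<forall>\<omega>'. (\<Sum>k\<in>UNIV. cmod (line_dbar (\<lambda>b. G k b (z0 + x)) \<omega>')) \<le> norm \<omega>' * V (z0 + x) * u (z0 + x))"
      using AE_lborel_translate[OF ineq, of z0] by eventually_elim (simp add: u_def dist_norm)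
  qed
  define N where "N = {w. \<exists>k. U k (z0 + w) \<noteq> 0}"
  have N: "N \<in> sets borel" unfolding N_def by measurable
  have "AE \<omega>::complex ^ 'n in lborel. \<omega> \<noteq> 0" by (rule AE_lborel_singleton)
  with sV sE su si have slices: "AE \<omega> in lborel. \<omega> \<in> ball 0 R \<longrightarrow> (AE \<mu> in lborel. \<mu> \<in> ball 0 1 \<longrightarrow> \<mu> *s \<omega> \<notin> N)"
  proof eventually_elim
    fix \<omega> :: "complex ^ 'n"
    assume sV: "\<omega> \<in> ball 0 R \<longrightarrow> (\<integral>\<^sup>+\<mu>\<in>ball 0 1. ennreal (cmod \<mu> powr a) * ennreal (V (z0 + \<mu> *s \<omega>) powr p) \<partial>lborel) < \<infinity>"
      and sE: "\<omega> \<in> ball 0 R \<longrightarrow> (\<integral>\<^sup>+\<mu>\<in>ball 0 1. ennreal (cmod \<mu> powr a) * E (z0 + \<mu> *s \<omega>) \<partial>lborel) < \<infinity>"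
      and su: "\<forall>m. \<omega> \<in> ball 0 R \<longrightarrow> (\<integral>\<^sup>+\<mu>\<in>ball 0 1. ennreal (cmod \<mu> powr a) * ennreal (u (z0 + \<mu> *s \<omega>) * inverse (norm (\<mu> *s \<omega>)) ^ m) \<partial>lborel) < \<infinity>"
      and si: "\<omega> \<in> ball 0 R \<longrightarrow> (AE \<mu> in lborel. \<mu> \<in> ball 0 1 \<longrightarrow>
      (\<forall>\<omega>'. (\<Sum>k\<in>UNIV. cmod (line_dbar (\<lambda>b. G k b (z0 + \<mu> *s \<omega>)) \<omega>')) \<le> norm \<omega>' * V (z0 + \<mu> *s \<omega>) * u (z0 + \<mu> *s \<omega>)))"
      and nz: "\<omega> \<noteq> 0"
    let ?x = "\<lambda>\<mu>. z0 + \<mu> *s \<omega>"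
    let ?f = "\<lambda>k \<mu>. U k (?x \<mu>)" and ?g = "\<lambda>k \<mu>. line_dbar (\<lambda>b. G k b (?x \<mu>)) \<omega>"
    let ?F = "\<lambda>i k \<mu>. F i k (?x \<mu>)" and ?F' = "\<lambda>i k \<mu> v. F' i k (?x \<mu>) (v *s \<omega>)"
    let ?W = "\<lambda>\<mu>. R * V (?x \<mu>)"
    let ?H = "\<lambda>\<mu>. ennreal (cmod \<mu> powr a) * ennreal (V (?x \<mu>) powr p) + ennreal (cmod \<mu> powr - \<gamma>) + 1"
    have [measurable]: "?x \<in> borel_measurable borel" by measurable
    have [measurable]: "?g k \<in> borel_measurable borel" for k unfolding line_dbar_def by measurable
    show "\<omega> \<in> ball 0 R \<longrightarrow> (AE \<mu> in lborel. \<mu> \<in> ball 0 1 \<longrightarrow> \<mu> *s \<omega> \<notin> N)"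
    proof
      assume \<omega>: "\<omega> \<in> ball 0 R"
      then have \<omega>R: "norm \<omega> \<le> R" by simp
      have "AE \<mu> in lborel. \<mu> \<in> ball 0 1 \<longrightarrow> (\<forall>k. ?f k \<mu> = 0)"
      proof (rule disc_unique_continuation[where F="?F" and F'="?F'" and g="?g" and W="?W" and H="?H" and \<alpha>=a and C="R + 1" and \<gamma>=\<gamma>])
        show "C1 (?F i k) (?F' i k)" for i k by (rule C1_slice[OF F])
        show "?f k \<in> borel_measurable borel" "?g k \<in> borel_measurable borel" for k by measurable
        show "?W \<in> borel_measurable borel" "?H \<in> borel_measurable borel" by measurable
        show "(\<lambda>i. \<integral>\<^sup>+\<mu>\<in>ball 0 1. ennreal (cmod \<mu> powr a * (cmod (?F i k \<mu> - ?f k \<mu>) + cmod (dbar (?F' i k \<mu>) - ?g k \<mu>))) \<partial>lborel)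
          \<longlonglongrightarrow> 0" for k
        proof -
          let ?J = "\<lambda>i. \<integral>\<^sup>+\<mu>\<in>ball 0 1. ennreal (cmod \<mu> powr a) * ennreal (e i k (?x \<mu>)) \<partial>lborel"
          have "(\<Sum>i. ?J i) = (\<integral>\<^sup>+\<mu>. (\<Sum>i. ennreal (cmod \<mu> powr a) * ennreal (e i k (?x \<mu>)) * indicator (ball 0 1) \<mu>) \<partial>lborel)"
            by (rule nn_integral_suminf[symmetric]) measurable
          also have "\<dots> \<le> (\<integral>\<^sup>+\<mu>\<in>ball 0 1. ennreal (cmod \<mu> powr a) * E (?x \<mu>) \<partial>lborel)"
          proof (intro nn_integral_mono)
            fix \<mu>
            have "(\<Sum>i. ennreal (e i k (?x \<mu>))) \<le> E (?x \<mu>)"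
              unfolding E_def
            proof (rule suminf_le)
              fix i
              have "(\<Sum>k\<in>{k}. ennreal (e i k (?x \<mu>))) \<le> (\<Sum>k\<in>UNIV. ennreal (e i k (?x \<mu>)))"
                by (rule sum_mono2) auto
              then show "ennreal (e i k (?x \<mu>)) \<le> (\<Sum>k\<in>UNIV. ennreal (e i k (?x \<mu>)))" by simp
            qed (rule summableI)+
            then have "ennreal (cmod \<mu> powr a) * (\<Sum>i. ennreal (e i k (?x \<mu>))) * indicator (ball 0 1) \<mu>
                \<le> ennreal (cmod \<mu> powr a) * E (?x \<mu>) * indicator (ball 0 1) \<mu>"
              by (intro mult_right_mono mult_left_mono) auto
            then show "(\<Sum>i. ennreal (cmod \<mu> powr a) * ennreal (e i k (?x \<mu>)) * indicator (ball 0 1) \<mu>)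
                \<le> ennreal (cmod \<mu> powr a) * E (?x \<mu>) * indicator (ball 0 1) \<mu>"
              by (simp only: ennreal_suminf_multc ennreal_suminf_cmult)
          qed
          also have "\<dots> < \<infinity>" using sE \<omega> by blast
          finally have "?J \<longlonglongrightarrow> 0" by (rule ennreal_suminf_finite_imp_tendsto_0)
          then have lim: "(\<lambda>i. ennreal (R + 1) * ?J i) \<longlonglongrightarrow> ennreal (R + 1) * 0"
            by (intro ennreal_tendsto_cmult) auto
          have le: "(\<integral>\<^sup>+\<mu>\<in>ball 0 1. ennreal (cmod \<mu> powr a * (cmod (?F i k \<mu> - ?f k \<mu>) + cmod (dbar (?F' i k \<mu>) - ?g k \<mu>))) \<partial>lborel)
              \<le> ennreal (R + 1) * ?J i" for i
          proof -
            have "(\<integral>\<^sup>+\<mu>\<in>ball 0 1. ennreal (cmod \<mu> powr a * (cmod (?F i k \<mu> - ?f k \<mu>) + cmod (dbar (?F' i k \<mu>) - ?g k \<mu>))) \<partial>lborel)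
              \<le> (\<integral>\<^sup>+\<mu>. ennreal (R + 1) * (ennreal (cmod \<mu> powr a) * ennreal (e i k (?x \<mu>)) * indicator (ball 0 1) \<mu>) \<partial>lborel)"
            proof (intro nn_integral_mono)
              fix \<mu>
              have "cmod (dbar (?F' i k \<mu>) - ?g k \<mu>) \<le> norm \<omega> * dd i k (?x \<mu>)"
                unfolding dbar_slice[OF C1_linear[OF F]] dd_def by (rule line_dbar_diff_bound)
              also have "\<dots> \<le> (R + 1) * dd i k (?x \<mu>)" using \<omega>R by (intro mult_right_mono dd0) simp
              finally have "cmod (?F i k \<mu> - ?f k \<mu>) + cmod (dbar (?F' i k \<mu>) - ?g k \<mu>)
                  \<le> (R + 1) * cmod (?F i k \<mu> - ?f k \<mu>) + (R + 1) * dd i k (?x \<mu>)"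
                using R by (intro add_mono) (auto simp: mult_le_cancel_right1)
              then have "cmod (?F i k \<mu> - ?f k \<mu>) + cmod (dbar (?F' i k \<mu>) - ?g k \<mu>) \<le> (R + 1) * e i k (?x \<mu>)"
                unfolding e_def by (simp only: distrib_left)
              then have "cmod \<mu> powr a * (cmod (?F i k \<mu> - ?f k \<mu>) + cmod (dbar (?F' i k \<mu>) - ?g k \<mu>)) \<le> cmod \<mu> powr a * ((R + 1) * e i k (?x \<mu>))"
                by (rule mult_left_mono) simp
              then have "ennreal (cmod \<mu> powr a * (cmod (?F i k \<mu> - ?f k \<mu>) + cmod (dbar (?F' i k \<mu>) - ?g k \<mu>)))
                  \<le> ennreal ((R + 1) * (cmod \<mu> powr a * e i k (?x \<mu>)))"
                by (intro ennreal_leI) (simp add: mult.left_commute)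
              also have "\<dots> = ennreal (R + 1) * (ennreal (cmod \<mu> powr a) * ennreal (e i k (?x \<mu>)))"
                using R dd0 by (simp add: ennreal_mult e_def)
              finally show "ennreal (cmod \<mu> powr a * (cmod (?F i k \<mu> - ?f k \<mu>) + cmod (dbar (?F' i k \<mu>) - ?g k \<mu>))) * indicator (ball 0 1) \<mu>
                  \<le> ennreal (R + 1) * (ennreal (cmod \<mu> powr a) * ennreal (e i k (?x \<mu>)) * indicator (ball 0 1) \<mu>)"
                by (auto simp: indicator_def)
            qed
            also have "\<dots> = ennreal (R + 1) * ?J i" by (rule nn_integral_cmult) measurable
            finally show ?thesis .
          qed
          show ?thesis
            by (rule tendsto_sandwich[OF _ _ tendsto_const lim[simplified]]) (use le in auto)
        qed
        show "AE \<mu> in lborel. \<mu> \<in> ball 0 1 \<longrightarrow> (\<Sum>k\<in>UNIV. cmod (?g k \<mu>)) \<le> ?W \<mu> * (\<Sum>k\<in>UNIV. cmod (?f k \<mu>))"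
        proof -
          have "AE \<mu> in lborel. \<mu> \<in> ball 0 1 \<longrightarrow>
            (\<forall>\<omega>'. (\<Sum>k\<in>UNIV. cmod (line_dbar (\<lambda>b. G k b (?x \<mu>)) \<omega>')) \<le> norm \<omega>' * V (?x \<mu>) * u (?x \<mu>))"
            using si \<omega> by blast
          then show ?thesis
          proof eventually_elim
            fix \<mu>
            assume le: "\<mu> \<in> ball 0 1 \<longrightarrow> (\<forall>\<omega>'. (\<Sum>k\<in>UNIV. cmod (line_dbar (\<lambda>b. G k b (?x \<mu>)) \<omega>')) \<le> norm \<omega>' * V (?x \<mu>) * u (?x \<mu>))"
            show "\<mu> \<in> ball 0 1 \<longrightarrow> (\<Sum>k\<in>UNIV. cmod (?g k \<mu>)) \<le> ?W \<mu> * (\<Sum>k\<in>UNIV. cmod (?f k \<mu>))"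
            proof
              assume "\<mu> \<in> ball 0 1"
              then have "(\<Sum>k\<in>UNIV. cmod (?g k \<mu>)) \<le> norm \<omega> * V (?x \<mu>) * u (?x \<mu>)" using le by blast
              also have "\<dots> \<le> ?W \<mu> * u (?x \<mu>)" using \<omega>R V0 u0 by (intro mult_right_mono) auto
              finally show "(\<Sum>k\<in>UNIV. cmod (?g k \<mu>)) \<le> ?W \<mu> * (\<Sum>k\<in>UNIV. cmod (?f k \<mu>))" unfolding u_def .
            qed
          qed
        qed
        show "?W \<mu> \<ge> 0" for \<mu> using R V0 by simp
        show "ennreal ((?W \<mu> + 1) / cmod (\<zeta> - \<mu>)) \<le> ennreal (R + 1) * (?H \<mu> + ennreal (cmod (\<mu> - \<zeta>) powr - \<gamma>))"
          if "\<mu> \<noteq> 0" for \<mu> \<zeta>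
        proof -
          let ?X = "cmod \<mu>" and ?Y = "cmod (\<mu> - \<zeta>)" and ?v = "V (?x \<mu>)"
          have 1: "?v / ?Y \<le> ?v powr p * ?X powr a + (?X powr - \<gamma> + ?Y powr - \<gamma>)"
            unfolding \<gamma>_def using that V0 p1 a(4) by (intro young_kernel_bound) auto
          have 2: "1 / ?Y \<le> 1 + ?Y powr - \<gamma>"
          proof (cases "?Y \<ge> 1")
            case True
            then have "1 / ?Y \<le> 1" by (subst divide_le_eq_1_pos; linarith)
            then show ?thesis by (simp add: add_increasing2)
          next
            case False
            show ?thesis
            proof (cases "?Y = 0")
              case nz: False
              then have "?Y powr - 1 \<le> ?Y powr - \<gamma>" using False \<gamma> by (intro powr_mono') auto
              then show ?thesis using nz by (simp add: powr_minus inverse_eq_divide add_increasing)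
            qed simp
          qed
          define T where "T = ?v powr p * ?X powr a + ?X powr - \<gamma> + 1 + ?Y powr - \<gamma>"
          have T: "?v / ?Y \<le> T" "1 / ?Y \<le> T"
            using 1 2 by (auto simp: T_def intro: order_trans add_increasing)
          have "(?W \<mu> + 1) / ?Y = R * (?v / ?Y) + 1 / ?Y" by (simp add: add_divide_distrib)
          also have "\<dots> \<le> R * T + T" using T R by (intro add_mono mult_left_mono) auto
          also have "\<dots> = (R + 1) * T" by (simp add: distrib_right)
          finally have "ennreal ((?W \<mu> + 1) / ?Y) \<le> ennreal ((R + 1) * T)" by (rule ennreal_leI)
          also have "\<dots> = ennreal (R + 1) * (?H \<mu> + ennreal (?Y powr - \<gamma>))"
          proof -
            have "ennreal T = ?H \<mu> + ennreal (?Y powr - \<gamma>)"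
              unfolding T_def by (simp add: ennreal_plus ennreal_mult mult.commute)
            moreover have "T \<ge> 0" by (simp add: T_def)
            ultimately show ?thesis using R by (simp add: ennreal_mult)
          qed
          finally show ?thesis by (simp add: norm_minus_commute)
        qed
        show "(\<integral>\<^sup>+\<mu>\<in>ball 0 1. ?H \<mu> \<partial>lborel) < \<infinity>"
        proof -
          let ?D = "ball (0::complex) 1"
          have "(\<integral>\<^sup>+\<mu>\<in>?D. ?H \<mu> \<partial>lborel) = (\<integral>\<^sup>+\<mu>. ennreal (cmod \<mu> powr a) * ennreal (V (?x \<mu>) powr p) * indicator ?D \<mu>
              + (ennreal (cmod \<mu> powr - \<gamma>) * indicator ?D \<mu> + indicator ?D \<mu>) \<partial>lborel)"
            by (simp add: distrib_right add.assoc)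
          also have "\<dots> = (\<integral>\<^sup>+\<mu>\<in>?D. ennreal (cmod \<mu> powr a) * ennreal (V (?x \<mu>) powr p) \<partial>lborel)
              + (\<integral>\<^sup>+\<mu>. ennreal (cmod \<mu> powr - \<gamma>) * indicator ?D \<mu> + indicator ?D \<mu> \<partial>lborel)"
            by (rule nn_integral_add) measurable
          also have "(\<integral>\<^sup>+\<mu>. ennreal (cmod \<mu> powr - \<gamma>) * indicator ?D \<mu> + indicator ?D \<mu> \<partial>lborel)
              = (\<integral>\<^sup>+\<mu>\<in>?D. ennreal (cmod \<mu> powr - \<gamma>) \<partial>lborel) + (\<integral>\<^sup>+\<mu>. indicator ?D \<mu> \<partial>lborel)"
            by (rule nn_integral_add) measurable
          also have "(\<integral>\<^sup>+\<mu>. indicator ?D \<mu> \<partial>lborel) = emeasure lborel ?D" by simp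
          finally show ?thesis
            using sV \<omega> nn_integral_pole_finite[of 1 \<gamma>] \<gamma> emeasure_lborel_ball_finite[of "0::complex" 1] by simp
        qed
        show "(\<integral>\<^sup>+\<mu>\<in>ball 0 1. ennreal ((\<Sum>k\<in>UNIV. cmod (?f k \<mu>)) * inverse (cmod \<mu>) ^ m) \<partial>lborel) < \<infinity>" for m
        proof -
          \<comment> \<open>The factor \<open>|\<mu>|\<^sup>a\<close> that slicing introduces is compensated by a pole of higher order.\<close>
          define M where "M = m + DIM(complex ^ 'n)"
          have "(\<integral>\<^sup>+\<mu>\<in>ball 0 1. ennreal (u (?x \<mu>) * inverse (cmod \<mu>) ^ m) \<partial>lborel)
              \<le> (\<integral>\<^sup>+\<mu>. ennreal (norm \<omega> ^ M) * (ennreal (cmod \<mu> powr a) * ennreal (u (?x \<mu>) * inverse (norm (\<mu> *s \<omega>)) ^ M) * indicator (ball 0 1) \<mu>) \<partial>lborel)"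
          proof (rule nn_integral_mono_AE)
            have "AE \<mu>::complex in lborel. \<mu> \<noteq> 0" by (rule AE_lborel_singleton)
            then show "AE \<mu> in lborel. ennreal (u (?x \<mu>) * inverse (cmod \<mu>) ^ m) * indicator (ball 0 1) \<mu>
              \<le> ennreal (norm \<omega> ^ M) * (ennreal (cmod \<mu> powr a) * ennreal (u (?x \<mu>) * inverse (norm (\<mu> *s \<omega>)) ^ M) * indicator (ball 0 1) \<mu>)"
            proof eventually_elim
              fix \<mu> :: complex assume \<mu>: "\<mu> \<noteq> 0"
              show "ennreal (u (?x \<mu>) * inverse (cmod \<mu>) ^ m) * indicator (ball 0 1) \<mu>
                \<le> ennreal (norm \<omega> ^ M) * (ennreal (cmod \<mu> powr a) * ennreal (u (?x \<mu>) * inverse (norm (\<mu> *s \<omega>)) ^ M) * indicator (ball 0 1) \<mu>)"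
              proof (cases "\<mu> \<in> ball 0 1")
                case True
                let ?t = "cmod \<mu>"
                have t: "0 < ?t" "?t < 1" using \<mu> True by auto
                have "?t ^ DIM(complex ^ 'n) = ?t powr ?d" by (rule powr_realpow[OF t(1), symmetric])
                also have "\<dots> \<le> ?t powr a" using t a(2) by (intro powr_mono') auto
                finally have pw: "?t ^ DIM(complex ^ 'n) \<le> ?t powr a" .
                have "inverse ?t ^ m = ?t ^ DIM(complex ^ 'n) * inverse ?t ^ M"
                proof -
                  have "?t ^ N * inverse ?t ^ N = 1" for N using t(1) by (simp flip: power_mult_distrib)
                  then have "inverse ?t ^ m = inverse ?t ^ m * (?t ^ DIM(complex ^ 'n) * inverse ?t ^ DIM(complex ^ 'n))"
                    by (simp only: mult_1_right)
                  then show ?thesis unfolding M_def power_add by (simp only: mult_ac)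
                qed
                also have "\<dots> \<le> ?t powr a * inverse ?t ^ M" using pw t by (intro mult_right_mono) auto
                also have "inverse ?t ^ M = norm \<omega> ^ M * inverse (norm (\<mu> *s \<omega>)) ^ M"
                proof -
                  have "inverse ?t = norm \<omega> * inverse (norm (\<mu> *s \<omega>))"
                    using nz t(1) by (simp add: norm_vector_scalar_mult)
                  then show ?thesis by (simp only: power_mult_distrib)
                qed
                finally have "u (?x \<mu>) * inverse ?t ^ m \<le> u (?x \<mu>) * (?t powr a * (norm \<omega> ^ M * inverse (norm (\<mu> *s \<omega>)) ^ M))"
                  by (rule mult_left_mono[OF _ u0])
                then have "ennreal (u (?x \<mu>) * inverse ?t ^ m) \<le> ennreal (norm \<omega> ^ M * (?t powr a * (u (?x \<mu>) * inverse (norm (\<mu> *s \<omega>)) ^ M)))"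
                  by (intro ennreal_leI) (simp only: mult_ac)
                also have "\<dots> = ennreal (norm \<omega> ^ M) * (ennreal (?t powr a) * ennreal (u (?x \<mu>) * inverse (norm (\<mu> *s \<omega>)) ^ M))"
                  using u0 by (simp add: ennreal_mult)
                finally show ?thesis using True by simp
              qed simp
            qed
          qed
          also have "\<dots> = ennreal (norm \<omega> ^ M) * (\<integral>\<^sup>+\<mu>\<in>ball 0 1. ennreal (cmod \<mu> powr a) * ennreal (u (?x \<mu>) * inverse (norm (\<mu> *s \<omega>)) ^ M) \<partial>lborel)"
            by (rule nn_integral_cmult) measurable
          also have "\<dots> < \<infinity>" using su \<omega> by (simp add: ennreal_mult_less_top)
          finally show ?thesis unfolding u_def .
        qed
      qed (use a \<gamma> R in auto)
      then show "AE \<mu> in lborel. \<mu> \<in> ball 0 1 \<longrightarrow> \<mu> *s \<omega> \<notin> N"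
        by eventually_elim (simp add: N_def)
    qed
  qed
  have "AE w in lborel. w \<in> ball 0 R \<longrightarrow> w \<notin> N" by (rule AE_slices_imp_AE_ball[OF N R slices])
  then have "AE x in lborel. - z0 + x \<in> ball 0 R \<longrightarrow> - z0 + x \<notin> N" by (rule AE_lborel_translate)
  then show ?thesis by eventually_elim (auto simp: N_def dist_norm norm_minus_commute)
qed

section \<open>From weak derivatives to unique continuation in domains\<close>

lemma L_loc_measurable_on:
  assumes "L_loc q \<Omega> f" "K \<in> sets lebesgue" "K \<subseteq> \<Omega>"
  shows "(\<lambda>x. indicator K x *\<^sub>R f x) \<in> borel_measurable lebesgue"
proof -
  have [measurable]: "(\<lambda>x. indicator \<Omega> x *\<^sub>R f x) \<in> borel_measurable lebesgue" "K \<in> sets lebesgue"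
    using assms by (simp_all add: L_loc_def set_borel_measurable_def)
  have "(\<lambda>x. indicator K x *\<^sub>R (indicator \<Omega> x *\<^sub>R f x)) \<in> borel_measurable lebesgue" by measurable
  moreover have "indicator K x *\<^sub>R (indicator \<Omega> x *\<^sub>R f x) = indicator K x *\<^sub>R f x" for x
    using assms(3) by (auto simp: indicator_def)
  ultimately show ?thesis by (simp only:)
qed

lemma L_loc_1_integrable:
  assumes f: "L_loc 1 \<Omega> f" and K: "compact K" "K \<subseteq> \<Omega>"
  shows "integrable lebesgue (\<lambda>x. indicator K x *\<^sub>R f x)"
proof -
  have "K \<in> sets lebesgue" using K(1) by (simp add: borel_compact)
  then have m: "(\<lambda>x. indicator K x *\<^sub>R f x) \<in> borel_measurable lebesgue"
    using L_loc_measurable_on[OF f _ K(2)] by blast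
  have "integrable lebesgue (\<lambda>x. norm (indicator K x *\<^sub>R f x))"
    using f K unfolding L_loc_def set_integrable_def by simp
  then show ?thesis using m by (simp only: integrable_norm_iff)
qed

text \<open>Borel representatives are needed for slicing: the map \<open>(\<omega>, \<mu>) \<mapsto> \<mu> \<omega>\<close> is Borel, but composition with
it does not preserve Lebesgue measurability in an evident way.\<close>

lemma integrable_lebesgue_complex_borel:
  fixes f :: "'a::euclidean_space \<Rightarrow> complex"
  assumes f: "integrable lebesgue f"
  obtains g where "integrable lborel g" "AE x in lborel. f x = g x"
proof -
  have "(\<lambda>x. Re (f x)) \<in> borel_measurable lebesgue" "(\<lambda>x. Im (f x)) \<in> borel_measurable lebesgue"
    using f by auto
  then obtain a b where a: "a \<in> borel_measurable lborel" "AE x in lborel. Re (f x) = a x"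
    and b: "b \<in> borel_measurable lborel" "AE x in lborel. Im (f x) = b x"
    using completion_ex_borel_measurable_real by metis
  define g where "g x = Complex (a x) (b x)" for x
  have "g = (\<lambda>x. of_real (a x) + \<i> * of_real (b x))" by (simp add: g_def fun_eq_iff complex_eq_iff)
  then have gm: "g \<in> borel_measurable lborel" using a(1) b(1) by simp
  have ae: "AE x in lborel. f x = g x"
    using a(2) b(2) by eventually_elim (simp add: g_def complex_eq_iff)
  have "integrable lebesgue g"
    using f gm ae
    by (subst integrable_cong_AE[of _ _ f]) (auto intro: measurable_completion AE_completion elim!: eventually_mono)
  then have "integrable lborel g" using gm by (simp add: integrable_completion)
  then show ?thesis using ae that by blast
qed

lemma set_integral_lebesgue_eq_borel:
  fixes f :: "'a::euclidean_space \<Rightarrow> complex" and \<psi> :: "'a \<Rightarrow> real"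
  assumes f: "L_loc 1 \<Omega> f" and "K \<subseteq> \<Omega>" and \<psi>: "continuous_on UNIV \<psi>" "\<And>x. x \<notin> K \<Longrightarrow> \<psi> x = 0"
    and \<Omega>: "\<Omega> \<in> sets lebesgue"
    and g: "integrable lborel g" "AE x in lborel. indicator K x *\<^sub>R f x = g x"
  shows "(LINT x:\<Omega>|lebesgue. \<psi> x *\<^sub>R f x) = (LINT x|lborel. \<psi> x *\<^sub>R g x)"
proof -
  have [measurable]: "(\<lambda>x. indicator \<Omega> x *\<^sub>R f x) \<in> borel_measurable lebesgue"
    using L_loc_measurable_on[OF f \<Omega>] by blast
  have \<psi>m: "\<psi> \<in> borel_measurable borel" using \<psi>(1) by (rule borel_measurable_continuous_onI)
  then have [measurable]: "\<psi> \<in> borel_measurable lebesgue" by (simp add: measurable_completion)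
  have gm: "(\<lambda>x. \<psi> x *\<^sub>R g x) \<in> borel_measurable lborel" using g(1) \<psi>m by auto
  have "(LINT x:\<Omega>|lebesgue. \<psi> x *\<^sub>R f x) = (LINT x|lebesgue. \<psi> x *\<^sub>R (indicator \<Omega> x *\<^sub>R f x))"
    unfolding set_lebesgue_integral_def by (simp add: mult.commute)
  also have "\<dots> = (LINT x|lebesgue. \<psi> x *\<^sub>R g x)"
  proof (rule integral_cong_AE)
    show "(\<lambda>x. \<psi> x *\<^sub>R (indicator \<Omega> x *\<^sub>R f x)) \<in> borel_measurable lebesgue" by measurable
    show "(\<lambda>x. \<psi> x *\<^sub>R g x) \<in> borel_measurable lebesgue" using gm by (rule measurable_completion)
    show "AE x in lebesgue. \<psi> x *\<^sub>R (indicator \<Omega> x *\<^sub>R f x) = \<psi> x *\<^sub>R g x"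
    proof (rule AE_completion)
      show "AE x in lborel. \<psi> x *\<^sub>R (indicator \<Omega> x *\<^sub>R f x) = \<psi> x *\<^sub>R g x"
        using g(2)
      proof eventually_elim
        fix x assume e: "indicator K x *\<^sub>R f x = g x"
        show "\<psi> x *\<^sub>R (indicator \<Omega> x *\<^sub>R f x) = \<psi> x *\<^sub>R g x"
        proof (cases "x \<in> K")
          case True
          then have "x \<in> \<Omega>" using \<open>K \<subseteq> \<Omega>\<close> by blast
          then show ?thesis using True e by simp
        qed (simp add: \<psi>(2))
      qed
    qed
  qed
  also have "\<dots> = (LINT x|lborel. \<psi> x *\<^sub>R g x)" by (rule integral_completion[OF gm])
  finally show ?thesis .
qed

lemma test_function_mono: "test_function \<Omega> \<phi> \<Longrightarrow> \<Omega> \<subseteq> \<Omega>' \<Longrightarrow> test_function \<Omega>' \<phi>"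
  by (auto simp: test_function_def)

lemma test_function_deriv:
  assumes "test_function \<Omega> \<phi>"
  shows "continuous_on UNIV \<phi>" "continuous_on UNIV (\<lambda>x. frechet_derivative \<phi> (at x) v)"
    "x \<notin> \<Omega> \<Longrightarrow> \<phi> x = 0" "x \<notin> \<Omega> \<Longrightarrow> frechet_derivative \<phi> (at x) v = 0"
proof -
  have Ck: "C_k k \<phi>" for k using assms by (simp add: test_function_def)
  show "continuous_on UNIV \<phi>" using Ck[of 0] by simp
  show "continuous_on UNIV (\<lambda>x. frechet_derivative \<phi> (at x) v)" using C_k_deriv(2)[OF Ck[of "Suc 0"], of v] by simp
  have C1: "C1 \<phi> (\<lambda>x. frechet_derivative \<phi> (at x))"
    unfolding C1_def using C_k_deriv(1)[OF Ck] C_k_deriv(2)[OF Ck, of 0] by auto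
  let ?S = "closure {x. \<phi> x \<noteq> 0}"
  have out: "\<phi> y = 0" if "y \<in> - ?S" for y using that closure_subset[of "{x. \<phi> x \<noteq> 0}"] by blast
  assume "x \<notin> \<Omega>"
  then have x: "x \<in> - ?S" using assms by (auto simp: test_function_def)
  show "\<phi> x = 0" using out[OF x] .
  show "frechet_derivative \<phi> (at x) v = 0"
    by (rule C1_zero_on_open[OF C1 _ out x]) auto
qed

text \<open>Any weak derivative serves in the proof, in particular the one selected by \<open>weak_partial\<close>.\<close>

lemma has_weak_partial_weak_partial:
  assumes "W11_loc \<Omega> f" "b \<in> Basis"
  shows "has_weak_partial \<Omega> b f (weak_partial \<Omega> b f)"
  using assms unfolding W11_loc_def weak_partial_def by (metis someI_ex)

lemma norm_le_sum_components:
  fixes x :: "complex ^ 'm"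
  shows "norm x \<le> (\<Sum>k\<in>UNIV. cmod (x $ k))"
  unfolding norm_vec_def by (rule L2_set_le_sum) simp

lemma sum_line_dbar_le_norm_dbar:
  fixes u :: "complex ^ 'n \<Rightarrow> complex ^ 'm"
  shows "(\<Sum>k\<in>UNIV. cmod (line_dbar (\<lambda>b. weak_partial \<Omega> b (\<lambda>w. u w $ k) z) \<omega>))
    \<le> real CARD('m) * (real CARD('n) * (norm \<omega> * norm_dbar \<Omega> u z))"
proof -
  let ?w = "\<lambda>j k. weak_dbar \<Omega> j (\<lambda>w. u w $ k) z"
  have le: "cmod (?w j k) \<le> norm_dbar \<Omega> u z" for j k
  proof -
    have "(cmod (?w j k))\<^sup>2 \<le> (\<Sum>k\<in>UNIV. (cmod (?w j k))\<^sup>2)" by (rule member_le_sum) auto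
    also have "\<dots> \<le> (\<Sum>j\<in>UNIV. \<Sum>k\<in>UNIV. (cmod (?w j k))\<^sup>2)"
      by (rule member_le_sum[of j UNIV "\<lambda>j. \<Sum>k\<in>UNIV. (cmod (?w j k))\<^sup>2"]) (auto intro: sum_nonneg)
    finally show ?thesis unfolding norm_dbar_def by (rule real_le_rsqrt)
  qed
  have "cmod (line_dbar (\<lambda>b. weak_partial \<Omega> b (\<lambda>w. u w $ k) z) \<omega>) \<le> real CARD('n) * (norm \<omega> * norm_dbar \<Omega> u z)" for k
  proof -
    have "line_dbar (\<lambda>b. weak_partial \<Omega> b (\<lambda>w. u w $ k) z) \<omega> = (\<Sum>j\<in>UNIV. cnj (\<omega> $ j) * ?w j k)"
      by (simp add: line_dbar_def weak_dbar_def)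
    also have "cmod \<dots> \<le> (\<Sum>(j::'n)\<in>UNIV. norm \<omega> * norm_dbar \<Omega> u z)"
    proof (rule sum_norm_le)
      fix j
      show "cmod (cnj (\<omega> $ j) * ?w j k) \<le> norm \<omega> * norm_dbar \<Omega> u z"
        unfolding norm_mult by (intro mult_mono le) (auto simp: Finite_Cartesian_Product.norm_nth_le)
    qed
    finally show ?thesis by simp
  qed
  then have "(\<Sum>k\<in>UNIV. cmod (line_dbar (\<lambda>b. weak_partial \<Omega> b (\<lambda>w. u w $ k) z) \<omega>))
      \<le> (\<Sum>(k::'m)\<in>UNIV. real CARD('n) * (norm \<omega> * norm_dbar \<Omega> u z))"
    by (intro sum_mono)
  then show ?thesis by simp
qed

lemma infinite_order_imp_weighted_integrable:
  fixes h :: "complex ^ 'n \<Rightarrow> real"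
  assumes [measurable]: "h \<in> borel_measurable borel" and h0: "\<And>x. h x \<ge> 0"
    and "\<rho> > 0" and fin: "(\<integral>\<^sup>+x\<in>ball z0 R. ennreal (h x) \<partial>lborel) < \<infinity>"
    and le: "\<And>t. 0 < t \<Longrightarrow> t \<le> \<rho> \<Longrightarrow> (\<integral>\<^sup>+x\<in>ball z0 t. ennreal (h x) \<partial>lborel) \<le> ennreal (C * t ^ Suc m)" and "C \<ge> 0"
  shows "(\<integral>\<^sup>+x\<in>ball z0 R. ennreal (h x * inverse (norm (x - z0)) ^ m) \<partial>lborel) < \<infinity>"
proof -
  have near: "(\<integral>\<^sup>+x\<in>ball z0 \<rho>. ennreal (h x) * ennreal (norm (x - z0) powr - real m) \<partial>lborel) < \<infinity>"
  proof (rule nn_integral_pole_weight_finite[where s="real (Suc m)" and C=C])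
    show "(\<integral>\<^sup>+x\<in>ball z0 t. ennreal (h x) \<partial>lborel) \<le> ennreal (C * t powr real (Suc m))" if "0 < t" "t \<le> \<rho>" for t
      using le[OF that] that(1) by (simp only: powr_realpow)
  qed (use \<open>\<rho> > 0\<close> \<open>C \<ge> 0\<close> in auto)
  have "(\<integral>\<^sup>+x\<in>ball z0 R. ennreal (h x * inverse (norm (x - z0)) ^ m) \<partial>lborel)
      \<le> (\<integral>\<^sup>+x. ennreal (h x) * ennreal (norm (x - z0) powr - real m) * indicator (ball z0 \<rho>) x
          + ennreal (inverse \<rho> ^ m) * (ennreal (h x) * indicator (ball z0 R) x) \<partial>lborel)"
  proof (rule nn_integral_mono_AE)
    have "AE x in lborel. x \<noteq> z0" by (rule AE_lborel_singleton)
    then show "AE x in lborel. ennreal (h x * inverse (norm (x - z0)) ^ m) * indicator (ball z0 R) x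
      \<le> ennreal (h x) * ennreal (norm (x - z0) powr - real m) * indicator (ball z0 \<rho>) x
          + ennreal (inverse \<rho> ^ m) * (ennreal (h x) * indicator (ball z0 R) x)"
    proof eventually_elim
      fix x assume x: "x \<noteq> z0"
      show "ennreal (h x * inverse (norm (x - z0)) ^ m) * indicator (ball z0 R) x
      \<le> ennreal (h x) * ennreal (norm (x - z0) powr - real m) * indicator (ball z0 \<rho>) x
          + ennreal (inverse \<rho> ^ m) * (ennreal (h x) * indicator (ball z0 R) x)"
      proof (cases "x \<in> ball z0 \<rho>")
        case True
        have "inverse (norm (x - z0)) ^ m = norm (x - z0) powr - real m"
          using x by (simp add: powr_minus powr_realpow power_inverse)
        then have "ennreal (h x * inverse (norm (x - z0)) ^ m) = ennreal (h x) * ennreal (norm (x - z0) powr - real m)"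
          using h0 by (simp add: ennreal_mult)
        then have "ennreal (h x * inverse (norm (x - z0)) ^ m) * indicator (ball z0 R) x
            \<le> ennreal (h x) * ennreal (norm (x - z0) powr - real m) * indicator (ball z0 \<rho>) x"
          using True by (auto simp: indicator_def)
        then show ?thesis by (rule add_increasing2[rotated]) simp
      next
        case False
        then have "\<rho> \<le> norm (x - z0)" by (simp add: dist_norm norm_minus_commute)
        then have "inverse (norm (x - z0)) ^ m \<le> inverse \<rho> ^ m"
          using \<open>\<rho> > 0\<close> x by (intro power_mono le_imp_inverse_le) auto
        then have "h x * inverse (norm (x - z0)) ^ m \<le> h x * inverse \<rho> ^ m" using h0 by (rule mult_left_mono)
        then have "ennreal (h x * inverse (norm (x - z0)) ^ m) \<le> ennreal (inverse \<rho> ^ m * h x)"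
          by (intro ennreal_leI) (simp only: mult.commute)
        also have "\<dots> = ennreal (inverse \<rho> ^ m) * ennreal (h x)" using h0 \<open>\<rho> > 0\<close> by (simp add: ennreal_mult)
        finally have "ennreal (h x * inverse (norm (x - z0)) ^ m) * indicator (ball z0 R) x
            \<le> ennreal (inverse \<rho> ^ m) * ennreal (h x) * indicator (ball z0 R) x" by (rule mult_right_mono) simp
        then show ?thesis by (simp add: mult.assoc add_increasing)
      qed
    qed
  qed
  also have "\<dots> = (\<integral>\<^sup>+x\<in>ball z0 \<rho>. ennreal (h x) * ennreal (norm (x - z0) powr - real m) \<partial>lborel)
      + (\<integral>\<^sup>+x. ennreal (inverse \<rho> ^ m) * (ennreal (h x) * indicator (ball z0 R) x) \<partial>lborel)"
    by (rule nn_integral_add) measurable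
  also have "(\<integral>\<^sup>+x. ennreal (inverse \<rho> ^ m) * (ennreal (h x) * indicator (ball z0 R) x) \<partial>lborel)
      = ennreal (inverse \<rho> ^ m) * (\<integral>\<^sup>+x\<in>ball z0 R. ennreal (h x) \<partial>lborel)"
    by (rule nn_integral_cmult) measurable
  finally show ?thesis using near fin by (auto simp: ennreal_mult_less_top elim: le_less_trans)
qed

text \<open>The hypotheses are transferred to Borel representatives.  The components of \<open>dbar u\<close> along a line
are sums of \<open>n\<close> terms and the norms are replaced by sums of absolute values, which costs the factor
\<open>c\<close> in the potential.\<close>

lemma infinite_order_imp_vanish_on_ball:
  fixes \<Omega> :: "(complex ^ 'n) set" and u :: "complex ^ 'n \<Rightarrow> complex ^ 'm" and V :: "complex ^ 'n \<Rightarrow> real"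
  assumes "open \<Omega>" and W: "\<And>k. W11_loc \<Omega> (\<lambda>z. u z $ k)"
    and p: "p > 2 * real CARD('n)" and V: "L_loc p \<Omega> V" and V0: "\<And>z. z \<in> \<Omega> \<Longrightarrow> V z \<ge> 0"
    and ineq: "AE z in lebesgue. z \<in> \<Omega> \<longrightarrow> norm_dbar \<Omega> u z \<le> V z * norm (u z)"
    and R: "0 < R" "R < R'" "cball z0 R' \<subseteq> \<Omega>"
    and van: "vanishes_to_infinite_order 1 u z0"
  shows "AE z in lebesgue. z \<in> ball z0 R \<longrightarrow> u z = 0"
proof -
  let ?K = "cball z0 R'" and ?u = "\<lambda>k z. u z $ k" and ?w = "\<lambda>k b. weak_partial \<Omega> b (\<lambda>z. u z $ k)"
  have K: "compact ?K" "?K \<subseteq> \<Omega>" using R by auto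
  have \<Omega>: "\<Omega> \<in> sets lebesgue" using \<open>open \<Omega>\<close> by simp
  have wp: "has_weak_partial \<Omega> b (?u k) (?w k b)" if "b \<in> Basis" for k b
    using has_weak_partial_weak_partial[OF W that] .
  have u_loc: "L_loc 1 \<Omega> (?u k)" for k using W by (simp add: W11_loc_def)
  have w_loc: "L_loc 1 \<Omega> (?w k b)" if "b \<in> Basis" for k b using wp[OF that] by (simp add: has_weak_partial_def)
  have "\<exists>g. integrable lborel g \<and> (AE x in lborel. indicator ?K x *\<^sub>R ?u k x = g x)" for k
    using integrable_lebesgue_complex_borel[OF L_loc_1_integrable[OF u_loc K]] by metis
  then have exU: "\<forall>k. \<exists>g. integrable lborel g \<and> (AE x in lborel. indicator ?K x *\<^sub>R ?u k x = g x)" by blast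
  from choice[OF exU] obtain U where U: "\<And>k. integrable lborel (U k)" "\<And>k. AE x in lborel. indicator ?K x *\<^sub>R ?u k x = U k x"
    by blast
  define P where "P k b g \<longleftrightarrow> integrable lborel g \<and> (AE x in lborel. indicator ?K x *\<^sub>R ?w k b x = g x)" for k b g
  have exG: "\<exists>g. P k b g" if "b \<in> Basis" for k b
    unfolding P_def using integrable_lebesgue_complex_borel[OF L_loc_1_integrable[OF w_loc[OF that] K]] by metis
  define G where "G k b = (SOME g. P k b g)" for k b
  have PG: "P k b (G k b)" if "b \<in> Basis" for k b
    unfolding G_def using exG[OF that] by (rule someI_ex)
  have G: "integrable lborel (G k b)" "AE x in lborel. indicator ?K x *\<^sub>R ?w k b x = G k b x" if "b \<in> Basis" for k b
    using PG[OF that] by (simp_all add: P_def)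
  have [measurable]: "U k \<in> borel_measurable borel" for k using U(1)[of k] by simp
  have weak: "(LINT y|lborel. frechet_derivative \<phi> (at y) b *\<^sub>R U k y) = - (LINT y|lborel. \<phi> y *\<^sub>R G k b y)"
    if b: "b \<in> Basis" and \<phi>: "test_function (ball z0 R') \<phi>" for k b \<phi>
  proof -
    note t = test_function_deriv[OF \<phi>]
    have sub: "ball z0 R' \<subseteq> ?K" by auto
    have "test_function \<Omega> \<phi>" by (rule test_function_mono[OF \<phi>]) (use sub K(2) in blast)
    then have eq: "(LINT x:\<Omega>|lebesgue. frechet_derivative \<phi> (at x) b *\<^sub>R ?u k x) = - (LINT x:\<Omega>|lebesgue. \<phi> x *\<^sub>R ?w k b x)"
      using wp[OF b] unfolding has_weak_partial_def by blast
    have "(LINT x:\<Omega>|lebesgue. frechet_derivative \<phi> (at x) b *\<^sub>R ?u k x) = (LINT y|lborel. frechet_derivative \<phi> (at y) b *\<^sub>R U k y)"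
      by (rule set_integral_lebesgue_eq_borel[OF u_loc K(2) t(2) _ \<Omega> U]) (use t(4) sub in blast)
    moreover have "(LINT x:\<Omega>|lebesgue. \<phi> x *\<^sub>R ?w k b x) = (LINT y|lborel. \<phi> y *\<^sub>R G k b y)"
      by (rule set_integral_lebesgue_eq_borel[OF w_loc[OF b] K(2) t(1) _ \<Omega> G[OF b]]) (use t(3) sub in blast)
    ultimately show ?thesis using eq by simp
  qed
  have "(\<lambda>x. indicator ?K x *\<^sub>R V x) \<in> borel_measurable lebesgue"
    using L_loc_measurable_on[OF V _ K(2)] by simp
  then obtain V1 where V1[measurable]: "V1 \<in> borel_measurable lborel" and V1': "AE x in lborel. indicator ?K x *\<^sub>R V x = V1 x"
    using completion_ex_borel_measurable_real by blast
  define c where "c = real CARD('m) * real CARD('n)"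
  have c: "c > 0" by (simp add: c_def)
  define V2 where "V2 x = c * max 0 (V1 x)" for x
  have V2[measurable]: "V2 \<in> borel_measurable borel" unfolding V2_def[abs_def] using V1 by measurable
  have V20: "V2 x \<ge> 0" for x using c by (simp add: V2_def)
  have V2_eq: "AE x in lborel. x \<in> ?K \<longrightarrow> V2 x = c * V x"
    using V1'
  proof eventually_elim
    fix x assume e: "indicator ?K x *\<^sub>R V x = V1 x"
    show "x \<in> ?K \<longrightarrow> V2 x = c * V x"
    proof
      assume "x \<in> ?K"
      then have "V1 x = V x" using e by simp
      moreover have "V x \<ge> 0" using \<open>x \<in> ?K\<close> K(2) by (intro V0) blast
      ultimately show "V2 x = c * V x" by (simp add: V2_def)
    qed
  qed
  have Vp: "(\<integral>\<^sup>+x\<in>ball z0 R. ennreal (V2 x powr p) \<partial>lborel) < \<infinity>"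
  proof -
    have "set_integrable lebesgue ?K (\<lambda>x. norm (V x) powr p)" using V K by (simp add: L_loc_def)
    then have "(\<integral>\<^sup>+x. ennreal (norm (indicator ?K x *\<^sub>R (norm (V x) powr p))) \<partial>lebesgue) < \<infinity>"
      unfolding set_integrable_def integrable_iff_bounded by blast
    then have fin: "(\<integral>\<^sup>+x. ennreal (norm (indicator ?K x *\<^sub>R (norm (V x) powr p))) \<partial>lborel) < \<infinity>"
      by (simp only: nn_integral_completion)
    have "(\<integral>\<^sup>+x\<in>ball z0 R. ennreal (V2 x powr p) \<partial>lborel) = (\<integral>\<^sup>+x\<in>ball z0 R. ennreal (c powr p * max 0 (V1 x) powr p) \<partial>lborel)"
      using c by (simp add: V2_def powr_mult)
    also have "\<dots> = (\<integral>\<^sup>+x. ennreal (c powr p) * (ennreal (max 0 (V1 x) powr p) * indicator (ball z0 R) x) \<partial>lborel)"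
      by (intro nn_integral_cong) (simp add: ennreal_mult mult.assoc)
    also have "\<dots> = ennreal (c powr p) * (\<integral>\<^sup>+x\<in>ball z0 R. ennreal (max 0 (V1 x) powr p) \<partial>lborel)"
      by (rule nn_integral_cmult) measurable
    also have "(\<integral>\<^sup>+x\<in>ball z0 R. ennreal (max 0 (V1 x) powr p) \<partial>lborel)
        \<le> (\<integral>\<^sup>+x. ennreal (norm (indicator ?K x *\<^sub>R (norm (V x) powr p))) \<partial>lborel)"
    proof (rule nn_integral_mono_AE)
      show "AE x in lborel. ennreal (max 0 (V1 x) powr p) * indicator (ball z0 R) x
          \<le> ennreal (norm (indicator ?K x *\<^sub>R (norm (V x) powr p)))"
        using V1'
      proof eventually_elim
        fix x assume e: "indicator ?K x *\<^sub>R V x = V1 x"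
        show "ennreal (max 0 (V1 x) powr p) * indicator (ball z0 R) x \<le> ennreal (norm (indicator ?K x *\<^sub>R (norm (V x) powr p)))"
        proof (cases "x \<in> ball z0 R")
          case True
          then have "x \<in> ?K" using R(2) by auto
          then have "V1 x = V x" using e by simp
          moreover have "V x \<ge> 0" using \<open>x \<in> ?K\<close> K(2) by (intro V0) blast
          ultimately show ?thesis using True \<open>x \<in> ?K\<close> by simp
        qed simp
      qed
    qed
    finally show ?thesis using fin by (auto simp: ennreal_mult_less_top mult_left_mono elim!: le_less_trans)
  qed
  have U_all: "AE x in lborel. \<forall>k. indicator ?K x *\<^sub>R ?u k x = U k x"
    using U(2) by (intro AE_finite_allI[where S=UNIV, simplified]) auto
  have G_all: "AE x in lborel. \<forall>k\<in>UNIV. \<forall>b\<in>Basis. indicator ?K x *\<^sub>R ?w k b x = G k b x"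
    using G(2) by (intro AE_finite_allI finite finite_Basis) auto
  have axB: "axis j 1 \<in> (Basis :: (complex ^ 'n) set)" "axis j \<i> \<in> (Basis :: (complex ^ 'n) set)" for j
    by (auto simp: axis_in_Basis_iff Basis_complex_def)
  have ineq': "AE x in lborel. x \<in> ball z0 R \<longrightarrow>
      (\<forall>\<omega>. (\<Sum>k\<in>UNIV. cmod (line_dbar (\<lambda>b. G k b x) \<omega>)) \<le> norm \<omega> * V2 x * (\<Sum>k\<in>UNIV. cmod (U k x)))"
    using ineq[unfolded AE_completion_iff] U_all G_all V2_eq
  proof eventually_elim
    fix x
    assume i: "x \<in> \<Omega> \<longrightarrow> norm_dbar \<Omega> u x \<le> V x * norm (u x)"
      and Ux: "\<forall>k. indicator ?K x *\<^sub>R ?u k x = U k x"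
      and Gx: "\<forall>k\<in>UNIV. \<forall>b\<in>Basis. indicator ?K x *\<^sub>R ?w k b x = G k b x"
      and Vx: "x \<in> ?K \<longrightarrow> V2 x = c * V x"
    show "x \<in> ball z0 R \<longrightarrow>
      (\<forall>\<omega>. (\<Sum>k\<in>UNIV. cmod (line_dbar (\<lambda>b. G k b x) \<omega>)) \<le> norm \<omega> * V2 x * (\<Sum>k\<in>UNIV. cmod (U k x)))"
    proof (intro impI allI)
      fix \<omega> :: "complex ^ 'n"
      assume "x \<in> ball z0 R"
      then have xK: "x \<in> ?K" using R(2) by auto
      then have x\<Omega>: "x \<in> \<Omega>" using K(2) by blast
      have Gw: "G k b x = ?w k b x" if "b \<in> Basis" for k b using Gx that xK by force
      have "line_dbar (\<lambda>b. G k b x) \<omega> = line_dbar (\<lambda>b. ?w k b x) \<omega>" for k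
        unfolding line_dbar_def by (simp add: Gw[OF axB(1)] Gw[OF axB(2)])
      then have "(\<Sum>k\<in>UNIV. cmod (line_dbar (\<lambda>b. G k b x) \<omega>)) \<le> real CARD('m) * (real CARD('n) * (norm \<omega> * norm_dbar \<Omega> u x))"
        using sum_line_dbar_le_norm_dbar[of \<Omega> u x \<omega>] by simp
      also have "\<dots> = c * norm \<omega> * norm_dbar \<Omega> u x" by (simp add: c_def)
      also have "\<dots> \<le> c * norm \<omega> * (V x * norm (u x))"
        using i x\<Omega> c by (intro mult_left_mono) auto
      also have "\<dots> \<le> c * norm \<omega> * (V x * (\<Sum>k\<in>UNIV. cmod (u x $ k)))"
        using c V0[OF x\<Omega>] by (intro mult_left_mono norm_le_sum_components) auto
      also have "\<dots> = norm \<omega> * V2 x * (\<Sum>k\<in>UNIV. cmod (U k x))"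
      proof -
        have "U k x = u x $ k" for k using Ux xK by force
        moreover have "V2 x = c * V x" using Vx xK by blast
        ultimately show ?thesis by (simp add: mult_ac)
      qed
      finally show "(\<Sum>k\<in>UNIV. cmod (line_dbar (\<lambda>b. G k b x) \<omega>)) \<le> norm \<omega> * V2 x * (\<Sum>k\<in>UNIV. cmod (U k x))" .
    qed
  qed
  define h where "h x = (\<Sum>k\<in>UNIV. cmod (U k x))" for x
  have h0: "h x \<ge> 0" for x by (auto simp: h_def intro: sum_nonneg)
  have hm[measurable]: "h \<in> borel_measurable borel" unfolding h_def[abs_def] by measurable
  have h_int: "integrable lborel h"
    unfolding h_def[abs_def] using U(1) by (intro Bochner_Integration.integrable_sum integrable_norm)
  define nu where "nu x = sqrt (\<Sum>k\<in>UNIV. (cmod (U k x))\<^sup>2)" for x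
  have [measurable]: "nu \<in> borel_measurable borel" unfolding nu_def[abs_def] by measurable
  have nu0: "nu x \<ge> 0" for x by (auto simp: nu_def intro: sum_nonneg)
  have nu_le: "nu x \<le> h x" for x
    unfolding nu_def h_def using L2_set_le_sum[of UNIV "\<lambda>k. cmod (U k x)"] by (simp add: L2_set_def)
  have h_le: "h x \<le> real CARD('m) * nu x" for x
  proof -
    have "cmod (U k x) \<le> nu x" for k
      unfolding nu_def by (rule real_le_rsqrt) (rule member_le_sum, auto)
    then have "h x \<le> (\<Sum>(k::'m)\<in>UNIV. nu x)" unfolding h_def by (intro sum_mono)
    then show ?thesis by simp
  qed
  have nu_int: "integrable lborel nu"
    by (rule Bochner_Integration.integrable_bound[OF h_int]) (use nu_le nu0 h0 in \<open>auto intro!: AE_I2\<close>)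
  define I where "I t = (LINT z:ball z0 t|lebesgue. norm (u z) powr 1)" for t
  have norm_u: "norm (u x) powr 1 = sqrt (\<Sum>k\<in>UNIV. (cmod (u x $ k))\<^sup>2)" for x
  proof -
    have "norm (u x) powr 1 = norm (u x)" by simp
    then show ?thesis unfolding norm_vec_def L2_set_def .
  qed
  have I_eq: "(\<integral>\<^sup>+x\<in>ball z0 t. ennreal (nu x) \<partial>lborel) = ennreal (I t)" if t: "t \<le> R'" for t
  proof -
    have sub: "ball z0 t \<subseteq> ?K" using t by auto
    have bm: "ball z0 t \<in> sets lebesgue" by simp
    have [measurable]: "(\<lambda>x. indicator (ball z0 t) x *\<^sub>R ?u k x) \<in> borel_measurable lebesgue" for k
      using L_loc_measurable_on[OF u_loc bm] sub K(2) by blast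
    have nb: "(\<lambda>x. indicator (ball z0 t) x *\<^sub>R nu x) \<in> borel_measurable lborel" by measurable
    have "I t = (LINT x|lebesgue. indicator (ball z0 t) x *\<^sub>R nu x)"
      unfolding I_def set_lebesgue_integral_def
    proof (rule integral_cong_AE)
      have eq: "indicator (ball z0 t) x *\<^sub>R (norm (u x) powr 1) = sqrt (\<Sum>k\<in>UNIV. (cmod (indicator (ball z0 t) x *\<^sub>R ?u k x))\<^sup>2)" for x
        unfolding norm_u by (cases "x \<in> ball z0 t") simp_all
      show "(\<lambda>x. indicator (ball z0 t) x *\<^sub>R (norm (u x) powr 1)) \<in> borel_measurable lebesgue"
        unfolding eq by measurable
      show "(\<lambda>x. indicator (ball z0 t) x *\<^sub>R nu x) \<in> borel_measurable lebesgue"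
        using nb by (rule measurable_completion)
      show "AE x in lebesgue. indicator (ball z0 t) x *\<^sub>R (norm (u x) powr 1) = indicator (ball z0 t) x *\<^sub>R nu x"
      proof (rule AE_completion)
        show "AE x in lborel. indicator (ball z0 t) x *\<^sub>R (norm (u x) powr 1) = indicator (ball z0 t) x *\<^sub>R nu x"
          using U_all
        proof eventually_elim
          fix x assume Ux: "\<forall>k. indicator ?K x *\<^sub>R ?u k x = U k x"
          show "indicator (ball z0 t) x *\<^sub>R (norm (u x) powr 1) = indicator (ball z0 t) x *\<^sub>R nu x"
          proof (cases "x \<in> ball z0 t")
            case True
            then have "U k x = u x $ k" for k using Ux sub by force
            then show ?thesis unfolding nu_def norm_u by simp
          qed simp
        qed
      qed
    qed
    also have "\<dots> = (LINT x|lborel. indicator (ball z0 t) x *\<^sub>R nu x)" by (rule integral_completion[OF nb])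
    finally have It: "I t = (LINT x|lborel. indicator (ball z0 t) x *\<^sub>R nu x)" .
    have "integrable lborel (\<lambda>x. indicator (ball z0 t) x *\<^sub>R nu x)"
      using nu_int by (intro integrable_mult_indicator) auto
    then have "(\<integral>\<^sup>+x. ennreal (indicator (ball z0 t) x *\<^sub>R nu x) \<partial>lborel) = ennreal (I t)"
      unfolding It using nu0 by (intro nn_integral_eq_integral) auto
    moreover have "ennreal (indicator (ball z0 t) x *\<^sub>R nu x) = ennreal (nu x) * indicator (ball z0 t) x" for x
      by (simp add: indicator_def)
    ultimately show ?thesis by simp
  qed
  have flat: "(\<integral>\<^sup>+x\<in>ball z0 R. ennreal (h x * inverse (norm (x - z0)) ^ m) \<partial>lborel) < \<infinity>" for m
  proof -
    have "((\<lambda>t. I t / t ^ Suc m) \<longlongrightarrow> 0) (at_right 0)"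
      using van unfolding vanishes_to_infinite_order_def I_def by (auto dest!: spec[of _ "Suc m"])
    then have "\<forall>\<^sub>F t in at_right 0. I t / t ^ Suc m < 1" by (rule order_tendstoD) simp
    then obtain \<rho>0 where \<rho>0: "\<rho>0 > 0" "\<And>t. 0 < t \<Longrightarrow> t < \<rho>0 \<Longrightarrow> I t / t ^ Suc m < 1"
      unfolding eventually_at_right_field by blast
    define \<rho> where "\<rho> = min (\<rho>0 / 2) R'"
    have \<rho>: "\<rho> > 0" "\<rho> < \<rho>0" "\<rho> \<le> R'" using \<rho>0(1) R by (auto simp: \<rho>_def)
    show ?thesis
    proof (rule infinite_order_imp_weighted_integrable[OF hm h0 \<rho>(1), of _ _ "real CARD('m)"])
      have "(\<integral>\<^sup>+x\<in>ball z0 R. ennreal (h x) \<partial>lborel) \<le> (\<integral>\<^sup>+x. ennreal (h x) \<partial>lborel)"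
        by (intro nn_integral_mono) (auto simp: indicator_def)
      also have "\<dots> = ennreal (LINT x|lborel. h x)" using h_int h0 by (intro nn_integral_eq_integral) auto
      also have "\<dots> < \<infinity>" by simp
      finally show "(\<integral>\<^sup>+x\<in>ball z0 R. ennreal (h x) \<partial>lborel) < \<infinity>" .
      show "(\<integral>\<^sup>+x\<in>ball z0 t. ennreal (h x) \<partial>lborel) \<le> ennreal (real CARD('m) * t ^ Suc m)" if t: "0 < t" "t \<le> \<rho>" for t
      proof -
        have "I t / t ^ Suc m < 1" using t \<rho>(2) by (intro \<rho>0(2)) auto
        then have It: "I t \<le> t ^ Suc m" using t(1) by (simp only: divide_less_eq_1_pos zero_less_power)
        have "(\<integral>\<^sup>+x\<in>ball z0 t. ennreal (h x) \<partial>lborel) \<le> (\<integral>\<^sup>+x. ennreal (real CARD('m)) * (ennreal (nu x) * indicator (ball z0 t) x) \<partial>lborel)"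
        proof (intro nn_integral_mono)
          fix x
          have "ennreal (h x) \<le> ennreal (real CARD('m) * nu x)" by (intro ennreal_leI h_le)
          also have "\<dots> = ennreal (real CARD('m)) * ennreal (nu x)" using nu0 by (intro ennreal_mult) auto
          finally show "ennreal (h x) * indicator (ball z0 t) x \<le> ennreal (real CARD('m)) * (ennreal (nu x) * indicator (ball z0 t) x)"
            unfolding mult.assoc[symmetric] by (rule mult_right_mono) simp
        qed
        also have "\<dots> = ennreal (real CARD('m)) * (\<integral>\<^sup>+x\<in>ball z0 t. ennreal (nu x) \<partial>lborel)"
          by (rule nn_integral_cmult) measurable
        also have "\<dots> = ennreal (real CARD('m)) * ennreal (I t)" using I_eq[of t] t \<rho>(3) by simp
        also have "\<dots> \<le> ennreal (real CARD('m)) * ennreal (t ^ Suc m)"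
          by (intro mult_left_mono ennreal_leI It) auto
        also have "\<dots> = ennreal (real CARD('m) * t ^ Suc m)" using t(1) by (intro ennreal_mult[symmetric]) auto
        finally show ?thesis .
      qed
    qed auto
  qed
  have "AE x in lborel. x \<in> ball z0 R \<longrightarrow> (\<forall>k. U k x = 0)"
  proof (rule unique_continuation_ball[OF U(1) G(1) weak R(1), where r="(R' - R) / 2" and p=p and V=V2])
    show "(R' - R) / 2 > 0" using R(2) by simp
    show "cball x ((R' - R) / 2) \<subseteq> ball z0 R'" if "x \<in> ball z0 R" for x
    proof
      fix y assume "y \<in> cball x ((R' - R) / 2)"
      then show "y \<in> ball z0 R'" using that R(2) dist_triangle[of z0 y x] by (simp add: field_simps)
    qed
    show "p > 2 * real CARD('n)" by (rule p)
    show "V2 \<in> borel_measurable borel" by (rule V2)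
    show "V2 x \<ge> 0" for x by (rule V20)
    show "(\<integral>\<^sup>+x\<in>ball z0 R. ennreal (V2 x powr p) \<partial>lborel) < \<infinity>" by (rule Vp)
    show "AE x in lborel. x \<in> ball z0 R \<longrightarrow>
      (\<forall>\<omega>. (\<Sum>k\<in>UNIV. cmod (line_dbar (\<lambda>b. G k b x) \<omega>)) \<le> norm \<omega> * V2 x * (\<Sum>k\<in>UNIV. cmod (U k x)))"
      by (rule ineq')
    show "(\<integral>\<^sup>+x\<in>ball z0 R. ennreal ((\<Sum>k\<in>UNIV. cmod (U k x)) * inverse (norm (x - z0)) ^ m) \<partial>lborel) < \<infinity>" for m
      using flat[of m] unfolding h_def .
  qed
  then have "AE x in lborel. x \<in> ball z0 R \<longrightarrow> u x = 0"
    using U_all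
  proof eventually_elim
    fix x assume z: "x \<in> ball z0 R \<longrightarrow> (\<forall>k. U k x = 0)" and Ux: "\<forall>k. indicator ?K x *\<^sub>R ?u k x = U k x"
    show "x \<in> ball z0 R \<longrightarrow> u x = 0"
    proof
      assume x: "x \<in> ball z0 R"
      then have "x \<in> ?K" using R(2) by auto
      then have "u x $ k = 0" for k using Ux z x by force
      then show "u x = 0" by (simp add: vec_eq_iff)
    qed
  qed
  then show ?thesis by (rule AE_completion)
qed

lemma vanish_near_imp_infinite_order:
  fixes u :: "'a::euclidean_space \<Rightarrow> 'b::euclidean_space"
  assumes "r > 0" "AE x in lebesgue. x \<in> ball z r \<longrightarrow> u x = 0"
  shows "vanishes_to_infinite_order 1 u z"
proof -
  have I0: "(LINT x:ball z t|lebesgue. norm (u x) powr 1) = 0" if "t < r" for t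
  proof -
    have "AE x in lebesgue. indicator (ball z t) x *\<^sub>R (norm (u x) powr 1) = 0"
      using assms(2) by eventually_elim (use that in \<open>auto simp: indicator_def\<close>)
    then show ?thesis unfolding set_lebesgue_integral_def by (rule integral_eq_zero_AE)
  qed
  show ?thesis
    unfolding vanishes_to_infinite_order_def
  proof (intro allI impI)
    fix m :: nat
    have "\<forall>\<^sub>F t in at_right (0::real). (LINT x:ball z t|lebesgue. norm (u x) powr 1) / t ^ m = 0"
      unfolding eventually_at_right_field
    proof (intro exI[of _ r] conjI allI impI)
      show "r > 0" by (rule assms(1))
      fix t assume "t < r"
      then show "(LINT x:ball z t|lebesgue. norm (u x) powr 1) / t ^ m = 0" by (simp only: I0 div_0)
    qed
    then show "((\<lambda>t::real. (LINT x:ball z t|lebesgue. norm (u x) powr 1) / t ^ m) \<longlongrightarrow> 0) (at_right 0)"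
      by (rule tendsto_eventually)
  qed
qed

lemma locally_AE_imp_AE:
  fixes \<Omega> :: "'a::euclidean_space set"
  assumes "\<And>x. x \<in> \<Omega> \<Longrightarrow> \<exists>r>0. AE y in lebesgue. y \<in> ball x r \<longrightarrow> P y"
  shows "AE x in lebesgue. x \<in> \<Omega> \<longrightarrow> P x"
proof -
  let ?S = "{x \<in> \<Omega>. \<not> P x}"
  have "negligible ?S"
  proof (subst locally_negligible_alt, intro ballI)
    fix x assume x: "x \<in> ?S"
    then have "x \<in> \<Omega>" by simp
    from assms[OF this] obtain r where r: "r > 0" "AE y in lebesgue. y \<in> ball x r \<longrightarrow> P y"
      by (elim exE conjE)
    obtain N where N: "{y \<in> space lebesgue. \<not> (y \<in> ball x r \<longrightarrow> P y)} \<subseteq> N" "N \<in> null_sets lebesgue"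
      using r(2) unfolding eventually_ae_filter by blast
    have "negligible (?S \<inter> ball x r)"
      by (rule negligible_subset[of N]) (use N in \<open>auto simp: negligible_iff_null_sets\<close>)
    moreover have "openin (top_of_set ?S) (?S \<inter> ball x r)" by (simp add: openin_open_Int)
    moreover have "x \<in> ?S \<inter> ball x r" using x r(1) by simp
    ultimately show "\<exists>U. openin (top_of_set ?S) U \<and> x \<in> U \<and> negligible U" by blast
  qed
  then have "?S \<in> null_sets lebesgue" by (simp add: negligible_iff_null_sets)
  then have "AE x in lebesgue. x \<notin> ?S" by (rule AE_not_in)
  then show ?thesis by eventually_elim auto
qed

theorem theorem1p1:
  fixes \<Omega> :: "(complex ^ 'n) set"
    and u :: "complex ^ 'n \<Rightarrow> complex ^ 'm"
    and V :: "complex ^ 'n \<Rightarrow> real"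
    and p :: real
    and z0 :: "complex ^ 'n"
  assumes "\<Omega> \<noteq> {}" and "open \<Omega>" and "connected \<Omega>"
    and "\<forall>k. W11_loc \<Omega> (\<lambda>z. u z $ k)"
    and "p > 2 * real CARD('n)"
    and "L_loc p \<Omega> V"
    and "\<forall>z\<in>\<Omega>. V z \<ge> 0"
    and "AE z in lebesgue. z \<in> \<Omega> \<longrightarrow> norm_dbar \<Omega> u z \<le> V z * norm (u z)"
    and "z0 \<in> \<Omega>"
    and "vanishes_to_infinite_order 1 u z0"
  shows "AE z in lebesgue. z \<in> \<Omega> \<longrightarrow> u z = 0"
proof -
  define vanish where "vanish z r \<longleftrightarrow> (AE x in lebesgue. x \<in> ball z r \<longrightarrow> u x = 0)" for z r
  have propagate: "vanish z R" if "vanishes_to_infinite_order 1 u z" "0 < R" "R < R'" "cball z R' \<subseteq> \<Omega>" for z R R'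
    unfolding vanish_def
    by (rule infinite_order_imp_vanish_on_ball[OF assms(2) _ assms(5,6) _ assms(8) that(2,3,4,1)])
       (use assms(4,7) in auto)
  define Z where "Z = {z \<in> \<Omega>. \<exists>r>0. vanish z r}"
  have mono: "vanish x s" if "vanish z r" "ball x s \<subseteq> ball z r" for x z r s
    using that(1) unfolding vanish_def by eventually_elim (use that(2) in blast)
  have ball_room: "\<exists>\<rho>>0. cball z (4 * \<rho>) \<subseteq> \<Omega>" if z: "z \<in> \<Omega>" for z
  proof -
    obtain e where "e > 0" "cball z e \<subseteq> \<Omega>" using open_contains_cball[THEN iffD1, OF assms(2)] z by blast
    then show ?thesis by (intro exI[of _ "e / 4"]) auto
  qed
  have z0: "z0 \<in> Z"
  proof -
    obtain \<rho> where \<rho>: "\<rho> > 0" "cball z0 (4 * \<rho>) \<subseteq> \<Omega>" using ball_room[OF assms(9)] by blast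
    then have "vanish z0 \<rho>" by (intro propagate[OF assms(10), of \<rho> "4 * \<rho>"]) auto
    then show ?thesis using \<rho>(1) assms(9) by (auto simp: Z_def)
  qed
  have "open Z"
    unfolding open_contains_ball
  proof
    fix z assume "z \<in> Z"
    then obtain r where r: "z \<in> \<Omega>" "r > 0" "vanish z r" by (auto simp: Z_def)
    obtain e where e: "e > 0" "ball z e \<subseteq> \<Omega>" using open_contains_ball[THEN iffD1, OF assms(2)] r(1) by blast
    define s where "s = min (r / 2) e"
    have s: "s > 0" "s \<le> r / 2" "s \<le> e" using r(2) e(1) by (simp_all add: s_def)
    have "ball z s \<subseteq> Z"
    proof
      fix x assume x: "x \<in> ball z s"
      have "ball x (r / 2) \<subseteq> ball z r"
      proof
        fix y assume "y \<in> ball x (r / 2)"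
        then have "dist x y < r / 2" "dist z x < s" using x by simp_all
        then have "dist z y < r" using s(2) dist_triangle[of z y x] by linarith
        then show "y \<in> ball z r" by simp
      qed
      then have "vanish x (r / 2)" by (rule mono[OF r(3)])
      moreover have "x \<in> \<Omega>" using x e(2) s(3) by (intro subsetD[OF e(2)]) simp
      moreover have "r / 2 > 0" using r(2) by simp
      ultimately show "x \<in> Z" unfolding Z_def by blast
    qed
    then show "\<exists>e>0. ball z e \<subseteq> Z" using s(1) by blast
  qed
  moreover have "open (\<Omega> - Z)"
    unfolding open_contains_ball
  proof
    fix z assume z: "z \<in> \<Omega> - Z"
    then obtain \<rho> where \<rho>: "\<rho> > 0" "cball z (4 * \<rho>) \<subseteq> \<Omega>" using ball_room by blast
    \<comment> \<open>If \<open>u\<close> vanished near \<open>x\<close>, it would vanish on the ball of radius \<open>2 \<rho>\<close> about \<open>x\<close>, which contains \<open>z\<close> in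
      its interior.\<close>
    have "x \<notin> Z" if x: "x \<in> ball z \<rho>" for x
    proof
      assume "x \<in> Z"
      then obtain r where "r > 0" "vanish x r" by (auto simp: Z_def)
      then have "vanishes_to_infinite_order 1 u x"
        unfolding vanish_def by (rule vanish_near_imp_infinite_order)
      moreover have "cball x (3 * \<rho>) \<subseteq> \<Omega>"
      proof
        fix y assume "y \<in> cball x (3 * \<rho>)"
        then have "y \<in> cball z (4 * \<rho>)" using x dist_triangle[of z y x] by auto
        then show "y \<in> \<Omega>" using \<rho>(2) by blast
      qed
      ultimately have "vanish x (2 * \<rho>)" using \<rho>(1) by (intro propagate[of x "2 * \<rho>" "3 * \<rho>"]) auto
      moreover have "ball z \<rho> \<subseteq> ball x (2 * \<rho>)"
      proof
        fix y assume "y \<in> ball z \<rho>"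
        then show "y \<in> ball x (2 * \<rho>)" using x dist_triangle[of x y z] by (auto simp: dist_commute)
      qed
      ultimately have "vanish z \<rho>" by (rule mono)
      then show False using z \<rho>(1) by (auto simp: Z_def)
    qed
    moreover have "ball z \<rho> \<subseteq> \<Omega>" using \<rho> by (auto intro!: subsetD[OF \<rho>(2)])
    ultimately show "\<exists>e>0. ball z e \<subseteq> \<Omega> - Z" using \<rho>(1) by blast
  qed
  ultimately have "Z \<inter> \<Omega> = {} \<or> (\<Omega> - Z) \<inter> \<Omega> = {}"
    using connectedD[OF assms(3), of Z "\<Omega> - Z"] by blast
  then have "\<Omega> \<subseteq> Z" using z0 assms(9) by blast
  then show ?thesis
    by (intro locally_AE_imp_AE) (auto simp: Z_def vanish_def)
qed

end
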